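(* Let $(S,o)$ be a smooth germ of surface, $L$ a smooth branch on $(S,o)$ and $C$ a reduced germ of curve on $(S,o)$ which does not contain the branch $L$ in its support. Then the toroidal pseudo-resolution algorithm applied to $(S,o)$, $L$, $C$ stops after a finite number of iterations.
   Context: $(S,o)$ is a germ of smooth complex surface. A curve singularity (germ of curve) on $(S,o)$ is a formal germ of effective divisor, defined by some $f\in\hat{\mathcal O}_{S,o}\simeq\mathbb C[[x,y]]$; it is a branch if $f$ is irreducible. A cross is an ordered pair $(L,L')$ of transversal smooth branches; coordinates $(x,y)$ define it if $L=Z(x)$, $L'=Z(y)$. **Newton modification.** Let $(x,y)$ define the cross $(L,L')$ and let $f\in\mathbb C[[x,y]]$ define $C$. The Newton polygon $\mathcal N_{L,L'}(C)$ is the convex hull of $\mathrm{Supp}(f)+\mathbb R_+^2$ in $M_{\mathbb R}\simeq\mathbb R^2$, $M$ being the lattice of exponents of monomials in $(x,y)$. Let $N$ be the dual lattice, with dual basis $(e_1,e_2)$, and $\sigma_0=\mathbb R_+e_1+\mathbb R_+e_2$. The Newton fan $\mathcal F_{L,L'}(C)$ is the fan subdividing $\sigma_0$ along the rays orthogonal to the compact edges of $\mathcal N_{L,L'}(C)$. Identifying $(S,o)$ with $(\mathbb C^2,0)$ by $(x,y)$, the toric modification $X_{\mathcal F_{L,L'}(C)}\to\mathbb C^2$ defines the Newton modification $\psi^C_{L,L'}:S_{\mathcal F_{L,L'}(C)}\to S$, depending only on $C$ and $(L,L')$; its boundary $\partial S_{\mathcal F_{L,L'}(C)}$ is the reduced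 preimage of $L+L'$. **Algorithm** (non-deterministic, because of the choices made at STEP 2). Input: $(S,o)$, a smooth branch $L$, a reduced $C$ not containing $L$. STEP 1: if $(L,C)$ is a cross, then STOP. STEP 2: choose a smooth branch $L'$ on $(S,o)$, possibly included in $C$, such that $(L,L')$ is a cross. STEP 3: let $\mathcal F_{L,L'}(C)$ be the Newton fan of $C$ relative to the cross $(L,L')$; consider the associated Newton modification $\psi_{L,L'}^C$ and the strict transform $C_{L,L'}$ of $C$ by it. STEP 4: for each point $\tilde o$ belonging to $C_{L,L'}\cap\partial S_{\mathcal F_{L,L'}(C)}$, denote: $L:=$ the germ of $\partial S_{\mathcal F_{L,L'}(C)}$ at $\tilde o$; $C:=$ the germ of $C_{L,L'}$ at $\tilde o$; $o:=\tilde o$; $S:=S_{\mathcal F_{L,L'}(C)}$. STEP 5: go to STEP 1. *)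

theory Defs
  imports "HOL-Analysis.Analysis" "HOL-Computational_Algebra.Computational_Algebra"
begin

text \<open>
  A smooth germ of surface \<open>(S, o)\<close> enters through its completed local ring, which is identified
  with the ring of formal power series in two variables by a choice of formal local coordinates.
  A germ of curve is represented by a defining series, so that two associated series
  represent the same germ; a unit represents the zero divisor.
\<close>

type_synonym series2 = "complex fps fps"

text \<open>The coefficient of \<open>x\<^sup>i y\<^sup>j\<close>; the outer variable is \<open>y\<close>.\<close>

definition coeff2 :: "series2 \<Rightarrow> nat \<Rightarrow> nat \<Rightarrow> complex" where
  "coeff2 f i j = fps_nth (fps_nth f j) i"

text \<open>
  The series \<open>g(X, Y)\<close>, for \<open>X\<close> and \<open>Y\<close> without constant term. The product \<open>X\<^sup>i Y\<^sup>j\<close> has no term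
  of degree less than \<open>i + j\<close>, hence the bounds of the sums.
\<close>

definition subst2 :: "series2 \<Rightarrow> series2 \<Rightarrow> series2 \<Rightarrow> series2" where
  "subst2 g X Y = Abs_fps (\<lambda>b. Abs_fps (\<lambda>a.
     \<Sum>i\<le>a + b. \<Sum>j\<le>a + b. coeff2 g i j * coeff2 (X ^ i * Y ^ j) a b))"

definition subst1 :: "series2 \<Rightarrow> complex fps \<Rightarrow> complex fps \<Rightarrow> complex fps" where
  "subst1 g X Y = Abs_fps (\<lambda>k.
     \<Sum>i\<le>k. \<Sum>j\<le>k. coeff2 g i j * fps_nth (X ^ i * Y ^ j) k)"

definition jacobian0 :: "series2 \<Rightarrow> series2 \<Rightarrow> complex" where
  "jacobian0 f g = coeff2 f 1 0 * coeff2 g 0 1 - coeff2 f 0 1 * coeff2 g 1 0"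

definition same_curve :: "series2 \<Rightarrow> series2 \<Rightarrow> bool" where
  "same_curve f g \<longleftrightarrow> f dvd g \<and> g dvd f"

definition branch :: "series2 \<Rightarrow> bool" where
  "branch f \<longleftrightarrow> irreducible f"

definition smooth_branch :: "series2 \<Rightarrow> bool" where
  "smooth_branch f \<longleftrightarrow> branch f \<and> (coeff2 f 1 0 \<noteq> 0 \<or> coeff2 f 0 1 \<noteq> 0)"

definition cross :: "series2 \<Rightarrow> series2 \<Rightarrow> bool" where
  "cross L L' \<longleftrightarrow> smooth_branch L \<and> smooth_branch L' \<and> jacobian0 L L' \<noteq> 0"

text \<open>
  \<open>g\<close> is the expansion of \<open>C\<close> in some coordinates \<open>(x, y)\<close> defining the cross \<open>(L, L')\<close>.
\<close>

definition expansion_in_cross :: "series2 \<Rightarrow> series2 \<Rightarrow> series2 \<Rightarrow> series2 \<Rightarrow> bool" where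
  "expansion_in_cross L L' C g \<longleftrightarrow>
     cross L L' \<and> (\<exists>x y. same_curve x L \<and> same_curve y L' \<and> C = subst2 g x y)"


section \<open>Newton polygon and Newton fan\<close>

text \<open>
  The lattices \<open>M\<close> (of exponents) and \<open>N\<close> are both \<open>int \<times> int\<close>, their real extensions are both
  \<open>real \<times> real\<close>, and the duality pairing is the standard inner product.
\<close>

definition newton_polygon :: "series2 \<Rightarrow> (real \<times> real) set" where
  "newton_polygon g =
     convex hull {(real i + s, real j + t) | i j s t. coeff2 g i j \<noteq> 0 \<and> 0 \<le> s \<and> 0 \<le> t}"

definition sigma0 :: "(real \<times> real) set" where
  "sigma0 = {n. 0 \<le> fst n \<and> 0 \<le> snd n}"

definition orthogonal_ray :: "(real \<times> real) set \<Rightarrow> (real \<times> real) set" where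
  "orthogonal_ray e = {n \<in> sigma0. \<forall>p\<in>e. \<forall>q\<in>e. n \<bullet> (p - q) = 0}"

definition newton_rays :: "series2 \<Rightarrow> (real \<times> real) set set" where
  "newton_rays g =
     {{(t, 0) | t. 0 \<le> t}, {(0, t) | t. 0 \<le> t}} \<union>
     {orthogonal_ray e | e. e edge_of newton_polygon g \<and> compact e}"

definition cone_sum :: "(real \<times> real) set \<Rightarrow> (real \<times> real) set \<Rightarrow> (real \<times> real) set" where
  "cone_sum A B = {a + b | a b. a \<in> A \<and> b \<in> B}"

text \<open>The two-dimensional cones are those spanned by two consecutive rays.\<close>

definition newton_fan :: "series2 \<Rightarrow> (real \<times> real) set set" where
  "newton_fan g =
     {{0}} \<union> newton_rays g \<union>
     {cone_sum A B | A B. A \<in> newton_rays g \<and> B \<in> newton_rays g \<and> A \<noteq> B \<and>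
        (\<forall>R\<in>newton_rays g. R \<subseteq> cone_sum A B \<longrightarrow> R = A \<or> R = B)}"


section \<open>Toric surfaces\<close>

definition pairing :: "real \<times> real \<Rightarrow> int \<times> int \<Rightarrow> real" where
  "pairing n m = n \<bullet> (real_of_int (fst m), real_of_int (snd m))"

definition dual_monoid :: "(real \<times> real) set \<Rightarrow> (int \<times> int) set" where
  "dual_monoid \<tau> = {m. \<forall>n\<in>\<tau>. 0 \<le> pairing n m}"

definition perp :: "(real \<times> real) set \<Rightarrow> (int \<times> int) set" where
  "perp \<tau> = {m. \<forall>n\<in>\<tau>. pairing n m = 0}"

definition monoid_hom_on :: "(int \<times> int) set \<Rightarrow> (int \<times> int \<Rightarrow> 'a :: comm_monoid_mult) \<Rightarrow> bool" where
  "monoid_hom_on D \<phi> \<longleftrightarrow> \<phi> 0 = 1 \<and> (\<forall>m\<in>D. \<forall>m'\<in>D. \<phi> (m + m') = \<phi> m * \<phi> m')"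

text \<open>
  The closed points of the affine toric surface of a cone \<open>\<tau>\<close> are the monoid homomorphisms
  from \<open>dual_monoid \<tau>\<close> to the multiplicative monoid of complex numbers, and those of its
  smallest orbit are the homomorphisms which vanish exactly outside \<open>perp \<tau>\<close>. The toric surface
  of a fan is the disjoint union of the smallest orbits attached to the cones of the fan: a point is
  given by its cone and its homomorphism, the latter extended by zero to the whole lattice \<open>M\<close>.
\<close>

type_synonym toric_point = "(real \<times> real) set \<times> (int \<times> int \<Rightarrow> complex)"

definition toric_points :: "(real \<times> real) set set \<Rightarrow> toric_point set" where
  "toric_points F =
     {(\<tau>, \<phi>). \<tau> \<in> F \<and> monoid_hom_on (dual_monoid \<tau>) \<phi> \<and> {m. \<phi> m \<noteq> 0} = perp \<tau>}"

text \<open>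
  The toric modification sends \<open>(\<tau>, \<phi>)\<close> to \<open>(\<phi> (1, 0), \<phi> (0, 1))\<close>. Over the germ \<open>(S, o)\<close>, the closed
  points of the boundary are the points lying over \<open>o\<close>: the preimages of the germs \<open>L\<close> and \<open>L'\<close> meet
  the fibre over \<open>o\<close> and have no closed point outside it.
\<close>

definition boundary_points :: "series2 \<Rightarrow> toric_point set" where
  "boundary_points g =
     {(\<tau>, \<phi>) \<in> toric_points (newton_fan g). \<phi> (1, 0) = 0 \<and> \<phi> (0, 1) = 0}"

text \<open>A formal arc on the toric surface, with origin \<open>p\<close>, given by the pullbacks of the monomials.\<close>

definition arc_at :: "toric_point \<Rightarrow> (int \<times> int \<Rightarrow> complex fps) \<Rightarrow> bool" where
  "arc_at p \<alpha> \<longleftrightarrow> monoid_hom_on (dual_monoid (fst p)) \<alpha> \<and>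
     (\<forall>m\<in>dual_monoid (fst p). fps_nth (\<alpha> m) 0 = snd p m)"

text \<open>
  Formal local coordinates of the toric surface at \<open>p\<close>, given by the expansions \<open>\<Phi> m\<close> of the
  monomials. The condition on the Jacobian says that the regular functions vanishing at \<open>p\<close>
  generate the maximal ideal of the ring of power series. Thus the map from the completed local
  ring at \<open>p\<close> to the ring of power series is surjective, hence bijective, its source being a
  two-dimensional domain. Such a \<open>\<Phi>\<close> exists if and only if the toric surface is smooth at \<open>p\<close>.
\<close>

definition coordinates_at :: "toric_point \<Rightarrow> (int \<times> int \<Rightarrow> series2) \<Rightarrow> bool" where
  "coordinates_at p \<Phi> \<longleftrightarrow> monoid_hom_on (dual_monoid (fst p)) \<Phi> \<and>
     (\<forall>m\<in>dual_monoid (fst p). coeff2 (\<Phi> m) 0 0 = snd p m) \<and>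
     (\<exists>m\<in>dual_monoid (fst p). \<exists>m'\<in>dual_monoid (fst p). jacobian0 (\<Phi> m) (\<Phi> m') \<noteq> 0)"


section \<open>Strict transform and boundary\<close>

text \<open>
  The strict transform is the closure of the preimage of \<open>C\<close> minus \<open>L + L'\<close>. When \<open>C\<close> contains
  \<open>L'\<close>, the strict transform of \<open>L'\<close> is a component of the boundary and is therefore not part of it.
  A boundary point belongs to this closure if and only if it is the origin of an arc lying over
  \<open>C\<close>, whose generic point is outside the boundary.
\<close>

definition strict_transform_boundary_points :: "series2 \<Rightarrow> toric_point set" where
  "strict_transform_boundary_points g =
     {p \<in> boundary_points g. \<exists>\<alpha>. arc_at p \<alpha> \<and> \<alpha> (1, 0) \<noteq> 0 \<and> \<alpha> (0, 1) \<noteq> 0 \<and>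
        subst1 g (\<alpha> (1, 0)) (\<alpha> (0, 1)) = 0}"

text \<open>\<open>B\<close> defines the reduced preimage of \<open>L + L'\<close>, in the coordinates \<open>\<Phi>\<close>.\<close>

definition boundary_germ :: "(int \<times> int \<Rightarrow> series2) \<Rightarrow> series2 \<Rightarrow> bool" where
  "boundary_germ \<Phi> B \<longleftrightarrow> squarefree B \<and> B dvd \<Phi> (1, 0) * \<Phi> (0, 1) \<and>
     (\<exists>k. \<Phi> (1, 0) * \<Phi> (0, 1) dvd B ^ k)"

text \<open>
  \<open>D\<close> defines the divisor obtained from the total transform of \<open>C\<close>, in the coordinates \<open>\<Phi>\<close>, by
  removing all the components of the boundary \<open>B\<close>.
\<close>

definition strict_transform_germ ::
    "series2 \<Rightarrow> (int \<times> int \<Rightarrow> series2) \<Rightarrow> series2 \<Rightarrow> series2 \<Rightarrow> bool" where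
  "strict_transform_germ g \<Phi> B D \<longleftrightarrow>
     (\<exists>E k. subst2 g (\<Phi> (1, 0)) (\<Phi> (0, 1)) = D * E \<and> E dvd B ^ k) \<and>
     (\<forall>q. q dvd D \<and> q dvd B \<longrightarrow> q dvd 1)"

definition new_input_at :: "series2 \<Rightarrow> toric_point \<Rightarrow> series2 \<Rightarrow> series2 \<Rightarrow> bool" where
  "new_input_at g p B D \<longleftrightarrow>
     (\<exists>\<Phi>. coordinates_at p \<Phi> \<and> boundary_germ \<Phi> B \<and> strict_transform_germ g \<Phi> B D)"


section \<open>The algorithm\<close>

text \<open>
  \<open>algorithm_stops L C\<close>: whatever the choices of \<open>L'\<close>, the tree of iterations issued from the
  input \<open>(L, C)\<close> is finite. Being inductive, the predicate excludes infinite sequences of successive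
  iterations; each iteration has to be possible (\<open>L'\<close> exists, and the points to be treated are smooth
  points of the new surface) and to issue only finitely many new ones.
\<close>

inductive algorithm_stops :: "series2 \<Rightarrow> series2 \<Rightarrow> bool" where
  stop: "cross L C \<Longrightarrow> algorithm_stops L C"
| iterate: "\<lbrakk>\<not> cross L C;
    \<exists>L'. cross L L';
    \<And>L' g. expansion_in_cross L L' C g \<Longrightarrow> finite (strict_transform_boundary_points g);
    \<And>L' g p. \<lbrakk>expansion_in_cross L L' C g; p \<in> strict_transform_boundary_points g\<rbrakk> \<Longrightarrow>
      \<exists>B D. new_input_at g p B D;
    \<And>L' g p B D. \<lbrakk>expansion_in_cross L L' C g; p \<in> strict_transform_boundary_points g;
      new_input_at g p B D\<rbrakk> \<Longrightarrow> algorithm_stops B D\<rbrakk>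
  \<Longrightarrow> algorithm_stops L C"

end

(*
  Let d be the intersection number of L and C. In coordinates (x, y) of a cross, C is given by a series
  g with g(0, y) of order d. A point of the strict transform lies on the orbit of a primitive vector
  (p, q); near it x = u^p W^b and y = u^q W^a with a p - b q = 1 and W = c + v, so that g = u^M h. The
  series h(0, v) is W^e times a polynomial in W whose degree is the lattice length of the edge orthogonal
  to (p, q), and p times this length is the height of the edge, which is at most d. Hence the new
  intersection number is at most d, with equality only if p = 1 and the edge joins (q d, 0) to (0, d).

  In that case, consider the order of contact of C with smooth branches transversal to L: the largest N
  such that C belongs to the ideal (z^d, L^N) for some coordinate z. If h is in (z^d, u^N), then pushing z
  down gives g in (z'^d, x^(N + 1)), so the contact drops at each step. For d > 1 it is finite, because
  infinite contact produces a smooth branch whose d-th power divides C.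

  Reducedness is carried along as the condition that a power of L belongs to the ideal generated
  by C and its partial derivatives. The chain rule makes this condition stable, and for a squarefree C it
  follows from Weierstrass preparation and a Bezout relation between a polynomial and its derivative.
*)

theory Submission
  imports Defs
begin

section \<open>Power series in two variables and substitution\<close>


text \<open>Every choice of \<open>L'\<close> and of coordinates is quantified universally, so the
  descent may rest only on quantities attached to the germs themselves: \<open>contact\<close> and
  \<open>jacobian_power\<close> mention \<open>L\<close> and \<open>C\<close> alone and are
  invariant under units and coordinate changes. Squarefreeness is awkward to carry along, because a
  factorisation of the strict transform on one chart does not descend to a factorisation of
  \<open>C\<close>. Membership of a power of \<open>L\<close> in an ideal can instead be pulled back
  directly, and the exceptional factors that appear are powers of the new \<open>L\<close>. The
  toric surface of the Newton fan may be singular at the fixed points of the two-dimensional cones.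
  Arcs decide which points matter: along an arc on \<open>C\<close> the lowest terms of
  \<open>g\<close> cancel, so the order vector of the arc is orthogonal to an edge and the origin of
  the arc lies on the orbit of a ray, where a unimodular chart exists.\<close>

definition Abs2 :: "(nat \<Rightarrow> nat \<Rightarrow> complex) \<Rightarrow> series2" where
  "Abs2 c = Abs_fps (\<lambda>j. Abs_fps (\<lambda>i. c i j))"

definition vx :: series2 where "vx = fps_const fps_X"
definition vy :: series2 where "vy = fps_X"
definition cst :: "complex \<Rightarrow> series2" where "cst c = fps_const (fps_const c)"

lemma coeff2_Abs2 [simp]: "coeff2 (Abs2 c) i j = c i j"
  by (simp add: coeff2_def Abs2_def)

lemma series2_eqI: "(\<And>i j. coeff2 f i j = coeff2 g i j) \<Longrightarrow> f = g"
  by (simp add: coeff2_def fps_eq_iff)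

lemma coeff2_0 [simp]: "coeff2 0 i j = 0"
  and coeff2_add [simp]: "coeff2 (f + g) i j = coeff2 f i j + coeff2 g i j"
  and coeff2_diff [simp]: "coeff2 (f - g) i j = coeff2 f i j - coeff2 g i j"
  and coeff2_uminus [simp]: "coeff2 (- f) i j = - coeff2 f i j"
  by (simp_all add: coeff2_def)

lemma coeff2_sum: "coeff2 (sum f A) i j = (\<Sum>a\<in>A. coeff2 (f a) i j)"
  by (induction A rule: infinite_finite_induct) auto

lemma coeff2_1: "coeff2 1 i j = (if i = 0 \<and> j = 0 then 1 else 0)"
  by (simp add: coeff2_def)

lemma coeff2_cst: "coeff2 (cst c) i j = (if i = 0 \<and> j = 0 then c else 0)"
  by (auto simp: coeff2_def cst_def)

lemma coeff2_vx: "coeff2 vx i j = (if i = 1 \<and> j = 0 then 1 else 0)"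
  by (simp add: coeff2_def vx_def)

lemma coeff2_vy: "coeff2 vy i j = (if i = 0 \<and> j = 1 then 1 else 0)"
  by (auto simp: coeff2_def vy_def)

lemma coeff2_mult:
  "coeff2 (f * g) a b = (\<Sum>j\<le>b. \<Sum>i\<le>a. coeff2 f i j * coeff2 g (a - i) (b - j))"
  by (simp add: coeff2_def fps_mult_nth fps_sum_nth atLeast0AtMost)

lemma coeff2_mult_00 [simp]: "coeff2 (f * g) 0 0 = coeff2 f 0 0 * coeff2 g 0 0"
  by (simp add: coeff2_mult)

lemma coeff2_power_00 [simp]: "coeff2 (f ^ n) 0 0 = coeff2 f 0 0 ^ n"
  by (induction n) (auto simp: coeff2_1)

lemma coeff2_mult_10: "coeff2 (f * g) 1 0 = coeff2 f 0 0 * coeff2 g 1 0 + coeff2 f 1 0 * coeff2 g 0 0"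
  by (simp add: coeff2_mult atMost_Suc)

lemma coeff2_mult_01: "coeff2 (f * g) 0 1 = coeff2 f 0 0 * coeff2 g 0 1 + coeff2 f 0 1 * coeff2 g 0 0"
  by (simp add: coeff2_mult atMost_Suc)

lemma coeff2_cst_mult [simp]: "coeff2 (cst c * f) i j = c * coeff2 f i j"
  by (simp add: coeff2_def cst_def)

lemma coeff2_vx_power_mult: "coeff2 (vx ^ n * f) i j = (if i < n then 0 else coeff2 f (i - n) j)"
  by (simp add: coeff2_def vx_def fps_const_power fps_X_power_mult_nth)

lemma coeff2_vy_power_mult: "coeff2 (vy ^ n * f) i j = (if j < n then 0 else coeff2 f i (j - n))"
  by (simp add: coeff2_def vy_def fps_X_power_mult_nth)

lemma cst_mult: "cst (a * b) = cst a * cst b"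
  by (simp add: cst_def)

definition mon :: "nat \<Rightarrow> nat \<Rightarrow> complex \<Rightarrow> series2" where
  "mon i j c = cst c * (vx ^ i * vy ^ j)"

lemma coeff2_mon: "coeff2 (mon i j c) a b = (if a = i \<and> b = j then c else 0)"
proof -
  have "coeff2 (vx ^ i * vy ^ j) a b = (if a = i \<and> b = j then 1 else 0)"
    using coeff2_vy_power_mult[of j 1] by (auto simp: coeff2_vx_power_mult coeff2_1)
  then show ?thesis by (simp add: mon_def)
qed

lemma mon_mult: "mon i j c * mon k l d = mon (i + k) (j + l) (c * d)"
  by (simp add: mon_def cst_mult power_add algebra_simps)

text \<open>Membership in the power \<open>n\<close> of the maximal ideal. This filtration replaces
  a topology: convergence and equality of series are checked degree by degree, see
  \<open>ord_ge_eqI\<close>.\<close>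

definition ord_ge :: "nat \<Rightarrow> series2 \<Rightarrow> bool" where
  "ord_ge n f \<longleftrightarrow> (\<forall>i j. i + j < n \<longrightarrow> coeff2 f i j = 0)"

lemma ord_ge_0 [simp]: "ord_ge 0 f" "ord_ge n 0"
  by (simp_all add: ord_ge_def)

lemma ord_ge_add: "ord_ge n f \<Longrightarrow> ord_ge n g \<Longrightarrow> ord_ge n (f + g)"
  and ord_ge_diff: "ord_ge n f \<Longrightarrow> ord_ge n g \<Longrightarrow> ord_ge n (f - g)"
  by (simp_all add: ord_ge_def)

lemma ord_ge_sum: "(\<And>a. a \<in> A \<Longrightarrow> ord_ge n (f a)) \<Longrightarrow> ord_ge n (sum f A)"
  by (simp add: ord_ge_def coeff2_sum)

lemma ord_ge_mono: "ord_ge n f \<Longrightarrow> m \<le> n \<Longrightarrow> ord_ge m f"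
  by (simp add: ord_ge_def)

lemma ord_ge_mult:
  assumes "ord_ge m f" "ord_ge n g"
  shows "ord_ge (m + n) (f * g)"
  unfolding ord_ge_def
proof (intro allI impI)
  fix a b assume ab: "a + b < m + n"
  have "coeff2 f i j * coeff2 g (a - i) (b - j) = 0" if "j \<le> b" "i \<le> a" for i j
  proof (cases "i + j < m")
    case True then show ?thesis using assms(1) by (simp add: ord_ge_def)
  next
    case False
    then have "(a - i) + (b - j) < n" using that ab by linarith
    then show ?thesis using assms(2) by (simp add: ord_ge_def)
  qed
  then show "coeff2 (f * g) a b = 0" unfolding coeff2_mult by (intro sum.neutral ballI) simp
qed

lemma ord_ge_mult_right: "ord_ge n g \<Longrightarrow> ord_ge n (f * g)"
  using ord_ge_mult[of 0 f n g] by simp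

lemma ord_ge_mult_left: "ord_ge n f \<Longrightarrow> ord_ge n (f * g)"
  using ord_ge_mult[of n f 0 g] by simp

lemma ord_ge_power: "ord_ge m f \<Longrightarrow> ord_ge (m * n) (f ^ n)"
  by (induction n) (auto intro: ord_ge_mult)

lemma ord_ge_1_iff: "ord_ge 1 f \<longleftrightarrow> coeff2 f 0 0 = 0"
  by (auto simp: ord_ge_def)

lemma ord_ge_eqI:
  assumes "\<And>n. ord_ge n (f - g)"
  shows "f = g"
proof (rule series2_eqI)
  fix i j show "coeff2 f i j = coeff2 g i j"
    using assms[of "Suc (i + j)"] by (simp add: ord_ge_def)
qed

definition trunc2 :: "nat \<Rightarrow> series2 \<Rightarrow> series2" where
  "trunc2 n f = (\<Sum>i\<le>n. \<Sum>j\<le>n. mon i j (coeff2 f i j))"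

lemma coeff2_trunc2: "coeff2 (trunc2 n f) a b = (if a \<le> n \<and> b \<le> n then coeff2 f a b else 0)"
proof -
  have "coeff2 (trunc2 n f) a b = (\<Sum>i\<le>n. \<Sum>j\<le>n. if i = a then (if j = b then coeff2 f i j else 0) else 0)"
    unfolding trunc2_def coeff2_sum coeff2_mon by (intro sum.cong refl) auto
  also have "\<dots> = (\<Sum>i\<le>n. if i = a then (if b \<le> n then coeff2 f i b else 0) else 0)"
    by (intro sum.cong refl) (auto simp: sum.delta)
  also have "\<dots> = (if a \<le> n \<and> b \<le> n then coeff2 f a b else 0)"
    by (auto simp: sum.delta)
  finally show ?thesis .
qed

lemma ord_ge_trunc2: "ord_ge (Suc n) (f - trunc2 n f)"
  by (auto simp: ord_ge_def coeff2_trunc2)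

lemma additive_sum:
  fixes \<phi> :: "series2 \<Rightarrow> series2"
  assumes "\<And>f g. \<phi> (f - g) = \<phi> f - \<phi> g"
  shows "\<phi> (sum f A) = (\<Sum>a\<in>A. \<phi> (f a))"
proof -
  have 0: "\<phi> 0 = 0" using assms[of 0 0] by simp
  have "\<phi> (f + g) = \<phi> f + \<phi> g" for f g
    using assms[of f "- g"] assms[of 0 g] 0 by simp
  then show ?thesis using 0 by (induction A rule: infinite_finite_induct) auto
qed

text \<open>Polynomials are dense and both maps are continuous, so monomials decide. The loss of one
  degree is allowed so that the principle also covers partial derivatives.\<close>

lemma additive_eqI:
  fixes \<phi> \<psi> :: "series2 \<Rightarrow> series2"
  assumes "\<And>f g. \<phi> (f - g) = \<phi> f - \<phi> g" "\<And>f g. \<psi> (f - g) = \<psi> f - \<psi> g"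
    and "\<And>n f. ord_ge (Suc n) f \<Longrightarrow> ord_ge n (\<phi> f)" "\<And>n f. ord_ge (Suc n) f \<Longrightarrow> ord_ge n (\<psi> f)"
    and "\<And>i j c. \<phi> (mon i j c) = \<psi> (mon i j c)"
  shows "\<phi> f = \<psi> f"
proof (rule ord_ge_eqI)
  fix n
  have t: "\<phi> (trunc2 n f) = \<psi> (trunc2 n f)"
    unfolding trunc2_def by (simp add: additive_sum[of \<phi>] additive_sum[of \<psi>] assms(1,2,5))
  have "ord_ge n (\<phi> (f - trunc2 n f) - \<psi> (f - trunc2 n f))"
    by (intro ord_ge_diff assms(3,4) ord_ge_trunc2)
  then show "ord_ge n (\<phi> f - \<psi> f)" by (simp add: assms(1,2) t)
qed

section \<open>Substitution as a continuous ring homomorphism\<close>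

lemma coeff2_subst2:
  "coeff2 (subst2 g X Y) a b = (\<Sum>i\<le>a + b. \<Sum>j\<le>a + b. coeff2 g i j * coeff2 (X ^ i * Y ^ j) a b)"
  by (simp add: subst2_def coeff2_def)

lemma subst2_add: "subst2 (f + g) X Y = subst2 f X Y + subst2 g X Y"
  by (rule series2_eqI) (simp add: coeff2_subst2 algebra_simps sum.distrib)

lemma subst2_diff: "subst2 (f - g) X Y = subst2 f X Y - subst2 g X Y"
  by (rule series2_eqI) (simp add: coeff2_subst2 algebra_simps sum_subtractf)

lemma subst2_0 [simp]: "subst2 0 X Y = 0"
  using subst2_diff[of 0 0 X Y] by simp

lemma coeff2_subst2_00 [simp]: "coeff2 (subst2 g X Y) 0 0 = coeff2 g 0 0"
  by (simp add: coeff2_subst2 coeff2_1)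

lemma monomial_ord_ge:
  assumes "coeff2 X 0 0 = 0" "coeff2 Y 0 0 = 0"
  shows "ord_ge (i + j) (X ^ i * Y ^ j)"
proof (rule ord_ge_mult)
  show "ord_ge i (X ^ i)" using ord_ge_power[of 1 X i] assms(1) ord_ge_1_iff by simp
  show "ord_ge j (Y ^ j)" using ord_ge_power[of 1 Y j] assms(2) ord_ge_1_iff by simp
qed

lemma ord_ge_subst2:
  assumes "coeff2 X 0 0 = 0" "coeff2 Y 0 0 = 0" "ord_ge n g"
  shows "ord_ge n (subst2 g X Y)"
  unfolding ord_ge_def
proof (intro allI impI)
  fix a b assume ab: "a + b < n"
  have "coeff2 g i j * coeff2 (X ^ i * Y ^ j) a b = 0" for i j
  proof (cases "i + j < n")
    case True then show ?thesis using assms(3) by (simp add: ord_ge_def)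
  next
    case False
    then have "ord_ge (Suc (a + b)) (X ^ i * Y ^ j)"
      using ab by (intro ord_ge_mono[OF monomial_ord_ge[OF assms(1,2)]]) simp
    then show ?thesis by (simp add: ord_ge_def)
  qed
  then show "coeff2 (subst2 g X Y) a b = 0" unfolding coeff2_subst2 by (intro sum.neutral ballI)
qed

text \<open>The finite ranges of summation in \<open>subst2\<close> omit only products
  \<open>X ^ i * Y ^ j\<close> whose order exceeds the degree of the coefficient in
  question.\<close>

lemma subst2_mon:
  assumes "coeff2 X 0 0 = 0" "coeff2 Y 0 0 = 0"
  shows "subst2 (mon i j c) X Y = cst c * (X ^ i * Y ^ j)"
proof (rule series2_eqI)
  fix a b
  have "coeff2 (subst2 (mon i j c) X Y) a b
    = (\<Sum>k\<le>a + b. \<Sum>l\<le>a + b. if k = i then (if l = j then c * coeff2 (X ^ i * Y ^ j) a b else 0) else 0)"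
    unfolding coeff2_subst2 coeff2_mon by (intro sum.cong refl) auto
  also have "\<dots> = (\<Sum>k\<le>a + b. if k = i then (if j \<le> a + b then c * coeff2 (X ^ i * Y ^ j) a b else 0) else 0)"
    by (intro sum.cong refl) (auto simp: sum.delta)
  also have "\<dots> = (if i \<le> a + b \<and> j \<le> a + b then c * coeff2 (X ^ i * Y ^ j) a b else 0)"
    by (auto simp: sum.delta)
  also have "\<dots> = c * coeff2 (X ^ i * Y ^ j) a b"
    using monomial_ord_ge[OF assms, of i j] by (auto simp: ord_ge_def)
  finally show "coeff2 (subst2 (mon i j c) X Y) a b = coeff2 (cst c * (X ^ i * Y ^ j)) a b" by simp
qed

text \<open>Density is used once for each factor: a monomial times \<open>g\<close> is reduced to
  monomials in \<open>g\<close>, then the left factor varies. This avoids rearranging the truncated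
  sums.\<close>

lemma subst2_mult:
  assumes XY: "coeff2 X 0 0 = 0" "coeff2 Y 0 0 = 0"
  shows "subst2 (f * g) X Y = subst2 f X Y * subst2 g X Y"
proof -
  have mon: "subst2 (mon i j c * g) X Y = subst2 (mon i j c) X Y * subst2 g X Y" for i j c g
  proof (rule additive_eqI[of "\<lambda>g. subst2 (mon i j c * g) X Y"])
    fix n and f :: series2
    assume "ord_ge (Suc n) f"
    then have f: "ord_ge n f" by (rule ord_ge_mono) simp
    show "ord_ge n (subst2 (mon i j c * f) X Y)"
      by (intro ord_ge_subst2 XY ord_ge_mult_right f)
    show "ord_ge n (subst2 (mon i j c) X Y * subst2 f X Y)"
      by (intro ord_ge_mult_right ord_ge_subst2 XY f)
  qed (simp_all add: right_diff_distrib subst2_diff mon_mult subst2_mon[OF XY] cst_mult power_add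
        algebra_simps)
  show ?thesis
  proof (rule additive_eqI[of "\<lambda>f. subst2 (f * g) X Y" "\<lambda>f. subst2 f X Y * subst2 g X Y"])
    fix n and f :: series2
    assume "ord_ge (Suc n) f"
    then have f: "ord_ge n f" by (rule ord_ge_mono) simp
    show "ord_ge n (subst2 (f * g) X Y)"
      by (intro ord_ge_subst2 XY ord_ge_mult_left f)
    show "ord_ge n (subst2 f X Y * subst2 g X Y)"
      by (intro ord_ge_mult_left ord_ge_subst2 XY f)
  qed (simp_all add: left_diff_distrib subst2_diff mon)
qed

lemma subst2_cst: 
  assumes XY: "coeff2 X 0 0 = 0" "coeff2 Y 0 0 = 0"
  shows "subst2 (cst c) X Y = cst c"
  using subst2_mon[OF XY, of 0 0 c] by (simp add: mon_def)

lemma cst_1: "cst 1 = 1" by (simp add: cst_def)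

lemma subst2_1: 
  assumes XY: "coeff2 X 0 0 = 0" "coeff2 Y 0 0 = 0"
  shows "subst2 1 X Y = 1"
  using subst2_cst[OF XY, of 1] by (simp add: cst_1)

lemma subst2_vx: 
  assumes XY: "coeff2 X 0 0 = 0" "coeff2 Y 0 0 = 0"
  shows "subst2 vx X Y = X"
  using subst2_mon[OF XY, of 1 0 1] by (simp add: mon_def cst_1)

lemma subst2_vy: 
  assumes XY: "coeff2 X 0 0 = 0" "coeff2 Y 0 0 = 0"
  shows "subst2 vy X Y = Y"
  using subst2_mon[OF XY, of 0 1 1] by (simp add: mon_def cst_1)

lemma subst2_power:
  assumes XY: "coeff2 X 0 0 = 0" "coeff2 Y 0 0 = 0"
  shows "subst2 (f ^ n) X Y = subst2 f X Y ^ n"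
  by (induction n) (simp_all add: subst2_1[OF XY] subst2_mult[OF XY])

lemma subst2_dvd:
  assumes XY: "coeff2 X 0 0 = 0" "coeff2 Y 0 0 = 0"
  shows "f dvd g \<Longrightarrow> subst2 f X Y dvd subst2 g X Y"
  by (auto simp: dvd_def subst2_mult[OF XY])

lemma subst2_subst2:
  assumes XY: "coeff2 X 0 0 = 0" "coeff2 Y 0 0 = 0" and UV: "coeff2 U 0 0 = 0" "coeff2 V 0 0 = 0"
  shows "subst2 (subst2 f X Y) U V = subst2 f (subst2 X U V) (subst2 Y U V)"
proof (rule additive_eqI[of "\<lambda>f. subst2 (subst2 f X Y) U V"])
  have XY': "coeff2 (subst2 X U V) 0 0 = 0" "coeff2 (subst2 Y U V) 0 0 = 0" using XY by simp_all
  show "subst2 (subst2 (mon i j c) X Y) U V = subst2 (mon i j c) (subst2 X U V) (subst2 Y U V)" for i j c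
    by (simp add: subst2_mon XY XY' subst2_mult[OF UV] subst2_cst[OF UV] subst2_power[OF UV])
qed (auto simp: subst2_diff XY UV intro!: ord_ge_subst2 elim: ord_ge_mono)

lemma vxy_00 [simp]: "coeff2 vx 0 0 = 0" "coeff2 vy 0 0 = 0"
  by (simp_all add: coeff2_vx coeff2_vy)

lemma subst2_id [simp]: "subst2 f vx vy = f"
  by (rule additive_eqI[of "\<lambda>f. subst2 f vx vy"])
    (auto simp: subst2_diff subst2_mon mon_def[symmetric] intro!: ord_ge_subst2 elim: ord_ge_mono)

section \<open>Partial derivatives and the chain rule\<close>

definition dx :: "series2 \<Rightarrow> series2" where "dx f = Abs_fps (\<lambda>j. fps_deriv (fps_nth f j))"
definition dy :: "series2 \<Rightarrow> series2" where "dy f = fps_deriv f"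

lemma coeff2_dx: "coeff2 (dx f) i j = of_nat (i + 1) * coeff2 f (i + 1) j"
  by (simp add: coeff2_def dx_def)

lemma coeff2_dy: "coeff2 (dy f) i j = of_nat (j + 1) * coeff2 f i (j + 1)"
proof -
  have "coeff2 (dy f) i j = fps_nth (of_nat (j + 1) * fps_nth f (j + 1)) i"
    by (simp add: coeff2_def dy_def)
  also have "\<dots> = of_nat (j + 1) * coeff2 f i (j + 1)"
    by (simp add: coeff2_def fps_of_nat[symmetric] del: of_nat_add of_nat_Suc)
  finally show ?thesis .
qed

locale derivation2 =
  fixes D :: "series2 \<Rightarrow> series2"
  assumes D_diff: "D (f - g) = D f - D g"
    and D_add: "D (f + g) = D f + D g"
    and D_mult: "D (f * g) = D f * g + f * D g"
    and D_cst: "D (cst c) = 0"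
    and D_ord: "ord_ge (Suc n) f \<Longrightarrow> ord_ge n (D f)"
begin

lemma D_1: "D 1 = 0" using D_cst[of 1] by (simp add: cst_1)

lemma D_power: "D (f ^ n) = of_nat n * f ^ (n - 1) * D f"
proof (induction n)
  case (Suc n)
  then show ?case by (cases n) (simp_all add: D_mult D_1 algebra_simps)
qed (simp add: D_1)

end

interpretation dx: derivation2 dx
proof
  show "dx (f * g) = dx f * g + f * dx g" for f g
  proof (rule fps_ext)
    fix n
    have "fps_nth (dx (f * g)) n
        = (\<Sum>i=0..n. fps_nth f i * fps_deriv (fps_nth g (n - i)) + fps_deriv (fps_nth f i) * fps_nth g (n - i))"
      by (simp add: dx_def fps_mult_nth fps_deriv_sum)
    then show "fps_nth (dx (f * g)) n = fps_nth (dx f * g + f * dx g) n"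
      by (simp add: dx_def fps_mult_nth sum.distrib)
  qed
qed (auto simp: ord_ge_def coeff2_dx coeff2_cst algebra_simps intro!: series2_eqI)

interpretation dy: derivation2 dy
proof
  show "ord_ge n (dy f)" if "ord_ge (Suc n) f" for n f
    using that by (auto simp: ord_ge_def coeff2_dy)
qed (auto simp: algebra_simps dy_def cst_def)

lemma dx_vx [simp]: "dx vx = 1" and dx_vy [simp]: "dx vy = 0"
  and dy_vx [simp]: "dy vx = 0" and dy_vy [simp]: "dy vy = 1"
  by (rule series2_eqI, auto simp: coeff2_dx coeff2_dy coeff2_vx coeff2_vy coeff2_1)+

lemma (in derivation2) chain_rule:
  assumes XY: "coeff2 X 0 0 = 0" "coeff2 Y 0 0 = 0"
  shows "D (subst2 f X Y) = subst2 (dx f) X Y * D X + subst2 (dy f) X Y * D Y"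
proof (rule additive_eqI[of "\<lambda>f. D (subst2 f X Y)"])
  show "D (subst2 (mon i j c) X Y)
    = subst2 (dx (mon i j c)) X Y * D X + subst2 (dy (mon i j c)) X Y * D Y" for i j c
  proof -
    have of_nat: "subst2 (of_nat n) X Y = of_nat n" for n
      by (induction n) (simp_all add: subst2_add subst2_1[OF XY])
    show ?thesis
      unfolding subst2_mon[OF XY] 
      by (simp add: mon_def subst2_mult[OF XY] subst2_cst[OF XY] subst2_power[OF XY] subst2_vx[OF XY]
          subst2_vy[OF XY] D_mult D_cst D_power dx.D_mult dx.D_cst dx.D_power dy.D_mult dy.D_cst dy.D_power
          of_nat algebra_simps)
  qed
qed (auto simp: subst2_diff D_diff dx.D_diff dy.D_diff XY algebra_simps
    intro!: D_ord dx.D_ord dy.D_ord ord_ge_subst2 ord_ge_add ord_ge_mult_right)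

definition jac :: "series2 \<Rightarrow> series2 \<Rightarrow> series2" where
  "jac f g = dx f * dy g - dy f * dx g"

lemma coeff2_jac: "coeff2 (jac f g) 0 0 = jacobian0 f g"
  by (simp add: jac_def jacobian0_def coeff2_dx coeff2_dy)

lemma jac_subst2:
  assumes XY: "coeff2 X 0 0 = 0" "coeff2 Y 0 0 = 0"
  shows "jac (subst2 f X Y) (subst2 g X Y) = subst2 (jac f g) X Y * jac X Y"
  by (simp add: jac_def dx.chain_rule[OF XY] dy.chain_rule[OF XY] subst2_diff subst2_mult[OF XY] algebra_simps)

lemma jacobian0_subst2:
  assumes XY: "coeff2 X 0 0 = 0" "coeff2 Y 0 0 = 0"
  shows "jacobian0 (subst2 f X Y) (subst2 g X Y) = jacobian0 f g * jacobian0 X Y"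
  unfolding coeff2_jac[symmetric] jac_subst2[OF XY] by simp

section \<open>Formal coordinates\<close>


lemma series2_unit_iff: "(f :: series2) dvd 1 \<longleftrightarrow> coeff2 f 0 0 \<noteq> 0"
proof
  assume "f dvd 1"
  then obtain g where "1 = f * g" by (auto simp: dvd_def)
  then have "coeff2 f 0 0 * coeff2 g 0 0 = 1"
    by (metis coeff2_mult_00 coeff2_1)
  then show "coeff2 f 0 0 \<noteq> 0" by auto
next
  assume "coeff2 f 0 0 \<noteq> 0"
  then have "fps_nth f 0 dvd 1" by (simp add: coeff2_def)
  then have "\<exists>k. 1 = fps_nth f 0 * k" by (auto simp: dvd_def)
  then have "\<exists>g. 1 = f * g" by (rule fps_is_left_unit_iff_zeroth_is_left_unit[THEN iffD2])
  then show "f dvd 1" by (auto simp: dvd_def)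
qed

definition coords :: "series2 \<Rightarrow> series2 \<Rightarrow> bool" where
  "coords X Y \<longleftrightarrow> coeff2 X 0 0 = 0 \<and> coeff2 Y 0 0 = 0 \<and> jacobian0 X Y \<noteq> 0"

lemma coordsD:
  assumes "coords X Y"
  shows "coeff2 X 0 0 = 0" "coeff2 Y 0 0 = 0" "jacobian0 X Y \<noteq> 0"
  using assms by (simp_all add: coords_def)

lemma coords_vx_vy: "coords vx vy"
  by (simp add: coords_def jacobian0_def coeff2_vx coeff2_vy)

lemma coords_subst2: "coords f g \<Longrightarrow> coords X Y \<Longrightarrow> coords (subst2 f X Y) (subst2 g X Y)"
  by (simp add: coords_def jacobian0_subst2)

lemma ord_ge_2_iff: "ord_ge 2 f \<longleftrightarrow> coeff2 f 0 0 = 0 \<and> coeff2 f 1 0 = 0 \<and> coeff2 f 0 1 = 0"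
proof -
  have "i + j < 2 \<longleftrightarrow> (i, j) \<in> {(0, 0), (1, 0), (0, Suc 0)}" for i j :: nat by auto
  then show ?thesis by (auto simp: ord_ge_def)
qed

lemma ord_ge_power_diff:
  assumes "ord_ge 1 A" "ord_ge 1 B" "ord_ge 2 (A - B)"
  shows "ord_ge (Suc n) (A ^ n - B ^ n)"
proof (induction n)
  case (Suc n)
  have eq: "A ^ Suc n - B ^ Suc n = A * (A ^ n - B ^ n) + (A - B) * B ^ n"
    by (simp add: algebra_simps)
  have "ord_ge (1 + Suc n) (A * (A ^ n - B ^ n))" "ord_ge (2 + 1 * n) ((A - B) * B ^ n)"
    using assms Suc by (intro ord_ge_mult ord_ge_power; simp)+
  then show ?case unfolding eq by (intro ord_ge_add) simp_all
qed simp

lemma coords_approx_linear: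
  assumes "coords X Y"
  obtains h where "ord_ge 1 h" "ord_ge 2 (cst \<alpha> * vx + cst \<beta> * vy - subst2 h X Y)"
proof -
  note XY = coordsD(1,2)[OF assms]
  define J where "J = jacobian0 X Y"
  \<comment> \<open>Cramer's rule: \<open>p\<close> and \<open>q\<close> are chosen so that the
    corresponding combination of \<open>X\<close> and \<open>Y\<close> has linear part \<alpha> x +
    \<beta> y.\<close>
  define p where "p = (\<alpha> * coeff2 Y 0 1 - \<beta> * coeff2 Y 1 0) / J"
  define q where "q = (\<beta> * coeff2 X 1 0 - \<alpha> * coeff2 X 0 1) / J"
  have J: "J \<noteq> 0" using assms by (simp add: J_def coords_def)
  define h where "h = mon 1 0 p + mon 0 1 q"
  have h: "subst2 h X Y = cst p * X + cst q * Y"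
    by (simp add: h_def subst2_add subst2_mon[OF XY])
  have Jp: "J * p = \<alpha> * coeff2 Y 0 1 - \<beta> * coeff2 Y 1 0" using J by (simp add: p_def)
  have Jq: "J * q = \<beta> * coeff2 X 1 0 - \<alpha> * coeff2 X 0 1" using J by (simp add: q_def)
  have "J * (p * coeff2 X 1 0 + q * coeff2 Y 1 0) = (J * p) * coeff2 X 1 0 + (J * q) * coeff2 Y 1 0"
    by (simp add: algebra_simps)
  also have "\<dots> = J * \<alpha>" unfolding Jp Jq by (simp add: J_def jacobian0_def algebra_simps)
  finally have "p * coeff2 X 1 0 + q * coeff2 Y 1 0 = \<alpha>" using J by simp
  moreover have "J * (p * coeff2 X 0 1 + q * coeff2 Y 0 1) = (J * p) * coeff2 X 0 1 + (J * q) * coeff2 Y 0 1"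
    by (simp add: algebra_simps)
  then have "J * (p * coeff2 X 0 1 + q * coeff2 Y 0 1) = J * \<beta>"
    unfolding Jp Jq by (simp add: J_def jacobian0_def algebra_simps)
  then have "p * coeff2 X 0 1 + q * coeff2 Y 0 1 = \<beta>" using J by simp
  ultimately have "ord_ge 2 (cst \<alpha> * vx + cst \<beta> * vy - subst2 h X Y)"
    unfolding h ord_ge_2_iff using XY J by (simp add: coeff2_vx coeff2_vy)
  moreover have "ord_ge 1 h" by (simp add: ord_ge_1_iff[unfolded One_nat_def] h_def coeff2_mon)
  ultimately show ?thesis using that by blast
qed

text \<open>\<open>hx\<close> and \<open>hy\<close> reproduce x and y up to terms of order two,
  hence monomials of degree \<open>n\<close> in them reproduce the monomials of degree
  \<open>n\<close> up to order \<open>n + 1\<close>; the leading form of \<open>F\<close> is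
  rewritten term by term.\<close>

lemma coords_approx:
  assumes XY: "coords X Y" and F: "ord_ge n F"
  shows "\<exists>h. ord_ge n h \<and> ord_ge (Suc n) (F - subst2 h X Y)"
proof -
  note XY0 = coordsD(1,2)[OF XY]
  obtain hx where hx: "ord_ge 1 hx" "ord_ge 2 (vx - subst2 hx X Y)"
    using coords_approx_linear[OF XY, of 1 0] by (metis cst_1 mult_1_left mult_zero_left cst_def fps_const_0_eq_0 add_0_right)
  obtain hy where hy: "ord_ge 1 hy" "ord_ge 2 (vy - subst2 hy X Y)"
    using coords_approx_linear[OF XY, of 0 1] by (metis cst_1 mult_1_left mult_zero_left cst_def fps_const_0_eq_0 add_0_left)
  have mon: "ord_ge (Suc (i + j)) (mon i j c - subst2 (cst c * (hx ^ i * hy ^ j)) X Y)" for i j c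
  proof -
    define A where "A = subst2 hx X Y"
    define B where "B = subst2 hy X Y"
    have AB: "ord_ge 1 A" "ord_ge 1 B" "ord_ge 2 (vx - A)" "ord_ge 2 (vy - B)"
      using hx hy by (auto simp: A_def B_def intro!: ord_ge_subst2 XY0)
    have v: "ord_ge 1 vx" "ord_ge 1 vy" by (simp_all add: ord_ge_1_iff[unfolded One_nat_def])
    have eq: "mon i j c - subst2 (cst c * (hx ^ i * hy ^ j)) X Y
        = cst c * (vx ^ i * (vy ^ j - B ^ j) + (vx ^ i - A ^ i) * B ^ j)"
      by (simp add: mon_def A_def B_def subst2_mult[OF XY0] subst2_cst[OF XY0] subst2_power[OF XY0] algebra_simps)
    have "ord_ge (1 * i + Suc j) (vx ^ i * (vy ^ j - B ^ j))" "ord_ge (Suc i + 1 * j) ((vx ^ i - A ^ i) * B ^ j)"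
      using AB v by (blast intro: ord_ge_mult ord_ge_power ord_ge_power_diff)+
    then show ?thesis unfolding eq by (intro ord_ge_mult_right[of _ _ "cst c"] ord_ge_add) simp_all
  qed
  define h where "h = (\<Sum>i\<le>n. \<Sum>j\<le>n. if i + j < n then 0 else cst (coeff2 F i j) * (hx ^ i * hy ^ j))"
  have "ord_ge (n) (cst c * (hx ^ i * hy ^ j))" if "\<not> i + j < n" for i j c
    using ord_ge_mult[OF ord_ge_power[OF hx(1)] ord_ge_power[OF hy(1)], of i j] that
    by (intro ord_ge_mult_right[of _ _ "cst c"]) (auto elim: ord_ge_mono)
  then have 1: "ord_ge n h" unfolding h_def by (intro ord_ge_sum) auto
  have tr: "trunc2 n F = (\<Sum>i\<le>n. \<Sum>j\<le>n. if i + j < n then 0 else mon i j (coeff2 F i j))"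
    unfolding trunc2_def using F
    by (intro sum.cong refl) (auto simp: ord_ge_def mon_def cst_def)
  have "trunc2 n F - subst2 h X Y = (\<Sum>i\<le>n. \<Sum>j\<le>n. if i + j < n then 0 else
      mon i j (coeff2 F i j) - subst2 (cst (coeff2 F i j) * (hx ^ i * hy ^ j)) X Y)"
    unfolding tr h_def by (simp add: additive_sum[of "\<lambda>f. subst2 f X Y", OF subst2_diff] sum_subtractf[symmetric]
        cong: if_cong) (intro sum.cong refl, auto)
  also have "ord_ge (Suc n) \<dots>"
  proof (intro ord_ge_sum)
    fix i j
    show "ord_ge (Suc n) (if i + j < n then 0 else
      mon i j (coeff2 F i j) - subst2 (cst (coeff2 F i j) * (hx ^ i * hy ^ j)) X Y)"
      using mon[of i j "coeff2 F i j"] by (auto elim: ord_ge_mono)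
  qed
  finally have "ord_ge (Suc n) ((F - trunc2 n F) + (trunc2 n F - subst2 h X Y))"
    by (intro ord_ge_add ord_ge_trunc2)
  then show ?thesis using 1 by auto
qed

text \<open>Formal inverse function theorem by successive approximation: \<open>G n\<close> is the
  remainder, of order at least \<open>n\<close>, and \<open>k n\<close> its correction.\<close>

lemma coords_surj:
  assumes XY: "coords X Y"
  obtains h where "subst2 h X Y = F"
proof -
  note XY0 = coordsD(1,2)[OF XY]
  obtain s where s: "\<And>n F. ord_ge n F \<Longrightarrow> ord_ge n (s n F) \<and> ord_ge (Suc n) (F - subst2 (s n F) X Y)"
    using coords_approx[OF XY] by metis
  define G where "G = rec_nat F (\<lambda>n G. G - subst2 (s n G) X Y)"
  have G0: "G 0 = F" and GS: "G (Suc n) = G n - subst2 (s n (G n)) X Y" for n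
    by (simp_all add: G_def)
  have G: "ord_ge n (G n)" for n
    by (induction n) (use s in \<open>auto simp: GS\<close>)
  define k where "k n = s n (G n)" for n
  have k: "ord_ge n (k n)" for n using s[OF G] by (simp add: k_def)
  \<comment> \<open>Since \<open>k n\<close> has order at least \<open>n\<close>, a coefficient of
    total degree \<open>a + b\<close> is complete after finitely many corrections.\<close>
  define h where "h = Abs2 (\<lambda>a b. \<Sum>n\<le>a + b. coeff2 (k n) a b)"
  have G': "G n = F - subst2 (\<Sum>m<n. k m) X Y" for n
    by (induction n) (simp_all add: G0 GS k_def subst2_add algebra_simps)
  have h: "ord_ge n (h - (\<Sum>m<n. k m))" for n
    unfolding ord_ge_def
  proof (intro allI impI)
    fix a b assume ab: "a + b < n"
    have "(\<Sum>m<n. coeff2 (k m) a b) = (\<Sum>m\<le>a + b. coeff2 (k m) a b)"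
      using k ab by (intro sum.mono_neutral_right) (auto simp: ord_ge_def)
    then show "coeff2 (h - (\<Sum>m<n. k m)) a b = 0" by (simp add: h_def coeff2_sum)
  qed
  have "F = subst2 h X Y"
  proof (rule ord_ge_eqI)
    fix n
    have "F - subst2 h X Y = G n - subst2 (h - (\<Sum>m<n. k m)) X Y"
      by (simp add: G' subst2_diff)
    then show "ord_ge n (F - subst2 h X Y)"
      using G h ord_ge_subst2[OF XY0] by (metis ord_ge_diff)
  qed
  then show ?thesis using that by simp
qed

lemma coords_inverse:
  assumes XY: "coords X Y"
  obtains A B where "coords A B" "\<And>f. subst2 (subst2 f X Y) A B = f" "\<And>f. subst2 (subst2 f A B) X Y = f"
proof -
  note XY0 = coordsD(1,2)[OF XY]
  obtain A where A: "subst2 A X Y = vx" using coords_surj[OF XY] by blast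
  obtain B where B: "subst2 B X Y = vy" using coords_surj[OF XY] by blast
  have AB0: "coeff2 A 0 0 = 0" "coeff2 B 0 0 = 0" using A B coeff2_subst2_00 vxy_00 by metis+
  have "jacobian0 A B * jacobian0 X Y = jacobian0 vx vy"
    using jacobian0_subst2[OF XY0, of A B] by (simp add: A B)
  then have AB: "coords A B" using AB0 coords_vx_vy by (auto simp: coords_def)
  have inv: "subst2 (subst2 f A B) X Y = f" for f
    by (simp add: subst2_subst2 AB0 XY0 A B)
  have "subst2 (subst2 f X Y) A B = f" for f
  proof -
    \<comment> \<open>\<open>A\<close> and \<open>B\<close> are coordinates as well, so their
      substitution is surjective; this makes the one-sided inverse two-sided.\<close>
    obtain h where h: "f = subst2 h A B" using coords_surj[OF AB] by metis
    show ?thesis unfolding h inv ..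
  qed
  with AB inv show ?thesis using that by blast
qed

lemma subst2_dvd_iff:
  assumes XY: "coords X Y"
  shows "subst2 f X Y dvd subst2 g X Y \<longleftrightarrow> f dvd g"
proof -
  obtain A B where AB: "coords A B" "\<And>f. subst2 (subst2 f X Y) A B = f"
    using coords_inverse[OF XY] by metis
  show ?thesis
    using subst2_dvd[OF coordsD(1,2)[OF XY], of f g] subst2_dvd[OF coordsD(1,2)[OF AB(1)], of "subst2 f X Y" "subst2 g X Y"]
    by (auto simp: AB(2))
qed

section \<open>Restriction to x = 0, primality of coordinates, smooth branches\<close>

definition res0 :: "series2 \<Rightarrow> complex fps" where
  "res0 f = Abs_fps (\<lambda>j. coeff2 f 0 j)"

lemma res0_nth [simp]: "fps_nth (res0 f) j = coeff2 f 0 j"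
  by (simp add: res0_def)

lemma res0_add [simp]: "res0 (f + g) = res0 f + res0 g"
  and res0_diff [simp]: "res0 (f - g) = res0 f - res0 g"
  and res0_mult [simp]: "res0 (f * g) = res0 f * res0 g"
  and res0_1 [simp]: "res0 1 = 1"
  by (auto simp: fps_eq_iff coeff2_mult fps_mult_nth atLeast0AtMost coeff2_1)

lemma res0_power [simp]: "res0 (f ^ n) = res0 f ^ n"
  by (induction n) simp_all

lemma vx_power_dvd_iff: "vx ^ n dvd f \<longleftrightarrow> (\<forall>i j. i < n \<longrightarrow> coeff2 f i j = 0)"
proof
  assume "\<forall>i j. i < n \<longrightarrow> coeff2 f i j = 0"
  then have "f = vx ^ n * Abs2 (\<lambda>i j. coeff2 f (i + n) j)"
    by (intro series2_eqI) (simp add: coeff2_vx_power_mult)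
  then show "vx ^ n dvd f" by (metis dvd_triv_left)
qed (auto simp: dvd_def coeff2_vx_power_mult)

lemma vy_power_dvd_iff: "vy ^ n dvd f \<longleftrightarrow> (\<forall>i j. j < n \<longrightarrow> coeff2 f i j = 0)"
proof
  assume "\<forall>i j. j < n \<longrightarrow> coeff2 f i j = 0"
  then have "f = vy ^ n * Abs2 (\<lambda>i j. coeff2 f i (j + n))"
    by (intro series2_eqI) (simp add: coeff2_vy_power_mult)
  then show "vy ^ n dvd f" by (metis dvd_triv_left)
qed (auto simp: dvd_def coeff2_vy_power_mult)

lemma vx_dvd_iff: "vx dvd f \<longleftrightarrow> res0 f = 0"
  using vx_power_dvd_iff[of 1 f] by (auto simp: fps_eq_iff)

lemma vx_nonzero [simp]: "vx \<noteq> 0"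
  by (simp add: vx_def)

lemma prime_vx: "prime_elem vx"
  by (auto simp: prime_elem_def vx_dvd_iff series2_unit_iff)

text \<open>\<open>vx\<close> is prime because it generates the kernel of \<open>res0\<close>, a
  homomorphism to a domain, and a change of coordinates carries this to \<open>X\<close>.
  Exceptional factors are split off later by means of this primality.\<close>

lemma prime_coords:
  assumes XY: "coords X Y"
  shows "prime_elem X"
proof -
  obtain A B where AB: "coords A B" "\<And>f. subst2 (subst2 f A B) X Y = f"
    using coords_inverse[OF XY] by metis
  have X: "X = subst2 vx X Y" by (simp add: subst2_vx coordsD[OF XY])
  show ?thesis
    unfolding prime_elem_def
  proof (intro conjI allI impI)
    show "X \<noteq> 0" using XY by (auto simp: coords_def jacobian0_def)
    show "\<not> X dvd 1" using XY by (simp add: coords_def series2_unit_iff)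
    fix a b assume "X dvd a * b"
    then have "subst2 vx X Y dvd subst2 (subst2 a A B * subst2 b A B) X Y"
      by (simp add: X[symmetric] subst2_mult coordsD[OF XY] AB(2))
    then have "vx dvd subst2 a A B \<or> vx dvd subst2 b A B"
      using prime_vx unfolding subst2_dvd_iff[OF XY] by (rule prime_elem_dvd_multD[rotated])
    then show "X dvd a \<or> X dvd b"
      using subst2_dvd_iff[OF XY, of vx] AB(2) X by metis
  qed
qed

lemma coords_commute: "coords X Y \<longleftrightarrow> coords Y X"
  by (auto simp: coords_def jacobian0_def mult.commute)

lemma prime_elem_irreducible:
  fixes p :: "'a :: idom"
  assumes "prime_elem p"
  shows "irreducible p"
proof (rule irreducibleI)
  have *: "b dvd 1" if ab: "p = a * b" "p dvd a" for a b
  proof -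
    obtain k where "a = p * k" using ab(2) by (auto simp: dvd_def)
    then have "p * 1 = p * (k * b)" using ab(1) by (metis mult.assoc mult.right_neutral)
    moreover have "p \<noteq> 0" using assms by (simp add: prime_elem_def)
    ultimately have "1 = k * b" by (simp only: mult_cancel_left) simp
    then show ?thesis by (metis dvd_triv_right)
  qed
  show "a dvd 1 \<or> b dvd 1" if "p = a * b" for a b
  proof -
    have "p dvd a \<or> p dvd b" using prime_elem_dvd_multD[OF assms, of a b] that by simp
    then show ?thesis using *[OF that] *[of b a] that by (metis mult.commute)
  qed
qed (use assms in \<open>auto simp: prime_elem_def\<close>)

text \<open>A non-unit with nonzero linear part forms a coordinate system with x or with y, hence is
  prime; irreducibility is automatic.\<close>

lemma smooth_branch_iff:
  "smooth_branch f \<longleftrightarrow> coeff2 f 0 0 = 0 \<and> (coeff2 f 1 0 \<noteq> 0 \<or> coeff2 f 0 1 \<noteq> 0)"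
proof
  assume "smooth_branch f"
  then show "coeff2 f 0 0 = 0 \<and> (coeff2 f 1 0 \<noteq> 0 \<or> coeff2 f 0 1 \<noteq> 0)"
    using irreducible_not_unit[of f] by (auto simp: smooth_branch_def branch_def series2_unit_iff)
next
  assume f: "coeff2 f 0 0 = 0 \<and> (coeff2 f 1 0 \<noteq> 0 \<or> coeff2 f 0 1 \<noteq> 0)"
  then have "coords f vy \<or> coords f vx"
    by (auto simp: coords_def jacobian0_def coeff2_vx coeff2_vy)
  then have "prime_elem f" using prime_coords by blast
  then show "smooth_branch f" using f by (simp add: smooth_branch_def branch_def prime_elem_irreducible)
qed

lemma cross_iff_coords: "cross L L' \<longleftrightarrow> coords L L'"
  by (auto simp: cross_def coords_def smooth_branch_iff jacobian0_def)

lemma smooth_branch_coords: "smooth_branch L \<Longrightarrow> \<exists>L'. coords L L'"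
  using exI[of "coords L" vx] exI[of "coords L" vy]
  by (auto simp: smooth_branch_iff coords_def jacobian0_def coeff2_vx coeff2_vy)

lemma coords_smooth: "coords X Y \<Longrightarrow> smooth_branch X"
  using cross_iff_coords cross_def by blast

section \<open>Contact and the Jacobian condition under units and coordinate changes\<close>

lemma same_curve_unit:
  assumes "same_curve f g"
  obtains u where "coeff2 u 0 0 \<noteq> 0" "f = u * g"
proof (cases "g = 0")
  case True
  then show ?thesis using assms that[of 1] by (simp add: same_curve_def coeff2_1)
next
  case False
  obtain u w where u: "f = g * u" "g = f * w" using assms by (auto simp: same_curve_def dvd_def)
  then have "g = g * (u * w)" by (metis mult.assoc)
  then have "u * w = 1" using False by (metis mult_cancel_left mult.right_neutral)
  then have "u dvd 1" by (metis dvd_triv_left)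
  then show ?thesis using u that[of u] by (simp add: series2_unit_iff mult.commute)
qed

lemma same_curve_sym: "same_curve f g \<Longrightarrow> same_curve g f"
  by (simp add: same_curve_def)

lemma coords_unit_mult:
  assumes "coords X Y" "coeff2 u 0 0 \<noteq> 0" "coeff2 w 0 0 \<noteq> 0"
  shows "coords (u * X) (w * Y)"
proof -
  have "jacobian0 (u * X) (w * Y) = coeff2 u 0 0 * coeff2 w 0 0 * jacobian0 X Y"
    using assms(1) coeff2_mult_10[unfolded One_nat_def] coeff2_mult_01[unfolded One_nat_def]
    by (simp add: jacobian0_def coords_def algebra_simps)
  then show ?thesis using assms by (simp add: coords_def)
qed

lemma coords_same_curve: "coords X Y \<Longrightarrow> same_curve X X' \<Longrightarrow> same_curve Y Y' \<Longrightarrow> coords X' Y'"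
  by (metis same_curve_unit same_curve_sym coords_unit_mult)

lemma expansion_in_cross_coords:
  assumes "expansion_in_cross L L' C g"
  obtains x y where "coords x y" "same_curve x L" "C = subst2 g x y"
  using assms unfolding expansion_in_cross_def cross_iff_coords
  by (metis coords_same_curve same_curve_sym)

text \<open>For \<open>N = 1\<close> this measures intersection: restricted to \<open>L\<close>, the
  ideal becomes the power \<open>n\<close> of the maximal ideal, so \<open>contact n 1 L C\<close>
  says that \<open>L\<close> and \<open>C\<close> meet with multiplicity at least \<open>n\<close>,
  possibly infinite. The negation for \<open>Suc d\<close> is the bound \<open>d\<close> of the
  induction.\<close>

definition contact :: "nat \<Rightarrow> nat \<Rightarrow> series2 \<Rightarrow> series2 \<Rightarrow> bool" where
  "contact n N L C \<longleftrightarrow> (\<exists>z c e. coords L z \<and> C = c * z ^ n + e * L ^ N)"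

lemma contact_subst2:
  assumes XY: "coords X Y" and "contact n N L C"
  shows "contact n N (subst2 L X Y) (subst2 C X Y)"
proof -
  note XY0 = coordsD(1,2)[OF XY]
  obtain z c e where z: "coords L z" "C = c * z ^ n + e * L ^ N" using assms(2) by (auto simp: contact_def)
  show ?thesis
    unfolding contact_def
    by (intro exI[of _ "subst2 z X Y"] exI[of _ "subst2 c X Y"] exI[of _ "subst2 e X Y"])
      (simp add: z(2) coords_subst2[OF z(1) XY] subst2_add subst2_mult XY0 subst2_power)
qed

lemma contact_same_curve:
  assumes "contact n N L C" "same_curve L L'" "same_curve C C'"
  shows "contact n N L' C'"
proof -
  obtain z c e where z: "coords L z" "C = c * z ^ n + e * L ^ N" using assms(1) by (auto simp: contact_def)
  obtain u where u: "L = u * L'" using assms(2) same_curve_unit by metis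
  obtain w where w: "C' = w * C" using assms(3) same_curve_unit same_curve_sym by metis
  have "coords L' z" using coords_same_curve[OF z(1) assms(2)] by (simp add: same_curve_def)
  moreover have "C' = (w * c) * z ^ n + (w * e * u ^ N) * L' ^ N"
    by (simp add: w z(2) u power_mult_distrib algebra_simps)
  ultimately show ?thesis unfolding contact_def by blast
qed

text \<open>Geometrically, the common zeros of \<open>C\<close> and its partial derivatives lie on
  \<open>L\<close>. This excludes a multiple component other than \<open>L\<close>, while a multiple
  component \<open>L\<close> is tolerated, so exceptional factors do no harm.\<close>

definition jacobian_power :: "series2 \<Rightarrow> series2 \<Rightarrow> bool" where
  "jacobian_power L C \<longleftrightarrow> (\<exists>N a b e. L ^ N = a * C + b * dx C + e * dy C)"

lemma jacobian_power_same_curve: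
  assumes "jacobian_power L C" "same_curve L L'" "same_curve C C'"
  shows "jacobian_power L' C'"
proof -
  obtain N a b e where N: "L ^ N = a * C + b * dx C + e * dy C" using assms(1) by (auto simp: jacobian_power_def)
  obtain u where u: "L' = u * L" using assms(2) same_curve_unit same_curve_sym by metis
  obtain w where w: "C = w * C'" using assms(3) same_curve_unit by metis
  have "L' ^ N = u ^ N * L ^ N" by (simp add: u power_mult_distrib)
  also have "\<dots> = u ^ N * (a * w + b * dx w + e * dy w) * C' + (u ^ N * b * w) * dx C' + (u ^ N * e * w) * dy C'"
    unfolding N by (subst (1 2 3) w) (simp add: dx.D_mult dy.D_mult algebra_simps)
  finally show ?thesis unfolding jacobian_power_def by blast
qed

text \<open>Cramer's rule inverts the chain rule.\<close>

lemma jac_chain_rule: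
  assumes "coeff2 X 0 0 = 0" "coeff2 Y 0 0 = 0"
  shows "jac X Y * subst2 (dx f) X Y = dx (subst2 f X Y) * dy Y - dy (subst2 f X Y) * dx Y"
    and "jac X Y * subst2 (dy f) X Y = dy (subst2 f X Y) * dx X - dx (subst2 f X Y) * dy X"
  by (simp_all add: dx.chain_rule[OF assms] dy.chain_rule[OF assms] jac_def algebra_simps)

text \<open>For coordinates \<open>jac X Y\<close> is a unit, with inverse \<open>w\<close>, so the
  relation can be divided by it after Cramer's rule.\<close>

lemma jacobian_power_subst2:
  assumes XY: "coords X Y" and "jacobian_power L C"
  shows "jacobian_power (subst2 L X Y) (subst2 C X Y)"
proof -
  note XY0 = coordsD(1,2)[OF XY]
  obtain N a b e where N: "L ^ N = a * C + b * dx C + e * dy C" using assms(2) by (auto simp: jacobian_power_def)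
  obtain w where w: "1 = jac X Y * w"
    using series2_unit_iff[of "jac X Y"] XY by (auto simp: coeff2_jac coords_def dvd_def)
  let ?s = "\<lambda>f. subst2 f X Y"
  have "?s L ^ N = ?s a * ?s C + w * (?s b * (jac X Y * ?s (dx C)) + ?s e * (jac X Y * ?s (dy C)))"
  proof -
    have "w * (?s b * (jac X Y * ?s (dx C)) + ?s e * (jac X Y * ?s (dy C)))
      = (jac X Y * w) * (?s b * ?s (dx C) + ?s e * ?s (dy C))" by (simp add: algebra_simps)
    then show ?thesis
      using arg_cong[OF N, of ?s] unfolding w[symmetric] by (simp add: subst2_add subst2_mult subst2_power XY0)
  qed
  also have "\<dots> = ?s a * ?s C + (w * (?s b * dy Y - ?s e * dy X)) * dx (?s C)
      + (w * (?s e * dx X - ?s b * dx Y)) * dy (?s C)"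
    unfolding jac_chain_rule[OF XY0] by (simp add: algebra_simps)
  finally show ?thesis unfolding jacobian_power_def by blast
qed

section \<open>Squarefree series and the Jacobian ideal\<close>


instance fps :: (field) semiring_gcd_mult_normalize ..

text \<open>An element \<open>H\<close> of least degree in the ideal of \<open>F\<close> and
  \<open>G\<close> divides every element up to a nonzero scalar, so a prime factor of positive
  degree of \<open>H\<close> would be common to \<open>F\<close> and \<open>G\<close>. The constant
  plays the role of a resultant.\<close>

lemma bezout_poly_const:
  fixes F G :: "'a :: {factorial_ring_gcd, semiring_gcd_mult_normalize} poly"
  assumes F: "F \<noteq> 0" and cop: "\<And>p. prime_elem p \<Longrightarrow> p dvd F \<Longrightarrow> p dvd G \<Longrightarrow> False"
  obtains A B c where "c \<noteq> 0" "[:c:] = A * F + B * G"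
proof -
  define I where "I = {A * F + B * G |A B. True}"
  have "F = 1 * F + 0 * G" "G = 0 * F + 1 * G" by simp_all
  then have FI: "F \<in> I" and GI: "G \<in> I" unfolding I_def by blast+
  obtain H where H: "H \<in> I" "H \<noteq> 0" and Hmin: "\<And>K. K \<in> I \<Longrightarrow> K \<noteq> 0 \<Longrightarrow> degree H \<le> degree K"
    using ex_has_least_nat[of "\<lambda>H. H \<in> I \<and> H \<noteq> 0" F degree] FI F by blast
  \<comment> \<open>Pseudo-division replaces division with remainder: the remainder stays in
    \<open>I\<close> and has smaller degree than \<open>H\<close>, so it vanishes.\<close>
  have div: "\<exists>a. a \<noteq> 0 \<and> H dvd smult a K" if K: "K \<in> I" for K
  proof -
    obtain a q where aq: "a \<noteq> 0" "smult a K = H * q + pseudo_mod K H"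
      using pseudo_mod(1)[OF H(2)] by blast
    obtain A B where AB: "K = A * F + B * G" using K by (auto simp: I_def)
    obtain A' B' where AB': "H = A' * F + B' * G" using H by (auto simp: I_def)
    have "pseudo_mod K H = smult a K - H * q" using aq(2) by simp
    also have "\<dots> = (smult a A - A' * q) * F + (smult a B - B' * q) * G"
      unfolding AB AB' by (simp add: algebra_simps smult_add_right)
    finally have "pseudo_mod K H \<in> I" by (auto simp: I_def)
    then have "pseudo_mod K H = 0" using Hmin[of "pseudo_mod K H"] pseudo_mod(2)[OF H(2), of K] by linarith
    then show ?thesis using aq by (metis add_0_right dvd_triv_left)
  qed
  have "degree H = 0"
  proof (rule ccontr)
    assume dH: "degree H \<noteq> 0"
    let ?H = "primitive_part H"
    have "?H \<noteq> 0" using H by simp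
    moreover have "\<not> ?H dvd 1"
    proof
      assume "?H dvd 1"
      then have "degree ?H = 0" using dvd_imp_degree_le[of ?H 1] by simp
      then show False using dH by simp
    qed
    ultimately obtain p where p: "prime p" "p dvd ?H" using prime_divisor_exists by blast
    have pH: "p dvd H" using p(2) content_times_primitive_part[of H] dvd_smult by metis
    \<comment> \<open>A constant factor of a primitive polynomial divides its content, hence is a
      unit.\<close>
    have dp: "degree p \<noteq> 0"
    proof
      assume "degree p = 0"
      then obtain c where c: "p = [:c:]" by (rule degree_eq_zeroE)
      then have "c dvd content ?H" using p(2) by (simp add: const_poly_dvd_iff_dvd_content)
      then have "p dvd 1" using c H(2) by (simp add: is_unit_const_poly_iff)
      then show False using p(1) by (auto simp: prime_def prime_elem_def)
    qed
    have "p dvd K" if K: "K \<in> I" for K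
    proof -
      obtain a where a: "a \<noteq> 0" "H dvd smult a K" using div[OF K] by blast
      then have "p dvd [:a:] * K" using pH dvd_trans by fastforce
      moreover have "prime_elem p" using p(1) by simp
      ultimately have "p dvd [:a:] \<or> p dvd K" by (metis prime_elem_dvd_multD)
      moreover have "\<not> p dvd [:a:]" using dp a(1) dvd_imp_degree_le[of p "[:a:]"] by auto
      ultimately show ?thesis by blast
    qed
    then show False using cop[of p] p(1) FI GI by (auto simp: prime_def)
  qed
  then obtain c where "H = [:c:]" by (rule degree_eq_zeroE)
  then show ?thesis using that[of c] H by (auto simp: I_def)
qed

text \<open>The Neumann series of 1 + x T applied to 1. Its term \<open>s n\<close> is divisible by
  x^n, so the sum makes sense and the equation is verified modulo every power of x.\<close>

lemma vx_linear_fixpoint: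
  fixes T :: "series2 \<Rightarrow> series2"
  assumes diff: "\<And>f g. T (f - g) = T f - T g" and lin: "\<And>f. T (vx * f) = vx * T f"
  obtains w where "w = 1 - vx * T w"
proof -
  have powlin: "T (vx ^ n * f) = vx ^ n * T f" for n f
    by (induction n) (simp_all add: lin mult.assoc)
  have neg: "T (- f) = - T f" for f using diff[of 0 f] diff[of 0 0] by simp
  have sgnlin: "T ((- 1) ^ n * f) = (- 1) ^ n * T f" for n f
    by (cases "even n") (simp_all add: neg)
  define s where "s n = (- 1) ^ n * (vx ^ n * (T ^^ n) 1)" for n
  have Ts: "- (vx * T (s n)) = s (Suc n)" for n
    by (simp add: s_def sgnlin powlin)
  define w where "w = Abs2 (\<lambda>i j. \<Sum>n\<le>i. coeff2 (s n) i j)"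
  have s0: "coeff2 (s n) i j = 0" if "i < n" for n i j
  proof -
    have "vx ^ n dvd s n" by (simp add: s_def)
    then show ?thesis using that by (simp add: vx_power_dvd_iff)
  qed
  have w: "vx ^ N dvd w - (\<Sum>n<N. s n)" for N
    unfolding vx_power_dvd_iff
  proof (intro allI impI)
    fix i j assume "i < N"
    then have "(\<Sum>n<N. coeff2 (s n) i j) = (\<Sum>n\<le>i. coeff2 (s n) i j)"
      by (intro sum.mono_neutral_right) (auto simp: s0)
    then show "coeff2 (w - (\<Sum>n<N. s n)) i j = 0" by (simp add: w_def coeff2_sum)
  qed
  have "vx ^ N dvd w - (1 - vx * T w)" for N
  proof -
    obtain k where k: "w - (\<Sum>n<N. s n) = vx ^ N * k" using w[of N] by (auto simp: dvd_def)
    have "T w = T (\<Sum>n<N. s n) + vx ^ N * T k"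
      using diff[of w "\<Sum>n<N. s n"] by (simp add: k powlin)
    then have "1 - vx * T w = 1 - vx * T (\<Sum>n<N. s n) - vx ^ N * (vx * T k)"
      by (simp add: algebra_simps)
    also have "- (vx * T (\<Sum>n<N. s n)) = (\<Sum>n<N. s (Suc n))"
      by (simp add: additive_sum[of T, OF diff] sum_distrib_left Ts[symmetric] sum_negf)
    then have "1 - vx * T (\<Sum>n<N. s n) = s 0 + (\<Sum>n<N. s (Suc n))"
      by (simp add: s_def[of 0])
    also have "\<dots> = (\<Sum>n<N. s n) + s N"
      by (simp add: sum.lessThan_Suc_shift[symmetric] del: sum.lessThan_Suc) simp
    finally have "w - (1 - vx * T w) = vx ^ N * (k + vx * T k) - s N"
      using k by (simp add: algebra_simps)
    moreover have "vx ^ N dvd s N" by (simp add: s_def)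
    ultimately show ?thesis by (metis dvd_diff dvd_triv_left)
  qed
  then have "w = 1 - vx * T w"
    by (intro series2_eqI) (metis (no_types) vx_power_dvd_iff lessI coeff2_diff eq_iff_diff_eq_0)
  then show ?thesis by (rule that)
qed

text \<open>\<open>sh\<close> deletes the terms of degree below \<open>d\<close> in y and divides
  the rest by y^d. With g = x \<alpha> + y^d \<beta> and q = w / \<beta>, the requirement
  \<open>sh (q * g) = 1\<close> becomes w = 1 - x sh (w \<alpha> / \<beta>), an equation of the form
  solved above; it makes \<open>q * g\<close> a monic polynomial of degree \<open>d\<close> in
  y.\<close>

lemma weierstrass_preparation:
  assumes g: "coeff2 g 0 d \<noteq> 0" "\<And>j. j < d \<Longrightarrow> coeff2 g 0 j = 0"
  obtains q F where "q dvd 1" "fps_of_poly F = q * g" "degree F = d" "lead_coeff F = 1"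
    "\<And>j. j < d \<Longrightarrow> fps_nth (coeff F j) 0 = 0"
proof -
  define \<beta> where "\<beta> = Abs2 (\<lambda>i j. coeff2 g i (j + d))"
  define \<alpha> where "\<alpha> = Abs2 (\<lambda>i j. if j < d then coeff2 g (Suc i) j else 0)"
  define sh where "sh f = Abs2 (\<lambda>i j. coeff2 f i (j + d))" for f
  have sh_diff: "sh (f - h) = sh f - sh h" for f h by (rule series2_eqI) (simp add: sh_def)
  have sh_add: "sh (f + h) = sh f + sh h" for f h by (rule series2_eqI) (simp add: sh_def)
  have sh_vx: "sh (vx * f) = vx * sh f" for f
    by (rule series2_eqI) (simp add: sh_def coeff2_vx_power_mult[of 1, simplified])
  have sh_vy: "sh (vy ^ d * f) = f" for f
    by (rule series2_eqI) (simp add: sh_def coeff2_vy_power_mult)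
  have gab: "g = vx * \<alpha> + vy ^ d * \<beta>"
    by (rule series2_eqI)
      (auto simp: \<alpha>_def \<beta>_def coeff2_vx_power_mult[of 1, simplified] coeff2_vy_power_mult g(2))
  have "\<beta> dvd 1" using g(1) by (simp add: series2_unit_iff \<beta>_def)
  then obtain \<beta>' where b: "\<beta> * \<beta>' = 1" by (auto simp: dvd_def)
  obtain w where w: "w = 1 - vx * sh (w * \<alpha> * \<beta>')"
    by (rule vx_linear_fixpoint[of "\<lambda>w. sh (w * \<alpha> * \<beta>')"])
      (simp_all add: left_diff_distrib sh_diff sh_vx mult.assoc)
  define q where "q = w * \<beta>'"
  have "\<beta>' dvd 1" using b by (metis dvd_triv_right)
  moreover have "coeff2 w 0 0 = 1"
    by (subst w) (simp add: coeff2_1)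
  ultimately have q: "q dvd 1" by (simp add: q_def series2_unit_iff)
  have qg: "q * g = vx * (w * \<alpha> * \<beta>') + vy ^ d * w"
    by (simp add: gab q_def algebra_simps) (metis b mult.assoc mult.commute mult.right_neutral)
  have "sh (q * g) = 1"
    unfolding qg sh_add sh_vx sh_vy using w by (metis add_diff_cancel_left' diff_diff_eq2 add_diff_eq add.commute diff_add_cancel)
  then have top': "coeff2 (q * g) i (j + d) = (if i = 0 \<and> j = 0 then 1 else 0)" for i j
    by (metis sh_def coeff2_Abs2 coeff2_1)
  then have top: "coeff2 (q * g) i j = (if i = 0 \<and> j = d then 1 else 0)" if j: "j \<ge> d" for i j
  proof -
    obtain k where "j = k + d" using le_Suc_ex[OF j] by (auto simp: add.commute)
    then show ?thesis using top'[of i k] by simp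
  qed
  define F where "F = truncate_fps (Suc d) (q * g)"
  have Fq: "fps_of_poly F = q * g"
  proof (rule fps_ext)
    fix j
    have "fps_nth (q * g) j = 0" if "\<not> j < Suc d"
      using that top[of j] by (intro fps_ext) (simp add: coeff2_def)
    then show "fps_nth (fps_of_poly F) j = fps_nth (q * g) j"
      by (auto simp: F_def coeff_truncate_fps)
  qed
  have cF: "coeff F d = 1"
    using top[of d] by (intro fps_ext) (simp add: F_def coeff_truncate_fps coeff2_def)
  have dF: "degree F = d"
    using cF degree_truncate_fps[of "Suc d" "q * g"] le_degree[of F d] by (auto simp: F_def[symmetric])
  have "fps_nth (coeff F j) 0 = 0" if "j < d" for j
  proof -
    have "fps_nth (coeff F j) 0 = fps_nth (res0 (q * g)) j"
      using that by (simp add: F_def coeff_truncate_fps coeff2_def del: res0_mult)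
    also have "\<dots> = 0" using that g(2) unfolding res0_mult by (simp add: fps_mult_nth)
    finally show ?thesis .
  qed
  then show ?thesis using that[OF q Fq dF] cF dF by simp
qed

text \<open>Modulo x the polynomial \<open>F\<close> is a pure power of the variable, hence so is
  each factor up to a constant; leading coefficients are units, so no degree is lost. A nonconstant
  factor thus remains a non-unit as a power series.\<close>

lemma distinguished_factor:
  fixes P K F :: "complex fps poly"
  assumes F: "lead_coeff F = 1" "\<And>j. j < degree F \<Longrightarrow> fps_nth (coeff F j) 0 = 0"
    and PK: "F = P * K" and deg: "degree P > 0"
  shows "fps_nth (coeff P 0) 0 = 0"
proof -
  let ?r = "map_poly (\<lambda>c. fps_nth c 0)"
  have mult: "?r (A * B) = ?r A * ?r B" for A B :: "complex fps poly"
    by (intro poly_eqI) (simp add: coeff_map_poly coeff_mult fps_sum_nth)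
  have Fm: "?r F = monom 1 (degree F)"
  proof (intro poly_eqI)
    fix j
    show "coeff (?r F) j = coeff (monom 1 (degree F)) j"
      using F coeff_eq_0[of F j] by (cases "j < degree F"; cases "j = degree F") (auto simp: coeff_map_poly)
  qed
  have lc: "lead_coeff P * lead_coeff K = 1" using F(1) PK by (simp add: lead_coeff_mult)
  then have lc0: "fps_nth (lead_coeff P) 0 * fps_nth (lead_coeff K) 0 = 1"
    by (metis fps_mult_nth_0 fps_one_nth)
  have degP: "degree (?r P) = degree P" and degK: "degree (?r K) = degree K"
    using lc0 by (auto intro!: map_poly_degree_eq)
  have nz: "?r P \<noteq> 0" "?r K \<noteq> 0" using mult[of P K] Fm PK by (metis monom_eq_0_iff mult_zero_left mult_zero_right one_neq_zero)+
  have "order 0 (?r P) + order 0 (?r K) = order 0 (?r F)"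
    using nz by (simp add: PK mult order_mult)
  also have "\<dots> = degree F" by (simp add: Fm order_0_monom)
  also have "\<dots> = degree P + degree K"
    using PK F(1) by (metis degree_mult_eq leading_coeff_0_iff mult_zero_left mult_zero_right zero_neq_one)
  finally have "order 0 (?r P) = degree P"
    using order_degree[OF nz(1), of 0] order_degree[OF nz(2), of 0] degP degK by linarith
  then have "poly (?r P) 0 = 0" using deg nz by (metis order_root less_not_refl)
  then show ?thesis by (simp add: poly_0_coeff_0 coeff_map_poly)
qed

lemma squarefree_jacobian_power:
  assumes sq: "squarefree g" and nd: "\<not> vx dvd g"
  shows "jacobian_power vx g"
proof -
  obtain j where "coeff2 g 0 j \<noteq> 0" using nd by (auto simp: vx_dvd_iff fps_eq_iff)
  then obtain d where d: "coeff2 g 0 d \<noteq> 0" "\<And>j. j < d \<Longrightarrow> coeff2 g 0 j = 0"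
    using exists_least_iff[of "\<lambda>j. coeff2 g 0 j \<noteq> 0"] by auto
  obtain q F where q: "q dvd 1" and Fq: "fps_of_poly F = q * g" and dF: "degree F = d"
    and F: "lead_coeff F = 1" "\<And>j. j < d \<Longrightarrow> fps_nth (coeff F j) 0 = 0"
    using weierstrass_preparation[OF d] by blast
  obtain q' where q': "q' * q = 1" using q by (metis dvd_def mult.commute)
  have F0: "F \<noteq> 0" using F(1) by auto
  have unit0: "P dvd 1" if P: "P dvd F" "degree P = 0" for P
  proof -
    obtain c where c: "P = [:c:]" using P(2) by (rule degree_eq_zeroE)
    then have "c dvd coeff F d" using P(1) by (simp add: const_poly_dvd_iff)
    then show ?thesis using F(1) c dF by (simp add: is_unit_const_poly_iff)
  qed
  \<comment> \<open>In characteristic zero a prime common to \<open>F\<close> and its derivative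
    divides \<open>F\<close> twice; as a series it has no constant term, so its square contradicts
    \<open>squarefree g\<close>.\<close>
  have nocommon: "False" if p: "prime_elem p" "p dvd F" "p dvd pderiv F" for p
  proof -
    obtain A where A: "F = p * A" using p(2) by (auto simp: dvd_def)
    have dp: "degree p > 0" using unit0[OF p(2)] p(1) by (auto simp: prime_elem_def)
    have "p dvd pderiv p * A" using p(3) dvd_diff[of p "pderiv F" "p * pderiv A"] by (simp add: A pderiv_mult algebra_simps)
    moreover have "\<not> p dvd pderiv p"
    proof
      assume "p dvd pderiv p"
      moreover have "pderiv p \<noteq> 0" using dp by (simp add: pderiv_eq_0_iff)
      ultimately have "degree p \<le> degree (pderiv p)" by (rule dvd_imp_degree_le)
      then show False using dp by (simp add: degree_pderiv)
    qed
    ultimately have "p dvd A" using p(1) by (auto dest: prime_elem_dvd_multD)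
    then obtain K where K: "A = p * K" by (auto simp: dvd_def)
    have c: "fps_nth (coeff p 0) 0 = 0"
      using distinguished_factor[of F p A] F dF A dp by auto
    have "g = q' * fps_of_poly F" using q' by (simp add: Fq mult.assoc[symmetric])
    also have "\<dots> = (q' * fps_of_poly K) * fps_of_poly p ^ 2"
      by (simp add: A K fps_of_poly_mult power2_eq_square algebra_simps)
    finally have "fps_of_poly p ^ 2 dvd g" by simp
    then have "fps_of_poly p dvd 1" using sq by (simp add: squarefree_def)
    then show False using c by (simp add: series2_unit_iff coeff2_def)
  qed
  obtain A B c where c: "c \<noteq> 0" "[:c:] = A * F + B * pderiv F"
    using nocommon by (rule bezout_poly_const[OF F0])
  \<comment> \<open>A nonzero series in x is a unit times a power of x, which turns the constant
    \<open>c\<close> into a power of \<open>vx\<close>.\<close>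
  define N where "N = subdegree c"
  have "fps_nth (fps_shift N c) 0 \<noteq> 0" using c(1) by (simp add: N_def)
  then have "fps_shift N c dvd 1" by simp
  then obtain u where u: "fps_shift N c * u = 1" by (auto simp: dvd_def)
  have "c = fps_shift N c * fps_X ^ N" unfolding N_def by (rule subdegree_decompose)
  then have "c * u = (fps_shift N c * u) * fps_X ^ N"
    by (metis mult.assoc mult.commute)
  then have "vx ^ N = fps_const u * fps_of_poly [:c:]"
    by (simp add: vx_def fps_const_power fps_of_poly_const mult.commute[of u] u)
  also have "\<dots> = fps_const u * (fps_of_poly A * (q * g) + fps_of_poly B * dy (q * g))"
    by (simp add: c(2) fps_of_poly_add fps_of_poly_mult Fq[symmetric] fps_of_poly_pderiv dy_def)
  also have "\<dots> = (fps_const u * (fps_of_poly A * q + fps_of_poly B * dy q)) * g + 0 * dx g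
      + (fps_const u * fps_of_poly B * q) * dy g"
    by (simp add: dy.D_mult algebra_simps)
  finally show ?thesis unfolding jacobian_power_def by blast
qed

section \<open>Contact with smooth branches\<close>


lemma coeff2_fps_const: "coeff2 (fps_const s) i j = (if j = 0 then fps_nth s i else 0)"
  by (simp add: coeff2_def)

lemma coeff2_vx_power: "coeff2 (vx ^ i) a b = (if a = i \<and> b = 0 then 1 else 0)"
  using coeff2_mon[of i 0 1 a b] by (simp add: mon_def cst_1)

lemma subst2_fps_const_vx:
  assumes "coeff2 Y 0 0 = 0"
  shows "subst2 (fps_const s) vx Y = fps_const s"
proof (rule series2_eqI)
  fix a b
  have "coeff2 (subst2 (fps_const s) vx Y) a b
      = (\<Sum>i\<le>a + b. \<Sum>j\<le>a + b. if j = 0 then fps_nth s i * coeff2 (vx ^ i) a b else 0)"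
    unfolding coeff2_subst2 by (intro sum.cong refl) (simp add: coeff2_fps_const)
  also have "\<dots> = (\<Sum>i\<le>a + b. if i = a then (if b = 0 then fps_nth s a else 0) else 0)"
    by (intro sum.cong refl) (auto simp: sum.delta coeff2_vx_power)
  also have "\<dots> = coeff2 (fps_const s) a b"
    by (simp add: sum.delta coeff2_fps_const)
  finally show "coeff2 (subst2 (fps_const s) vx Y) a b = coeff2 (fps_const s) a b" .
qed

lemma coords_vx_shift: "fps_nth s 0 = 0 \<Longrightarrow> coords vx (vy + fps_const s)"
  by (simp add: coords_def jacobian0_def coeff2_vx coeff2_vy coeff2_fps_const)

lemma coords_vx_shift': "fps_nth s 0 = 0 \<Longrightarrow> coords vx (vy - fps_const s)"
  by (simp add: coords_def jacobian0_def coeff2_vx coeff2_vy coeff2_fps_const)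

text \<open>A smooth branch transversal to x = 0 is a graph y = s(x): y is expanded in the
  coordinates (x, z), and the part free of z is the series \<open>s\<close>.\<close>

lemma coords_vx_graph:
  assumes z: "coords vx z"
  obtains w s where "coeff2 w 0 0 \<noteq> 0" "fps_nth s 0 = 0" "z = w * (vy - fps_const s)"
proof -
  note z0 = coordsD(1,2)[OF z]
  obtain h where h: "subst2 h vx z = vy" using coords_surj[OF z] by blast
  define s where "s = fps_nth h 0"
  have "vy ^ 1 dvd h - fps_const s"
    unfolding vy_power_dvd_iff by (simp add: coeff2_fps_const s_def coeff2_def)
  then obtain k where k: "h = fps_const s + vy * k" by (auto simp: dvd_def algebra_simps)
  then have y: "vy = fps_const s + z * subst2 k vx z"
    using h by (simp add: subst2_add subst2_mult z0 subst2_vy subst2_fps_const_vx)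
  then have eq: "vy - fps_const s = z * subst2 k vx z" by (metis add_diff_cancel_left')
  have "coeff2 (vy - fps_const s) 0 1 = coeff2 z 0 1 * coeff2 k 0 0"
    unfolding eq coeff2_mult_01 using z0 by simp
  then have "coeff2 k 0 0 \<noteq> 0" by (auto simp: coeff2_vy coeff2_fps_const)
  then have "subst2 k vx z dvd 1" by (simp add: series2_unit_iff)
  then obtain w where w: "subst2 k vx z * w = 1" by (auto simp: dvd_def)
  then have "w dvd 1" by (metis dvd_triv_right)
  moreover have "z = w * (vy - fps_const s)" unfolding eq using w by (simp add: algebra_simps)
  moreover have "coeff2 (vy - fps_const s) 0 0 = 0" unfolding eq using z0 by simp
  then have "fps_nth s 0 = 0" by (simp add: coeff2_fps_const)
  ultimately show ?thesis using that by (simp add: series2_unit_iff)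
qed

text \<open>The factor \<open>c\<close> must be a unit: on x = 0 the order of \<open>g\<close> is at
  most \<delta> \<le> \<open>d\<close>, while the power of \<open>z\<close> already contributes at
  least \<open>d\<close>.\<close>

lemma contact_vx_graph:
  assumes g: "coeff2 g 0 \<delta> \<noteq> 0" "\<delta> \<le> d" and N: "N \<ge> 1" and "contact d N vx g"
  obtains c s where "coeff2 c 0 0 \<noteq> 0" "fps_nth s 0 = 0" "vx ^ N dvd g - c * (vy - fps_const s) ^ d"
proof -
  obtain z c e where z: "coords vx z" "g = c * z ^ d + e * vx ^ N"
    using assms(4) by (auto simp: contact_def)
  obtain w s where w: "coeff2 w 0 0 \<noteq> 0" "fps_nth s 0 = 0" "z = w * (vy - fps_const s)"
    using coords_vx_graph[OF z(1)] by blast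
  have "res0 vx = 0" using vx_dvd_iff[of vx] by simp
  then have r: "res0 g = res0 c * res0 z ^ d" using N by (simp add: z(2) zero_power)
  have "coeff2 c 0 0 \<noteq> 0"
  proof
    assume c: "coeff2 c 0 0 = 0"
    have nz: "res0 g \<noteq> 0" using g by (metis res0_nth fps_zero_nth)
    then have "res0 c \<noteq> 0" "res0 z ^ d \<noteq> 0" using r by auto
    then have "subdegree (res0 g) = subdegree (res0 c) + d * subdegree (res0 z)"
      by (simp add: r)
    moreover have "subdegree (res0 c) \<ge> 1"
      using c \<open>res0 c \<noteq> 0\<close> by (intro subdegree_geI) simp_all
    moreover have "d * subdegree (res0 z) \<ge> d"
    proof (cases "d = 0")
      case False
      then have "res0 z \<noteq> 0" using \<open>res0 z ^ d \<noteq> 0\<close> by auto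
      then have "subdegree (res0 z) \<ge> 1"
        using coordsD(2)[OF z(1)] by (intro subdegree_geI) simp_all
      then show ?thesis by simp
    qed simp
    moreover have "subdegree (res0 g) \<le> \<delta>" using g by (intro subdegree_leI) simp
    ultimately show False using g(2) by linarith
  qed
  then show ?thesis
    using that[of "c * w ^ d" s] w z(2) by (simp add: power_mult_distrib mult.assoc)
qed

lemma dvd_power_diff: "a - b dvd a ^ n - b ^ (n :: nat)" for a b :: "'a :: comm_ring_1"
proof (induction n)
  case (Suc n)
  have "a ^ Suc n - b ^ Suc n = a * (a ^ n - b ^ n) + (a - b) * b ^ n" by (simp add: algebra_simps)
  then show ?case using Suc by (simp add: dvd_add dvd_mult)
qed simp

lemma subst2_shift:
  assumes "fps_nth s 0 = 0"
  shows "subst2 (vy - fps_const t) vx (vy + fps_const s) = vy + fps_const (s - t)"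
  using coordsD(1,2)[OF coords_vx_shift[OF assms]]
  by (simp add: subst2_diff subst2_vy subst2_fps_const_vx fps_const_sub[symmetric] del: fps_const_sub)

text \<open>Move the second graph to y = 0 and then set y = 0: a unit times (s' - s)^d is divisible
  by x^(d K), hence s' - s by x^K. The precision \<open>d * K\<close> pays for the extraction of a
  \<open>d\<close>-th root.\<close>

lemma graph_approx_close:
  assumes c: "coeff2 c 0 0 \<noteq> 0" and s: "fps_nth s 0 = 0" and s': "fps_nth s' 0 = 0"
    and d: "d > 0" and g: "vx ^ (d * K) dvd g - c * (vy - fps_const s) ^ d"
    and g': "vx ^ (d * K) dvd g - c' * (vy - fps_const s') ^ d"
    and i: "i < K"
  shows "fps_nth s i = fps_nth s' i"
proof -
  let ?N = "d * K" and ?Y = "vy + fps_const s'"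
  note XY = coords_vx_shift[OF s']
  note XY0 = coordsD(1,2)[OF XY]
  let ?c = "fps_nth (subst2 c vx ?Y) 0"
  have "vx ^ ?N dvd c * (vy - fps_const s) ^ d - c' * (vy - fps_const s') ^ d"
    using dvd_diff[OF g' g] by simp
  then have "subst2 (vx ^ ?N) vx ?Y dvd subst2 (c * (vy - fps_const s) ^ d - c' * (vy - fps_const s') ^ d) vx ?Y"
    using subst2_dvd_iff[OF XY] by blast
  then have "vx ^ ?N dvd subst2 c vx ?Y * (vy + fps_const (s' - s)) ^ d - subst2 c' vx ?Y * vy ^ d"
    unfolding subst2_diff[of "c * _"] subst2_mult[OF XY0] subst2_power[OF XY0] subst2_vx[OF XY0]
      subst2_shift[OF s'] by simp
  then obtain k where "subst2 c vx ?Y * (vy + fps_const (s' - s)) ^ d - subst2 c' vx ?Y * vy ^ d = vx ^ ?N * k"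
    by (auto simp: dvd_def)
  then have "fps_nth (subst2 c vx ?Y * (vy + fps_const (s' - s)) ^ d - subst2 c' vx ?Y * vy ^ d) 0
      = fps_nth (vx ^ ?N * k) 0" by simp
  then have eq: "?c * (s' - s) ^ d = fps_X ^ ?N * fps_nth k 0"
    using d by (simp add: fps_power_zeroth vy_def vx_def fps_const_power zero_power)
  show ?thesis
  proof (cases "s' = s")
    case False
    have c0: "fps_nth ?c 0 \<noteq> 0" using c coeff2_subst2_00[of c vx ?Y] by (simp add: coeff2_def)
    then have "?c \<noteq> 0" by auto
    then have "fps_nth k 0 \<noteq> 0" using eq False by auto
    then have "?N \<le> subdegree (?c * (s' - s) ^ d)"
      unfolding eq by (simp add: fps_X_power_subdegree)
    also have "\<dots> = d * subdegree (s' - s)" using c0 \<open>?c \<noteq> 0\<close> False by simp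
    finally have "K \<le> subdegree (s' - s)" using d by simp
    then have "fps_nth (s' - s) i = 0" using i by (intro nth_less_subdegree_zero) simp
    then show ?thesis by simp
  qed simp
qed

text \<open>A branch of multiplicity \<open>d \<ge> 2\<close> in \<open>g\<close> divides
  \<open>g\<close> and both its derivatives, hence a power of x by the Jacobian condition; a graph
  over the x-axis cannot do so.\<close>

lemma contact_bounded_vx:
  assumes g: "coeff2 g 0 \<delta> \<noteq> 0" "\<delta> \<le> d" and d: "d \<ge> 2" and jp: "jacobian_power vx g"
  shows "\<exists>N. \<not> contact d N vx g"
proof (rule ccontr)
  assume "\<nexists>N. \<not> contact d N vx g"
  then have "\<exists>c s. coeff2 c 0 0 \<noteq> 0 \<and> fps_nth s 0 = 0 \<and> vx ^ N dvd g - c * (vy - fps_const s) ^ d" if "N \<ge> 1" for N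
    using contact_vx_graph[OF g that] by metis
  then obtain c s where cs: "\<And>N. N \<ge> 1 \<Longrightarrow> coeff2 (c N) 0 0 \<noteq> 0" "\<And>N. N \<ge> 1 \<Longrightarrow> fps_nth (s N) 0 = 0"
      "\<And>N. N \<ge> 1 \<Longrightarrow> vx ^ N dvd g - c N * (vy - fps_const (s N)) ^ d"
    by metis
  \<comment> \<open>Precision \<open>d * (i + 1)\<close> fixes the coefficients up to index
    \<open>i\<close> by \<open>graph_approx_close\<close>, so the approximating graphs converge to
    \<sigma>.\<close>
  define \<sigma> where "\<sigma> = Abs_fps (\<lambda>i. fps_nth (s (d * (i + 1))) i)"
  have stable: "fps_nth (s (d * K)) i = fps_nth \<sigma> i" if "i < K" for i K
  proof -
    have *: "d * (i + 1) \<le> d * K" using that by (intro mult_le_mono) auto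
    have "vx ^ (d * (i + 1)) dvd g - c (d * K) * (vy - fps_const (s (d * K))) ^ d"
      using cs(3)[of "d * K"] le_imp_power_dvd[OF *, of vx] that d by (auto intro: dvd_trans)
    then have "fps_nth (s (d * (i + 1))) i = fps_nth (s (d * K)) i"
      using cs that d by (intro graph_approx_close[of "c (d * (i + 1))" _ _ d "i + 1" g "c (d * K)"]) auto
    then show ?thesis by (simp add: \<sigma>_def)
  qed
  have \<sigma>0: "fps_nth \<sigma> 0 = 0" using stable[of 0 1] cs(2)[of d] d by simp
  let ?z = "vy - fps_const \<sigma>"
  have cong: "vx ^ K dvd g - c (d * K) * ?z ^ d" if "K \<ge> 1" for K
  proof -
    let ?s = "s (d * K)"
    have "K \<le> d * K" "d * K \<ge> 1" using d that by auto
    then have 1: "vx ^ K dvd g - c (d * K) * (vy - fps_const ?s) ^ d"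
      using cs(3)[of "d * K"] le_imp_power_dvd[of K "d * K" vx] by (auto intro: dvd_trans)
    have "vx ^ K dvd (vy - fps_const ?s) - ?z"
      unfolding vx_power_dvd_iff by (auto simp: coeff2_fps_const stable)
    then have "vx ^ K dvd (vy - fps_const ?s) ^ d - ?z ^ d" by (rule dvd_trans[OF _ dvd_power_diff])
    then have "vx ^ K dvd c (d * K) * ((vy - fps_const ?s) ^ d - ?z ^ d)" by (rule dvd_mult)
    from dvd_add[OF 1 this] show ?thesis by (simp add: algebra_simps)
  qed
  note XY = coords_vx_shift[OF \<sigma>0]
  note XY0 = coordsD(1,2)[OF XY]
  let ?Y = "vy + fps_const \<sigma>"
  have sz: "subst2 (?z ^ d) vx ?Y = vy ^ d"
    using subst2_shift[OF \<sigma>0, of \<sigma>] by (simp add: subst2_power[OF XY0])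
  \<comment> \<open>The limit graph has been moved to y = 0; the coefficient at x^i is tested with
    an approximation modulo x^(i + 1).\<close>
  have "coeff2 (subst2 g vx ?Y) i j = 0" if "j < d" for i j
  proof -
    have "subst2 (vx ^ Suc i) vx ?Y dvd subst2 (g - c (d * Suc i) * ?z ^ d) vx ?Y"
      using cong[of "Suc i"] subst2_dvd_iff[OF XY] by auto
    then have "vx ^ Suc i dvd subst2 g vx ?Y - vy ^ d * subst2 (c (d * Suc i)) vx ?Y"
      unfolding subst2_diff[of g] subst2_mult[OF XY0] sz unfolding subst2_power[OF XY0] subst2_vx[OF XY0]
      by (simp add: mult.commute)
    then have "coeff2 (subst2 g vx ?Y - vy ^ d * subst2 (c (d * Suc i)) vx ?Y) i j = 0"
      unfolding vx_power_dvd_iff by blast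
    then show ?thesis using that by (simp add: coeff2_vy_power_mult)
  qed
  then have "subst2 (?z ^ d) vx ?Y dvd subst2 g vx ?Y"
    unfolding sz vy_power_dvd_iff by blast
  then have "?z ^ d dvd g" using subst2_dvd_iff[OF XY] by blast
  then have "?z ^ 2 dvd g" using le_imp_power_dvd[OF d, of ?z] by (rule dvd_trans[rotated])
  then obtain k where k: "g = ?z * (?z * k)" by (auto simp: dvd_def power2_eq_square mult.assoc)
  obtain N a b e where "vx ^ N = a * g + b * dx g + e * dy g" using jp by (auto simp: jacobian_power_def)
  then have "vx ^ N = ?z * (a * (?z * k) + b * (dx ?z * k + dx (?z * k)) + e * (dy ?z * k + dy (?z * k)))"
    unfolding k dx.D_mult[of ?z "?z * k"] dy.D_mult[of ?z "?z * k"] by (simp only: ring_distribs mult_ac)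
  then have dvd: "?z dvd vx ^ N" by (metis dvd_triv_left)
  have z: "coords ?z vx" using coords_vx_shift'[OF \<sigma>0] coords_commute by blast
  have "?z dvd vx" using prime_elem_dvd_power[OF prime_coords[OF z] dvd] .
  then obtain q where q: "vx = ?z * q" by (auto simp: dvd_def)
  have z0: "coeff2 ?z 0 0 = 0" using z by (simp add: coords_def)
  from z0 have s0: "coeff2 (fps_const \<sigma>) 0 0 = 0" by simp
  \<comment> \<open>The first equation forces the quotient \<open>q\<close> to vanish at the origin,
    the second forbids it.\<close>
  have "coeff2 ?z 0 1 * coeff2 q 0 0 = coeff2 vx 0 1"
    by (subst q, subst coeff2_mult_01) (simp add: z0 s0)
  moreover have "coeff2 ?z 1 0 * coeff2 q 0 0 = coeff2 vx 1 0"
    by (subst q, subst coeff2_mult_10) (simp add: z0 s0)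
  ultimately show False by (simp add: coeff2_vx coeff2_vy coeff2_fps_const)
qed

section \<open>The chart at a point of an exceptional component\<close>


lemma coeff2_corner_decomposition:
  assumes "\<And>i j. i < n \<Longrightarrow> j < d \<Longrightarrow> coeff2 f i j = 0"
  obtains A B where "f = A * vy ^ d + B * vx ^ n"
proof -
  define A where "A = Abs2 (\<lambda>i j. coeff2 f i (j + d))"
  have "vx ^ n dvd f - vy ^ d * A"
    unfolding vx_power_dvd_iff by (auto simp: coeff2_vy_power_mult A_def assms)
  then obtain B where "f - vy ^ d * A = vx ^ n * B" by (auto simp: dvd_def)
  then have "f = A * vy ^ d + B * vx ^ n" by (simp add: algebra_simps)
  then show ?thesis by (rule that)
qed

lemma contact_vxI:
  assumes "\<And>i j. i < N \<Longrightarrow> j < n \<Longrightarrow> coeff2 g i j = 0"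
  shows "contact n N vx g"
  using coeff2_corner_decomposition[OF assms] coords_vx_vy unfolding contact_def by metis

lemma coeff2_subst2_blowup:
  "coeff2 (subst2 f vx (vx ^ q * vy)) (i + q * j) j = coeff2 f i j"
proof -
  have XY: "vx ^ k * (vx ^ q * vy) ^ l = mon (k + q * l) l 1" for k l
    by (simp add: mon_def cst_1 power_mult_distrib power_add power_mult mult.assoc)
  have "coeff2 (subst2 f vx (vx ^ q * vy)) (i + q * j) j
    = (\<Sum>k\<le>i + q * j + j. \<Sum>l\<le>i + q * j + j. if l = j then (if k = i then coeff2 f i j else 0) else 0)"
    unfolding coeff2_subst2 XY coeff2_mon by (intro sum.cong refl) auto
  also have "\<dots> = coeff2 f i j" by (simp add: sum.delta)
  finally show ?thesis .
qed

lemma pcompose_power: "pcompose (A ^ n) (B :: complex poly) = pcompose A B ^ n"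
  by (induction n) (simp_all add: pcompose_mult pcompose_1)

text \<open>The chart at the point with coordinate \<open>c\<close> on the orbit of the ray through
  (p, q). The relation between \<open>a\<close> and \<open>b\<close> completes (p, q) by (b, a) to a
  basis of the lattice; it is additive because exponents are natural numbers. \<open>M\<close> is
  the minimal weight of the support.\<close>

locale newton_chart =
  fixes g :: series2 and p q a b M :: nat and c :: complex
  assumes pos: "p > 0" "q > 0" and unimodular: "a * p = 1 + b * q" and c: "c \<noteq> 0"
    and M_le: "coeff2 g i j \<noteq> 0 \<Longrightarrow> M \<le> p * i + q * j"
    and M_eq: "\<exists>i j. coeff2 g i j \<noteq> 0 \<and> p * i + q * j = M"
begin

text \<open>The orbit coordinate, centred by v = W - c. It is a unit because \<open>c\<close> is
  nonzero, so u = 0 is the only boundary component through the point.\<close>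

definition W :: series2 where "W = cst c + vy"
definition X :: series2 where "X = vx ^ p * W ^ b"
definition Y :: series2 where "Y = vx ^ q * W ^ a"

lemma XY0: "coeff2 X 0 0 = 0" "coeff2 Y 0 0 = 0"
  using pos by (simp_all add: X_def Y_def)

lemma W_unit: "W dvd 1"
  using c by (simp add: series2_unit_iff W_def coeff2_cst)

lemma XY_monomial: "X ^ i * Y ^ j = vx ^ (p * i + q * j) * W ^ (b * i + a * j)"
  by (simp add: X_def Y_def power_mult_distrib power_add ac_simps flip: power_mult)


lemma coeff2_W_power: "coeff2 (W ^ e) i j = (if i = 0 then coeff ([:c, 1:] ^ e) j else 0)"
proof (induction e arbitrary: i j)
  case 0
  then show ?case by (auto simp: coeff2_1)
next
  case (Suc e)
  have "coeff2 (W ^ Suc e) i j = c * coeff2 (W ^ e) i j + (if j = 0 then 0 else coeff2 (W ^ e) i (j - 1))"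
    using coeff2_vy_power_mult[of 1 "W ^ e" i j] by (simp add: W_def ring_distribs)
  also have "\<dots> = (if i = 0 then coeff ([:c, 1:] ^ Suc e) j else 0)"
    by (auto simp: Suc.IH coeff_pCons split: nat.splits)
  finally show ?case .
qed

lemma chart_exists: "\<exists>h. subst2 g X Y = vx ^ M * h"
proof -
  have "coeff2 (subst2 g X Y) k l = 0" if "k < M" for k l
  proof -
    have "coeff2 g i j * coeff2 (X ^ i * Y ^ j) k l = 0" for i j
      using M_le[of i j] that by (cases "coeff2 g i j = 0") (auto simp: XY_monomial coeff2_vx_power_mult)
    then show ?thesis unfolding coeff2_subst2 by (intro sum.neutral ballI)
  qed
  then have "vx ^ M dvd subst2 g X Y" by (simp add: vx_power_dvd_iff)
  then show ?thesis by (auto simp: dvd_def)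
qed

definition h :: series2 where "h = (SOME h. subst2 g X Y = vx ^ M * h)"

lemma chart: "subst2 g X Y = vx ^ M * h"
  unfolding h_def by (rule someI_ex[OF chart_exists])

text \<open>The lattice points of weight \<open>M\<close>; the bounds by \<open>M\<close> follow
  from p, q > 0 and make finiteness visible. \<open>ex\<close> is the exponent of \<open>W\<close>
  in the pulled back monomial, and \<open>P\<close> is the initial form of \<open>g\<close> for the
  weight (p, q), read as a polynomial in \<open>W\<close>.\<close>

definition E :: "(nat \<times> nat) set" where "E = {(i, j). i \<le> M \<and> j \<le> M \<and> p * i + q * j = M}"
definition ex :: "nat \<times> nat \<Rightarrow> nat" where "ex = (\<lambda>(i, j). b * i + a * j)"
definition P :: "complex poly" where "P = (\<Sum>v\<in>E. monom (coeff2 g (fst v) (snd v)) (ex v))"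

lemma finite_E: "finite E"
  by (rule finite_subset[of _ "{..M} \<times> {..M}"]) (auto simp: E_def)

lemma E_I:
  assumes "p * i + q * j = M"
  shows "(i, j) \<in> E"
proof -
  have "1 * i \<le> p * i" "1 * j \<le> q * j" using pos by (intro mult_le_mono; simp)+
  then have "i \<le> M" "j \<le> M" using assms by linarith+
  then show ?thesis using assms by (simp add: E_def)
qed

text \<open>Inversion of the unimodular matrix with rows (p, q) and (b, a), kept free of
  subtraction. By the first identity, one step in the exponent of \<open>W\<close> raises the height
  \<open>j\<close> by \<open>p\<close>.\<close>

lemma ex_inverse:
  assumes "(i, j) \<in> E"
  shows "j + b * M = p * ex (i, j)" "i + q * ex (i, j) = a * M"
proof -
  have "j + b * M = (1 + b * q) * j + b * (p * i)"
    using assms by (auto simp: E_def algebra_simps)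
  then show "j + b * M = p * ex (i, j)"
    unfolding unimodular[symmetric] by (simp add: ex_def algebra_simps)
  have "a * M = (a * p) * i + a * (q * j)" using assms by (auto simp: E_def algebra_simps)
  then show "i + q * ex (i, j) = a * M"
    unfolding unimodular by (simp add: ex_def algebra_simps)
qed

lemma inj_ex: "inj_on ex E"
proof (rule inj_onI)
  fix v w assume "v \<in> E" "w \<in> E" "ex v = ex w"
  then show "v = w"
    using ex_inverse[of "fst v" "snd v"] ex_inverse[of "fst w" "snd w"]
    by (simp add: prod_eq_iff)
qed

lemma coeff_P: "v \<in> E \<Longrightarrow> coeff P (ex v) = coeff2 g (fst v) (snd v)"
proof -
  assume v: "v \<in> E"
  have "coeff P (ex v) = (\<Sum>w\<in>E. if w = v then coeff2 g (fst v) (snd v) else 0)"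
    unfolding P_def coeff_sum using v inj_ex by (intro sum.cong refl) (auto dest: inj_onD)
  then show ?thesis using v finite_E by simp
qed

lemma coeff_P_nonzeroD: 
  assumes "coeff P e \<noteq> 0"
  obtains i j where "(i, j) \<in> E" "coeff2 g i j \<noteq> 0" "e = ex (i, j)"
proof -
  obtain v where "v \<in> E" "coeff (monom (coeff2 g (fst v) (snd v)) (ex v)) e \<noteq> 0"
    using assms unfolding P_def coeff_sum by (rule sum.not_neutral_contains_not_neutral)
  then show ?thesis using that[of "fst v" "snd v"] by (auto split: if_splits)
qed

lemma P_nonzero: "P \<noteq> 0"
  using M_eq E_I coeff_P by fastforce

text \<open>Setting u = 0 keeps only the terms of weight exactly \<open>M\<close>, so h(0, v) is P(c
  + v).\<close>

lemma coeff2_h: "coeff2 h 0 l = coeff (pcompose P [:c, 1:]) l"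
proof -
  have "coeff2 h 0 l = coeff2 (subst2 g X Y) M l"
    by (simp add: chart coeff2_vx_power_mult)
  also have "\<dots> = (\<Sum>v\<in>{..M + l} \<times> {..M + l}. coeff2 g (fst v) (snd v) * coeff2 (X ^ fst v * Y ^ snd v) M l)"
    unfolding coeff2_subst2 by (simp add: sum.cartesian_product split_def)
  also have "\<dots> = (\<Sum>v\<in>E. coeff2 g (fst v) (snd v) * coeff ([:c, 1:] ^ ex v) l)"
  proof (rule sum.mono_neutral_cong_right)
    show "E \<subseteq> {..M + l} \<times> {..M + l}" by (auto simp: E_def)
    show "\<forall>v\<in>{..M + l} \<times> {..M + l} - E. coeff2 g (fst v) (snd v) * coeff2 (X ^ fst v * Y ^ snd v) M l = 0"
    proof
      fix v assume v: "v \<in> {..M + l} \<times> {..M + l} - E"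
      then have "p * fst v + q * snd v \<noteq> M" using E_I[of "fst v" "snd v"] by auto
      then show "coeff2 g (fst v) (snd v) * coeff2 (X ^ fst v * Y ^ snd v) M l = 0"
        using M_le[of "fst v" "snd v"] by (auto simp: XY_monomial coeff2_vx_power_mult coeff2_W_power)
    qed
    show "coeff2 g (fst v) (snd v) * coeff2 (X ^ fst v * Y ^ snd v) M l
        = coeff2 g (fst v) (snd v) * coeff ([:c, 1:] ^ ex v) l" if "v \<in> E" for v
    proof -
      have "p * fst v + q * snd v = M" using that by (auto simp: E_def)
      then show ?thesis
        by (simp add: XY_monomial coeff2_vx_power_mult coeff2_W_power ex_def split_def)
    qed
  qed simp
  also have "\<dots> = coeff (pcompose P [:c, 1:]) l"
    by (simp add: P_def pcompose_sum pcompose_smult pcompose_power monom_altdef coeff_sum pcompose_pCons)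
  finally show ?thesis .
qed

text \<open>
  A zero of order \<open>k\<close> of \<open>P\<close> at a nonzero point forces the exponents of \<open>P\<close> to spread over a length
  at least \<open>k\<close>, that is, the edge has height at least \<open>p k\<close>.
\<close>

lemma edge_height:
  assumes "\<And>l. l < k \<Longrightarrow> coeff2 h 0 l = 0"
  obtains i j where "(i, j) \<in> E" "p * k \<le> j"
proof -
  define e0 where "e0 = (LEAST e. coeff P e \<noteq> 0)"
  have "\<exists>e. coeff P e \<noteq> 0" using P_nonzero by (auto simp: poly_eq_iff)
  then have e0: "coeff P e0 \<noteq> 0" unfolding e0_def by (rule LeastI_ex)
  have low: "coeff P e = 0" if "e < e0" for e
    using not_less_Least[of e "\<lambda>e. coeff P e \<noteq> 0"] that by (auto simp: e0_def)
  have "monom 1 e0 dvd P" using low by (simp add: monom_1_dvd_iff')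
  then have d0: "[:0, 1:] ^ e0 dvd P" by (simp add: monom_altdef)
  have "monom 1 k dvd pcompose P [:c, 1:]" using assms coeff2_h by (simp add: monom_1_dvd_iff')
  then obtain Q where "pcompose P [:c, 1:] = [:0, 1:] ^ k * Q" by (auto simp: monom_altdef dvd_def)
  \<comment> \<open>Undoing the translation turns the order of h(0, v) into a root multiplicity of
    \<open>P\<close> at \<open>c\<close>.\<close>
  then have "pcompose (pcompose P [:c, 1:]) [:- c, 1:] = pcompose ([:0, 1:] ^ k * Q) [:- c, 1:]" by simp
  then have "P = [:- c, 1:] ^ k * pcompose Q [:- c, 1:]"
    by (simp add: pcompose_assoc[symmetric] pcompose_mult pcompose_power pcompose_pCons)
  then have d1: "[:- c, 1:] ^ k dvd P" by (metis dvd_triv_left)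
  obtain P' where P': "P = [:0, 1:] ^ e0 * P'" using d0 by (auto simp: dvd_def)
  then have "P' \<noteq> 0" using P_nonzero by auto
  \<comment> \<open>Since \<open>c\<close> is nonzero, the lowest power of \<open>W\<close> has no
    root there; the multiplicity is carried by \<open>P'\<close>, whose degree bounds it.\<close>
  have "poly ([:0, 1:] ^ e0) c \<noteq> 0" using c by simp
  then have "order c ([:0, 1:] ^ e0) = 0" by (metis order_root)
  then have "order c P = order c P'" using P_nonzero unfolding P' by (simp add: order_mult)
  moreover have "k \<le> order c P" using d1 P_nonzero by (simp add: order_divides)
  ultimately have "k \<le> degree P'" using order_degree[OF \<open>P' \<noteq> 0\<close>, of c] by linarith
  moreover have "degree P = e0 + degree P'"
    using \<open>P' \<noteq> 0\<close> unfolding P' by (simp add: degree_mult_eq degree_power_eq)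
  ultimately have e: "e0 + k \<le> degree P" by simp
  obtain i1 j1 where v1: "(i1, j1) \<in> E" "coeff2 g i1 j1 \<noteq> 0" "degree P = ex (i1, j1)"
    using P_nonzero by (metis leading_coeff_0_iff coeff_P_nonzeroD)
  obtain i0 j0 where v0: "(i0, j0) \<in> E" "coeff2 g i0 j0 \<noteq> 0" "e0 = ex (i0, j0)"
    using e0 by (rule coeff_P_nonzeroD)
  have "p * (e0 + k) \<le> p * degree P" using e by simp
  then have "p * k \<le> j1"
    using ex_inverse(1)[OF v1(1)] ex_inverse(1)[OF v0(1)] v0(3) v1(3) by (simp add: algebra_simps)
  then show ?thesis using that v1 by blast
qed

section \<open>Intersection number, Jacobian condition and contact across one chart\<close>

lemma E_height:
  assumes "(i, j) \<in> E" "coeff2 g 0 \<delta> \<noteq> 0"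
  shows "j \<le> \<delta>"
proof -
  have "M = p * i + q * j" using assms(1) by (simp add: E_def)
  then have "q * j \<le> q * \<delta>" using M_le[OF assms(2)] by linarith
  then show ?thesis using pos by simp
qed

text \<open>Order at least \<delta> + 1 of h(0, v) would need a point of height p (\<delta> + 1) on
  the edge, but the monomial y^\<delta> bounds such heights by \<delta>.\<close>

lemma h_order:
  assumes "coeff2 g 0 \<delta> \<noteq> 0"
  shows "\<exists>l\<le>\<delta>. coeff2 h 0 l \<noteq> 0"
proof (rule ccontr)
  assume "\<not> ?thesis"
  then have "coeff2 h 0 l = 0" if "l < Suc \<delta>" for l using that by auto
  then obtain i j where "(i, j) \<in> E" "p * Suc \<delta> \<le> j" by (rule edge_height)
  moreover have "Suc \<delta> \<le> p * Suc \<delta>" using pos by (cases p) auto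
  ultimately show False using E_height[of i j \<delta>] assms by linarith
qed

text \<open>A point of the edge has height at least p d, while \<open>E_height\<close> bounds it by
  \<delta> \<le> d; hence p = 1 and the height is d. The weight of (0, d) bounds \<open>M\<close>
  from above, that of the edge point from below.\<close>

lemma h_order_max:
  assumes \<delta>: "coeff2 g 0 \<delta> \<noteq> 0" "\<delta> \<le> d" and d: "d > 0" and h: "\<And>l. l < d \<Longrightarrow> coeff2 h 0 l = 0"
  shows "p = 1" "M = q * d"
proof -
  obtain i j where v: "(i, j) \<in> E" "p * d \<le> j" using h by (rule edge_height)
  have j: "j \<le> \<delta>" using v(1) \<delta>(1) by (rule E_height)
  then have "p * d \<le> d" using v \<delta> by linarith
  then show p: "p = 1" using d pos by simp
  have "d \<le> \<delta>" "d = \<delta>" "j = d" using v(2) j \<delta>(2) p by auto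
  then have "M \<le> q * d" "q * d \<le> M" using M_le[OF \<delta>(1)] v(1) by (auto simp: E_def)
  then show "M = q * d" by simp
qed

text \<open>The logarithmic form dx dy / (x y) pulls back to du dW / (u W) times a p - b q = 1, so
  the Jacobian is a monomial in u and the unit \<open>W\<close>. The extra factor \<open>W\<close>
  avoids the exponent a + b - 1.\<close>

lemma jac_XY: "W * jac X Y = vx ^ (p + q - 1) * W ^ (a + b)"
proof -
  obtain p' where p': "p = Suc p'" using pos by (cases p) auto
  obtain q' where q': "q = Suc q'" using pos by (cases q) auto
  have a: "a > 0" using unimodular by (cases a) auto
  have dW: "dx W = 0" "dy W = 1" by (simp_all add: W_def dx.D_add dy.D_add dx.D_cst dy.D_cst)
  have pw: "of_nat n * W ^ (n - 1) * W = of_nat n * W ^ n" for n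
  proof (cases n)
    case (Suc m)
    then show ?thesis by (simp add: algebra_simps)
  qed simp
  have dyX: "dy X * W = vx ^ p * (of_nat b * W ^ b)"
    unfolding X_def by (simp add: dy.D_mult dy.D_power dW mult.assoc pw[unfolded mult.assoc] del: One_nat_def)
  have dyY: "dy Y * W = vx ^ q * (of_nat a * W ^ a)"
    unfolding Y_def by (simp add: dy.D_mult dy.D_power dW mult.assoc pw[unfolded mult.assoc] del: One_nat_def)
  have dpow: "dx (W ^ n) = 0" for n by (simp add: dx.D_power dW)
  have dxX: "dx X = of_nat p * vx ^ p' * W ^ b" and dxY: "dx Y = of_nat q * vx ^ q' * W ^ a"
    unfolding X_def Y_def dx.D_mult dpow dx.D_power[of vx] by (simp_all add: p' q' del: power_Suc)
  have "W * jac X Y = dx X * (dy Y * W) - (dy X * W) * dx Y"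
    by (simp add: jac_def algebra_simps)
  also have "\<dots> = (of_nat (a * p) - of_nat (b * q)) * (vx ^ (p + q - 1) * W ^ (a + b))"
    unfolding dyX dyY dxX dxY by (simp add: p' q' power_add algebra_simps)
  also have "\<dots> = vx ^ (p + q - 1) * W ^ (a + b)" unfolding unimodular by simp
  finally show ?thesis .
qed

text \<open>After multiplication by the Jacobian the pulled back relation involves the derivatives
  of u^M h, and the product rule moves the derivatives of u^M into the coefficient of
  \<open>h\<close>. The left side is a power of u times a power of the unit \<open>W\<close>, which
  is divided out at the end.\<close>

lemma jacobian_power_h:
  assumes "jacobian_power vx g"
  shows "jacobian_power vx h"
proof -
  obtain N A B C where N: "vx ^ N = A * g + B * dx g + C * dy g"
    using assms by (auto simp: jacobian_power_def)
  let ?s = "\<lambda>f. subst2 f X Y"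
  let ?G = "vx ^ M * h"
  have "X ^ N = ?s A * ?G + ?s B * ?s (dx g) + ?s C * ?s (dy g)"
    using arg_cong[OF N, of ?s]
    by (simp add: subst2_add subst2_mult XY0 subst2_power subst2_vx chart)
  then have "jac X Y * X ^ N = jac X Y * ?s A * ?G + ?s B * (jac X Y * ?s (dx g)) + ?s C * (jac X Y * ?s (dy g))"
    by (simp add: algebra_simps)
  also have "\<dots> = jac X Y * ?s A * ?G + (?s B * dy Y - ?s C * dy X) * dx ?G
      + (?s C * dx X - ?s B * dx Y) * dy ?G"
    unfolding jac_chain_rule[OF XY0] chart by (simp add: algebra_simps)
  also obtain A' B' C' where "\<dots> = A' * h + B' * dx h + C' * dy h"
  proof
    show "jac X Y * ?s A * ?G + (?s B * dy Y - ?s C * dy X) * dx ?G + (?s C * dx X - ?s B * dx Y) * dy ?G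
      = (jac X Y * ?s A * vx ^ M + (?s B * dy Y - ?s C * dy X) * dx (vx ^ M)
          + (?s C * dx X - ?s B * dx Y) * dy (vx ^ M)) * h
        + ((?s B * dy Y - ?s C * dy X) * vx ^ M) * dx h + ((?s C * dx X - ?s B * dx Y) * vx ^ M) * dy h"
      unfolding dx.D_mult[of "vx ^ M"] dy.D_mult[of "vx ^ M"] by (simp add: algebra_simps)
  qed
  finally have JX: "jac X Y * X ^ N = A' * h + B' * dx h + C' * dy h" .
  obtain V where V: "W * V = 1" using W_unit by (auto simp: dvd_def)
  define e where "e = a + b + b * N"
  have "W * (jac X Y * X ^ N) = vx ^ (p + q - 1 + p * N) * W ^ e"
    unfolding mult.assoc[symmetric] jac_XY
    by (simp add: X_def power_mult_distrib power_add e_def ac_simps flip: power_mult)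
  then have "vx ^ (p + q - 1 + p * N) * (W ^ e * V ^ e) = V ^ e * W * (jac X Y * X ^ N)"
    by (simp add: algebra_simps)
  also have "W ^ e * V ^ e = 1" by (simp add: power_mult_distrib[symmetric] V)
  finally have "vx ^ (p + q - 1 + p * N) = (V ^ e * W * A') * h + (V ^ e * W * B') * dx h + (V ^ e * W * C') * dy h"
    unfolding JX by (simp add: algebra_simps)
  then show ?thesis unfolding jacobian_power_def by blast
qed

lemma h_not_dvd: "\<not> vx dvd h"
proof
  assume "vx dvd h"
  then have "coeff2 h 0 l = 0" for l by (simp add: vx_dvd_iff fps_eq_iff)
  then have "pcompose P [:c, 1:] = 0" by (simp add: coeff2_h poly_eq_iff)
  then show False using P_nonzero by (simp add: pcompose_eq_0_iff)
qed

text \<open>The branch v = s(u) is the strict transform of y = x^q (c + s(x)). With both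
  straightened, the coefficient of x^i y^j in \<open>g'\<close> is that of u^(i + q j - q d) v^j in
  \<open>h'\<close>; for \<open>j < d\<close> the first exponent drops by at least \<open>q\<close>,
  hence at least by one.\<close>

lemma contact_lift:
  assumes p1: "p = 1" "a = 1" "b = 0" and M: "M = q * d"
    and h0: "coeff2 h 0 \<delta> \<noteq> 0" "\<delta> \<le> d" and con: "contact d N vx h"
  shows "contact d (Suc N) vx g"
proof -
  obtain \<gamma> s where s: "fps_nth s 0 = 0" "vx ^ N dvd h - \<gamma> * (vy - fps_const s) ^ d"
  \<comment> \<open>For \<open>N = 0\<close> the divisibility is void and any graph serves;
    \<open>contact_vx_graph\<close> starts at 1.\<close>
  proof (cases "N = 0")
    case True
    then show ?thesis using that[of 0 0] by simp
  next
    case False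
    then have "N \<ge> 1" by simp
    from contact_vx_graph[OF h0 this con] show ?thesis using that by metis
  qed
  define t where "t = fps_X ^ q * (fps_const c + s)"
  have t0: "fps_nth t 0 = 0" using pos by (simp add: t_def fps_X_power_mult_nth)
  have t: "fps_const t = vx ^ q * (cst c + fps_const s)"
    by (simp add: t_def vx_def cst_def fps_const_power)
  note S = coordsD(1,2)[OF coords_vx_shift[OF s(1)]] and T = coordsD(1,2)[OF coords_vx_shift[OF t0]]
  define g' where "g' = subst2 g vx (vy + fps_const t)"
  define h' where "h' = subst2 h vx (vy + fps_const s)"
  have bl: "coeff2 (vx ^ q * vy) 0 0 = 0" by simp
  have XY: "X = vx" "Y = vx ^ q * (cst c + vy)" unfolding X_def Y_def W_def by (simp_all add: p1)
  have "subst2 g' vx (vx ^ q * vy) = subst2 g vx (vx ^ q * (cst c + vy + fps_const s))"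
    unfolding g'_def
    by (subst subst2_subst2[OF T])
      (simp_all add: bl subst2_vx subst2_vy subst2_add subst2_fps_const_vx, simp add: t algebra_simps)
  also have "\<dots> = subst2 (subst2 g X Y) vx (vy + fps_const s)"
    by (subst subst2_subst2[OF XY0 S])
      (simp add: XY subst2_mult[OF S] subst2_vx[OF S] subst2_vy[OF S] subst2_power[OF S] subst2_add
        subst2_cst[OF S] algebra_simps)
  also have "\<dots> = vx ^ M * h'"
    by (simp add: chart h'_def subst2_mult[OF S] subst2_power[OF S] subst2_vx[OF S])
  finally have eq: "subst2 g' vx (vx ^ q * vy) = vx ^ M * h'" .
  have "subst2 (vx ^ N) vx (vy + fps_const s) dvd subst2 (h - \<gamma> * (vy - fps_const s) ^ d) vx (vy + fps_const s)"
    using s(2) by (rule subst2_dvd[OF S])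
  then have "vx ^ N dvd h' - vy ^ d * subst2 \<gamma> vx (vy + fps_const s)"
    unfolding subst2_diff[of h] subst2_mult[OF S] subst2_power[OF S] subst2_vx[OF S] subst2_shift[OF s(1)]
    by (simp add: h'_def mult.commute)
  then have h': "coeff2 h' k j = 0" if "k < N" "j < d" for k j
    using that unfolding vx_power_dvd_iff by (auto simp: coeff2_vy_power_mult)
  have "coeff2 g' i j = 0" if "i < Suc N" "j < d" for i j
  proof -
    have "q * Suc j \<le> q * d" using that(2) by (intro mult_le_mono) auto
    then have *: "i + q * j < M \<or> i + q * j - M < N"
      using that(1) pos M by auto
    have "coeff2 g' i j = coeff2 (vx ^ M * h') (i + q * j) j"
      using coeff2_subst2_blowup[of g' q i j] eq by simp
    then show ?thesis
      using * h'[of "i + q * j - M" j] that(2)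
      by (cases "i + q * j < M") (simp_all add: coeff2_vx_power_mult)
  qed
  then obtain A B where AB: "g' = A * vy ^ d + B * vx ^ Suc N"
    by (rule coeff2_corner_decomposition)
  note T' = coordsD(1,2)[OF coords_vx_shift'[OF t0]]
  have "g = subst2 g' vx (vy - fps_const t)"
    unfolding g'_def subst2_subst2[OF T T']
    using T'(2) by (simp add: subst2_vx[OF T'] subst2_vy[OF T'] subst2_add subst2_fps_const_vx[OF T'(2)])
  also have "\<dots> = subst2 A vx (vy - fps_const t) * (vy - fps_const t) ^ d
      + subst2 B vx (vy - fps_const t) * vx ^ Suc N"
    unfolding AB by (simp only: subst2_add subst2_mult[OF T'] subst2_power[OF T'] subst2_vx[OF T'] subst2_vy[OF T'])
  finally show ?thesis using coords_vx_shift'[OF t0] unfolding contact_def by blast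
qed

end

section \<open>Rays of the Newton fan\<close>


text \<open>The degenerate \<open>ray 0 0\<close>, which is {0}, is included on purpose: one form
  then covers the zero cone and every orthogonal ray of an edge.\<close>

definition ray :: "real \<Rightarrow> real \<Rightarrow> (real \<times> real) set" where
  "ray x y = {(t * x, t * y) | t. 0 \<le> t}"

lemma pairing_altdef: "pairing n m = fst n * real_of_int (fst m) + snd n * real_of_int (snd m)"
  by (simp add: pairing_def inner_prod_def)

lemma ray_eq_orthogonal:
  assumes P: "P > 0" "Q > 0" and d: "(du, dv) \<noteq> (0, 0)" "P * du + Q * dv = 0"
  shows "{n \<in> sigma0. fst n * du + snd n * dv = 0} = ray P Q"
proof (intro equalityI subsetI)
  fix n assume "n \<in> ray P Q"
  then obtain t where t: "n = (t * P, t * Q)" "t \<ge> 0" by (auto simp: ray_def)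
  have "t * P * du + t * Q * dv = t * (P * du + Q * dv)" by (simp add: algebra_simps)
  then show "n \<in> {n \<in> sigma0. fst n * du + snd n * dv = 0}"
    using t P d by (simp add: sigma0_def)
next
  fix n assume n: "n \<in> {n \<in> sigma0. fst n * du + snd n * dv = 0}"
  have dv: "dv \<noteq> 0" using d P by auto
  have "dv * snd n = - (fst n * du)" "Q * dv = - (P * du)" using n d(2) by (auto simp: algebra_simps)
  then have "dv * (snd n * P) = - (fst n * du) * P" "fst n * (Q * dv) = - (fst n * du) * P"
    by (simp_all add: mult.assoc[symmetric])
  then have "dv * (snd n * P) = dv * (fst n * Q)" by (simp add: mult_ac)
  then have "snd n * P = fst n * Q" using dv by (simp add: algebra_simps)
  then have "n = (fst n / P * P, fst n / P * Q)" using P by (simp add: prod_eq_iff field_simps)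
  moreover have "fst n / P \<ge> 0" using n P by (simp add: sigma0_def)
  ultimately show "n \<in> ray P Q" unfolding ray_def by blast
qed

lemma generator_in_newton_polygon:
  "coeff2 g i j \<noteq> 0 \<Longrightarrow> 0 \<le> s \<Longrightarrow> 0 \<le> t \<Longrightarrow> (real i + s, real j + t) \<in> newton_polygon g"
  unfolding newton_polygon_def by (rule hull_inc) blast

text \<open>The open half-plane above weight \<open>M\<close>, joined with the hull of the support
  points of weight \<open>M\<close>, is a convex set \<open>K\<close> containing all generators. So
  it contains the polygon, and the line of weight \<open>M\<close> meets \<open>K\<close> exactly in
  that hull.\<close>

lemma newton_polygon_face:
  fixes P Q M :: nat
  assumes pos: "P > 0" "Q > 0" and M: "\<And>i j. coeff2 g i j \<noteq> 0 \<Longrightarrow> M \<le> P * i + Q * j"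
  defines "F \<equiv> {(real i, real j) | i j. coeff2 g i j \<noteq> 0 \<and> P * i + Q * j = M}"
  shows "finite F" "newton_polygon g \<inter> {z. (real P, real Q) \<bullet> z = real M} = convex hull F"
    "newton_polygon g \<subseteq> {z. (real P, real Q) \<bullet> z \<ge> real M}"
proof -
  let ?n = "(real P, real Q)"
  have "i \<le> M" "j \<le> M" if "P * i + Q * j = M" for i j
  proof -
    have "1 * i \<le> P * i" "1 * j \<le> Q * j" using pos by (intro mult_le_mono; simp)+
    then show "i \<le> M" "j \<le> M" using that by linarith+
  qed
  then have "F \<subseteq> (\<lambda>(i, j). (real i, real j)) ` ({..M} \<times> {..M})" unfolding F_def by force
  then show "finite F" by (rule finite_subset) simp
  have "F \<subseteq> {z. ?n \<bullet> z = real M}"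
    by (auto simp: F_def inner_prod_def simp flip: of_nat_mult of_nat_add)
  then have hF: "convex hull F \<subseteq> {z. ?n \<bullet> z = real M}" by (rule hull_minimal) (rule convex_hyperplane)
  define K where "K = {z. ?n \<bullet> z > real M} \<union> convex hull F"
  have K: "?n \<bullet> z \<ge> real M" if "z \<in> K" for z using that hF by (auto simp: K_def)
  have "convex K"
  proof (rule convexI)
    fix x y :: "real \<times> real" and u v :: real
    assume x: "x \<in> K" and y: "y \<in> K" and uv: "0 \<le> u" "0 \<le> v" "u + v = 1"
    have eq: "?n \<bullet> (u *\<^sub>R x + v *\<^sub>R y) = u * (?n \<bullet> x) + v * (?n \<bullet> y)" by (simp add: inner_add_right)
    have M: "real M = u * real M + v * real M" using uv by (simp add: distrib_right[symmetric])
    consider "u = 0" | "v = 0" | "x \<in> convex hull F" "y \<in> convex hull F"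
      | "u > 0" "v > 0" "?n \<bullet> x > real M" | "u > 0" "v > 0" "?n \<bullet> y > real M"
      using x y uv by (force simp: K_def)
    then show "u *\<^sub>R x + v *\<^sub>R y \<in> K"
    proof cases
      case 1 then show ?thesis using y uv by simp
    next
      case 2 then show ?thesis using x uv by simp
    next
      case 3
      then have "u *\<^sub>R x + v *\<^sub>R y \<in> convex hull F" using uv by (intro convexD[OF convex_convex_hull])
      then show ?thesis by (simp add: K_def)
    next
      case 4
      then have "u * real M < u * (?n \<bullet> x)" "v * real M \<le> v * (?n \<bullet> y)"
        using K[OF y] by (simp_all only: mult_strict_left_mono mult_left_mono less_imp_le)
      then show ?thesis using M eq by (simp add: K_def)
    next
      case 5
      then have "u * real M \<le> u * (?n \<bullet> x)" "v * real M < v * (?n \<bullet> y)"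
        using K[OF x] by (simp_all only: mult_strict_left_mono mult_left_mono less_imp_le)
      then show ?thesis using M eq by (simp add: K_def)
    qed
  qed
  moreover have "{(real i + s, real j + t) | i j s t. coeff2 g i j \<noteq> 0 \<and> 0 \<le> s \<and> 0 \<le> t} \<subseteq> K"
  proof clarify
    fix i j and s t :: real
    assume g: "coeff2 g i j \<noteq> 0" and st: "0 \<le> s" "0 \<le> t"
    have "?n \<bullet> (real i + s, real j + t) = real (P * i + Q * j) + (real P * s + real Q * t)"
      by (simp add: inner_prod_def algebra_simps)
    moreover have "real M \<le> real (P * i + Q * j)" using M[OF g] by (simp only: of_nat_le_iff)
    moreover have Ps: "real P * s \<ge> 0" "real Q * t \<ge> 0" using st by simp_all
    ultimately have "?n \<bullet> (real i + s, real j + t) > real M \<or>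
        P * i + Q * j = M \<and> real P * s = 0 \<and> real Q * t = 0"
      unfolding of_nat_eq_iff[symmetric, of "P * i + Q * j", where 'a = real] by linarith
    then show "(real i + s, real j + t) \<in> K"
    proof
      assume "P * i + Q * j = M \<and> real P * s = 0 \<and> real Q * t = 0"
      then have "(real i + s, real j + t) \<in> F" using pos g by (auto simp: F_def)
      then show ?thesis by (simp add: K_def hull_inc)
    qed (simp add: K_def)
  qed
  ultimately have sub: "newton_polygon g \<subseteq> K" unfolding newton_polygon_def by (intro hull_minimal)
  show "newton_polygon g \<subseteq> {z. ?n \<bullet> z \<ge> real M}" using sub K by blast
  have "F \<subseteq> newton_polygon g" unfolding F_def using generator_in_newton_polygon[of g _ _ 0 0] by auto
  then have "convex hull F \<subseteq> newton_polygon g"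
    by (rule hull_minimal) (simp add: newton_polygon_def)
  then show "newton_polygon g \<inter> {z. ?n \<bullet> z = real M} = convex hull F"
    using sub hF by (auto simp: K_def)
qed

text \<open>Two distinct support points of minimal weight make the supporting face one-dimensional;
  it is compact as the hull of finitely many points, both weights being positive.\<close>

lemma ray_in_newton_rays:
  fixes P Q M :: nat
  assumes pos: "P > 0" "Q > 0" and M: "\<And>i j. coeff2 g i j \<noteq> 0 \<Longrightarrow> M \<le> P * i + Q * j"
    and v: "coeff2 g i1 j1 \<noteq> 0" "P * i1 + Q * j1 = M"
    and w: "coeff2 g i2 j2 \<noteq> 0" "P * i2 + Q * j2 = M" and ne: "(i1, j1) \<noteq> (i2, j2)"
  shows "ray P Q \<in> newton_rays g"
proof -
  let ?n = "(real P, real Q)" and ?v = "(real i1, real j1)" and ?w = "(real i2, real j2)"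
  let ?F = "{(real i, real j) | i j. coeff2 g i j \<noteq> 0 \<and> P * i + Q * j = M}"
  define e where "e = newton_polygon g \<inter> {z. ?n \<bullet> z = real M}"
  note face = newton_polygon_face[OF pos M]
  have e: "e = convex hull ?F" unfolding e_def by (rule face(2))
  have vw: "?v \<in> e" "?w \<in> e" unfolding e using v w by (auto intro!: hull_inc)
  have "convex (newton_polygon g)" by (simp add: newton_polygon_def)
  then have "e face_of newton_polygon g"
    unfolding e_def using face(3) by (intro face_of_Int_supporting_hyperplane_ge) auto
  moreover have "aff_dim e = 1"
  proof (rule antisym)
    have "aff_dim e \<le> aff_dim {z. ?n \<bullet> z = real M}" unfolding e_def by (rule aff_dim_subset) simp
    also have "\<dots> = 1" using pos by (subst aff_dim_hyperplane) (simp_all add: prod_eq_iff zero_prod_def)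
    finally show "aff_dim e \<le> 1" .
    have "aff_dim {?v, ?w} = 1" using ne by (simp add: aff_dim_2)
    then show "1 \<le> aff_dim e" using aff_dim_subset[of "{?v, ?w}" e] vw by simp
  qed
  moreover have "compact e" unfolding e using face(1) by (rule finite_imp_compact_convex_hull)
  ultimately have "orthogonal_ray e \<in> newton_rays g" unfolding newton_rays_def edge_of_def by blast
  moreover have "orthogonal_ray e = ray P Q"
  proof -
    define du dv where "du = real i1 - real i2" and "dv = real j1 - real j2"
    have d: "(du, dv) \<noteq> (0, 0)" using ne by (simp add: du_def dv_def)
    have "real (P * i1 + Q * j1) = real (P * i2 + Q * j2)" using v(2) w(2) by simp
    then have d0: "real P * du + real Q * dv = 0" by (simp add: du_def dv_def algebra_simps)
    note r = ray_eq_orthogonal[OF _ _ d d0]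
    show ?thesis
    proof (intro equalityI subsetI)
      fix n assume n: "n \<in> orthogonal_ray e"
      then have "n \<bullet> (?v - ?w) = 0" using vw unfolding orthogonal_ray_def by blast
      then have "n \<in> {n \<in> sigma0. fst n * du + snd n * dv = 0}"
        using n by (simp add: orthogonal_ray_def inner_prod_def du_def dv_def)
      then show "n \<in> ray P Q" using r pos by simp
    next
      fix n assume "n \<in> ray P Q"
      then obtain t :: real where t: "n = (t * P, t * Q)" "t \<ge> 0" by (auto simp: ray_def)
      then have n: "n = t *\<^sub>R ?n" by simp
      have "n \<bullet> (x - y) = 0" if "x \<in> e" "y \<in> e" for x y
        using that unfolding n inner_scaleR_left inner_diff_right by (simp add: e_def)
      then show "n \<in> orthogonal_ray e" using t by (auto simp: orthogonal_ray_def sigma0_def)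
    qed
  qed
  ultimately show ?thesis by simp
qed

text \<open>A generator with nonzero shift (s, t) is the midpoint of the generators with shifts (0,
  0) and (2 s, 2 t).\<close>

lemma extreme_point_newton_polygon:
  assumes "x extreme_point_of newton_polygon g"
  obtains i j :: nat where "x = (real i, real j)"
proof -
  have "x \<in> {(real i + s, real j + t) | i j s t. coeff2 g i j \<noteq> 0 \<and> 0 \<le> s \<and> 0 \<le> t}"
    using assms unfolding newton_polygon_def by (rule extreme_point_of_convex_hull)
  then obtain i j s t where x: "x = (real i + s, real j + t)" and g: "coeff2 g i j \<noteq> 0" and st: "0 \<le> s" "0 \<le> t"
    by blast
  let ?a = "(real i, real j)" and ?b = "(real i + 2 * s, real j + 2 * t)"
  have ab: "?a \<in> newton_polygon g" "?b \<in> newton_polygon g"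
    using generator_in_newton_polygon[OF g, of 0 0] generator_in_newton_polygon[OF g, of "2 * s" "2 * t"] st by simp_all
  have "x = midpoint ?a ?b" by (simp add: x midpoint_def algebra_simps)
  then have "s = 0 \<and> t = 0"
    using assms ab midpoint_in_open_segment[of ?a ?b] unfolding extreme_point_of_def by force
  then show ?thesis using that x by simp
qed

text \<open>A compact edge is the hull of its extreme points, which are integral; the difference of
  two of them spans its direction, and the absolute values of its coordinates, swapped, generate the
  orthogonal ray.\<close>

lemma newton_ray_integral:
  assumes "R \<in> newton_rays g"
  obtains x y :: int where "x \<ge> 0" "y \<ge> 0" "R = ray x y"
proof -
  consider "R = {(t, 0) | t. 0 \<le> t}" | "R = {(0, t) | t. 0 \<le> t}"
    | e where "R = orthogonal_ray e" "e edge_of newton_polygon g" "compact e"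
    using assms unfolding newton_rays_def by blast
  then show ?thesis
  proof cases
    case 1 then show ?thesis using that[of 1 0] by (simp add: ray_def)
  next
    case 2 then show ?thesis using that[of 0 1] by (simp add: ray_def)
  next
    case 3
    have face: "e face_of newton_polygon g" and dim: "aff_dim e = 1" using 3 by (auto simp: edge_of_def)
    have "convex e" using face by (rule face_of_imp_convex)
    then have hull: "e = convex hull {x. x extreme_point_of e}"
      using 3 by (intro Krein_Milman_Minkowski)
    have "\<exists>v w. v \<noteq> w \<and> v extreme_point_of e \<and> w extreme_point_of e"
    proof (rule ccontr)
      assume "\<not> ?thesis"
      then obtain v where "{x. x extreme_point_of e} \<subseteq> {v}" by blast
      then have "e \<subseteq> {v}" using hull hull_mono[of "{x. x extreme_point_of e}" "{v}" convex] by simp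
      then have "aff_dim e \<le> 0" using aff_dim_subset[of e "{v}"] by simp
      then show False using dim by simp
    qed
    then obtain v w where vw: "v \<noteq> w" "v extreme_point_of e" "w extreme_point_of e" by blast
    have "v extreme_point_of newton_polygon g" "w extreme_point_of newton_polygon g"
      using vw extreme_point_of_face[OF face] by auto
    then obtain i j k l :: nat where ij: "v = (real i, real j)" "w = (real k, real l)"
      by (metis extreme_point_newton_polygon)
    have vwe: "v \<in> e" "w \<in> e" using vw by (auto simp: extreme_point_of_def)
    define du dv where "du = int i - int k" and "dv = int j - int l"
    have d: "du \<noteq> 0 \<or> dv \<noteq> 0" using vw(1) ij by (auto simp: du_def dv_def)
    have aff: "affine hull e = affine hull {v, w}"
    proof -
      have "affine hull {v, w} \<subseteq> affine hull e" using vwe by (intro hull_mono) auto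
      moreover have "aff_dim (affine hull {v, w}) = aff_dim (affine hull e)"
        using vw(1) dim by (simp add: aff_dim_2)
      ultimately show ?thesis using aff_dim_eq_full_gen aff_dim_psubset
        by (metis hull_hull psubsetI less_irrefl)
    qed
    have R: "R = {n \<in> sigma0. fst n * real_of_int du + snd n * real_of_int dv = 0}"
    proof (intro equalityI subsetI)
      fix n assume "n \<in> R"
      then have "n \<in> sigma0" "n \<bullet> (v - w) = 0" using 3 vwe by (auto simp: orthogonal_ray_def)
      then show "n \<in> {n \<in> sigma0. fst n * real_of_int du + snd n * real_of_int dv = 0}"
        by (simp add: ij du_def dv_def inner_prod_def)
    next
      fix n assume n: "n \<in> {n \<in> sigma0. fst n * real_of_int du + snd n * real_of_int dv = 0}"
      then have "n \<bullet> w = n \<bullet> v"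
        by (simp add: ij du_def dv_def inner_prod_def algebra_simps)
      then have "affine hull {v, w} \<subseteq> {z. n \<bullet> z = n \<bullet> v}"
        by (intro hull_minimal) (auto simp: affine_hyperplane)
      then have "e \<subseteq> {z. n \<bullet> z = n \<bullet> v}" using aff hull_subset[of e affine] by auto
      then have "n \<bullet> (x - y) = 0" if "x \<in> e" "y \<in> e" for x y
        using that unfolding inner_diff_right by (metis (mono_tags) mem_Collect_eq subsetD diff_self)
      then show "n \<in> R" using n 3 by (simp add: orthogonal_ray_def)
    qed
    show ?thesis
    proof (cases "du * dv > 0")
      \<comment> \<open>A direction whose coordinates have the same sign is orthogonal in
        \<open>sigma0\<close> only to 0, which gives the degenerate ray.\<close>
      case True
      have "R = ray 0 0"
      proof -
        have "n = 0" if n: "n \<in> sigma0" "fst n * real_of_int du + snd n * real_of_int dv = 0" for n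
        proof -
          have "fst n * (real_of_int du * real_of_int du) + snd n * (real_of_int du * real_of_int dv)
              = real_of_int du * (fst n * real_of_int du + snd n * real_of_int dv)"
            by (simp add: algebra_simps)
          then have sum: "fst n * (real_of_int du * real_of_int du) + snd n * (real_of_int du * real_of_int dv) = 0"
            using n by simp
          have p: "real_of_int du * real_of_int du > 0" "real_of_int du * real_of_int dv > 0"
            using True by (auto simp: zero_less_mult_iff)
          have "fst n * (real_of_int du * real_of_int du) \<ge> 0" "snd n * (real_of_int du * real_of_int dv) \<ge> 0"
            using n(1) p by (simp_all add: sigma0_def mult_nonneg_nonneg[OF _ less_imp_le])
          then have "fst n * (real_of_int du * real_of_int du) = 0" "snd n * (real_of_int du * real_of_int dv) = 0"
            using sum by linarith+
          then show "n = 0" using p by (auto simp: prod_eq_iff)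
        qed
        moreover have "0 \<in> sigma0" by (simp add: sigma0_def)
        moreover have "ray 0 0 = {0}" by (auto simp: ray_def prod_eq_iff)
        ultimately show ?thesis unfolding R by auto
      qed
      then show ?thesis using that[of 0 0] by simp
    next
      case False
      define P Q where "P = \<bar>dv\<bar>" and "Q = \<bar>du\<bar>"
      have PQ: "P * du + Q * dv = 0"
        using False by (cases "du \<ge> 0"; cases "dv \<ge> 0") (auto simp: P_def Q_def not_less mult_le_0_iff algebra_simps)
      then have PQr: "real_of_int P * real_of_int du + real_of_int Q * real_of_int dv = 0"
        by (simp flip: of_int_mult of_int_add)
      have "R = ray P Q"
      proof (cases "du = 0 \<or> dv = 0")
        case True
        then show ?thesis
        proof
          assume "du = 0"
          then have dv: "dv \<noteq> 0" using d by simp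
          have "n \<in> ray P Q" if "fst n \<ge> 0" "snd n = 0" for n
            unfolding ray_def using that dv \<open>du = 0\<close>
            by (auto simp: P_def Q_def prod_eq_iff intro!: exI[of _ "fst n / \<bar>real_of_int dv\<bar>"])
          then show ?thesis
            unfolding R using dv \<open>du = 0\<close> by (auto simp: sigma0_def ray_def P_def Q_def)
        next
          assume "dv = 0"
          then have du: "du \<noteq> 0" using d by simp
          have "n \<in> ray P Q" if "fst n = 0" "snd n \<ge> 0" for n
            unfolding ray_def using that du \<open>dv = 0\<close>
            by (auto simp: P_def Q_def prod_eq_iff intro!: exI[of _ "snd n / \<bar>real_of_int du\<bar>"])
          then show ?thesis
            unfolding R using du \<open>dv = 0\<close> by (auto simp: sigma0_def ray_def P_def Q_def)
        qed
      next
        case False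
        then show ?thesis
          unfolding R using PQr by (intro ray_eq_orthogonal) (auto simp: P_def Q_def)
      qed
      then show ?thesis using that[of P Q] by (simp add: P_def Q_def)
    qed
  qed
qed

section \<open>Order vectors of arcs\<close>


lemma ray_scale: "k > 0 \<Longrightarrow> ray (k * x) (k * y) = ray x y"
proof (intro equalityI subsetI)
  fix n assume k: "k > 0" and "n \<in> ray x y"
  then obtain t where "n = (t * x, t * y)" "t \<ge> 0" by (auto simp: ray_def)
  then have "n = (t / k * (k * x), t / k * (k * y))" "t / k \<ge> 0" using k by simp_all
  then show "n \<in> ray (k * x) (k * y)" unfolding ray_def by blast
next
  fix n assume k: "k > 0" and "n \<in> ray (k * x) (k * y)"
  then obtain t where "n = (t * (k * x), t * (k * y))" "t \<ge> 0" by (auto simp: ray_def)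
  then have "n = ((t * k) * x, (t * k) * y)" "t * k \<ge> 0" using k by simp_all
  then show "n \<in> ray x y" unfolding ray_def by blast
qed

lemma ray_00: "ray 0 0 = {0}" by (auto simp: ray_def prod_eq_iff)

lemma self_in_ray: "(x, y) \<in> ray x y" unfolding ray_def using zero_le_one by force

lemma ray_parallel:
  assumes P: "P > 0" "Q > 0" and xy: "x \<ge> 0" "(x, y) \<noteq> (0, 0)" "x * Q = y * P"
  shows "ray x y = ray P Q"
proof -
  have y: "y = x / P * Q" using xy P by (simp add: field_simps)
  then have "x > 0" using xy by (auto simp: less_le)
  then show ?thesis using ray_scale[of "x / P" P Q] P y by simp
qed

lemma cone_sum_iff: "n \<in> cone_sum A B \<longleftrightarrow> (\<exists>a\<in>A. \<exists>b\<in>B. n = a + b)"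
  unfolding cone_sum_def by blast

lemma dual_monoid_cone_sum_ray:
  fixes x y x' y' :: int
  shows "m \<in> dual_monoid (cone_sum (ray x y) (ray x' y')) \<longleftrightarrow>
      0 \<le> x * fst m + y * snd m \<and> 0 \<le> x' * fst m + y' * snd m" (is "?l = (0 \<le> ?s \<and> 0 \<le> ?s')")
    and "m \<in> perp (cone_sum (ray x y) (ray x' y')) \<longleftrightarrow>
      x * fst m + y * snd m = 0 \<and> x' * fst m + y' * snd m = 0" (is "?r \<longleftrightarrow> _")
proof -
  let ?C = "cone_sum (ray x y) (ray x' y')"
  have pr: "pairing (t * x + t' * x', t * y + t' * y') m
      = t * real_of_int ?s + t' * real_of_int ?s'" for t t' :: real
    by (simp add: pairing_altdef algebra_simps)
  have C: "(t * x + t' * x', t * y + t' * y') \<in> ?C" if "t \<ge> 0" "t' \<ge> 0" for t t' :: real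
  proof -
    have "(t * x, t * y) \<in> ray x y" "(t' * x', t' * y') \<in> ray x' y'" using that by (auto simp: ray_def)
    then show ?thesis unfolding cone_sum_iff by force
  qed
  have C': "\<exists>(t :: real) (t' :: real). t \<ge> 0 \<and> t' \<ge> 0 \<and> n = (t * x + t' * x', t * y + t' * y')" if "n \<in> ?C" for n
    using that unfolding cone_sum_iff ray_def by force
  have ends: "pairing ((1 :: real) * x + (0 :: real) * x', (1 :: real) * y + (0 :: real) * y') m = real_of_int ?s"
     "pairing ((0 :: real) * x + (1 :: real) * x', (0 :: real) * y + (1 :: real) * y') m = real_of_int ?s'"
    unfolding pr by simp_all
  show "?l = (0 \<le> ?s \<and> 0 \<le> ?s')"
  proof
    assume ?l
    then have "0 \<le> real_of_int ?s" "0 \<le> real_of_int ?s'"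
      using C[of 1 0] C[of 0 1] unfolding ends[symmetric] dual_monoid_def by auto
    then show "0 \<le> ?s \<and> 0 \<le> ?s'" by (simp only: of_int_0_le_iff)
  next
    assume s: "0 \<le> ?s \<and> 0 \<le> ?s'"
    have "0 \<le> pairing n m" if n: "n \<in> ?C" for n
    proof -
      obtain t t' :: real where t: "t \<ge> 0" "t' \<ge> 0" "n = (t * x + t' * x', t * y + t' * y')" using C'[OF n] by blast
      show ?thesis unfolding t(3) pr using s t(1,2)
        by (intro add_nonneg_nonneg mult_nonneg_nonneg) (simp_all only: of_int_0_le_iff)
    qed
    then show ?l by (simp add: dual_monoid_def)
  qed
  show "?r \<longleftrightarrow> ?s = 0 \<and> ?s' = 0"
  proof
    assume ?r
    then have "real_of_int ?s = 0" "real_of_int ?s' = 0"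
      using C[of 1 0] C[of 0 1] unfolding ends[symmetric] perp_def by auto
    then show "?s = 0 \<and> ?s' = 0" by (simp only: of_int_eq_0_iff)
  next
    assume s: "?s = 0 \<and> ?s' = 0"
    have "pairing n m = 0" if n: "n \<in> ?C" for n
    proof -
      obtain t t' :: real where t: "n = (t * x + t' * x', t * y + t' * y')" using C'[OF n] by blast
      have "real_of_int ?s = 0" "real_of_int ?s' = 0" using s by (simp_all only: of_int_0)
      then show ?thesis unfolding t pr by simp
    qed
    then show ?r by (simp add: perp_def)
  qed
qed

lemma cone_sum_0: "cone_sum A {0} = A"
  by (rule set_eqI) (simp add: cone_sum_iff)

lemma cone_sum_commute: "cone_sum A B = cone_sum B A"
  by (rule set_eqI) (metis cone_sum_iff add.commute)

lemma dual_monoid_ray: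
  fixes x y :: int
  shows "m \<in> dual_monoid (ray x y) \<longleftrightarrow> 0 \<le> x * fst m + y * snd m"
    and "m \<in> perp (ray x y) \<longleftrightarrow> x * fst m + y * snd m = 0"
  using dual_monoid_cone_sum_ray[of m x y 0 0] by (simp_all add: ray_00 cone_sum_0)

text \<open>
  The order vector \<open>(P, Q)\<close> of an arc lies in the relative interior of the cone of its origin: this is
  the hypothesis on \<open>m\<close>.
\<close>

lemma order_vector_ray:
  fixes P Q x y :: int
  assumes P: "P > 0" "Q > 0" and x: "x \<ge> 0"
    and H: "\<And>m. m \<in> dual_monoid (ray x y) \<Longrightarrow>
      0 \<le> P * fst m + Q * snd m \<and> (P * fst m + Q * snd m = 0 \<longleftrightarrow> m \<in> perp (ray x y))"
  shows "ray x y = ray P Q"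
proof (rule ray_parallel)
  show "(real_of_int x, real_of_int y) \<noteq> (0, 0)"
    using H[of "(-1, 0)"] P by (auto simp: dual_monoid_ray)
  have "P * (- y) + Q * x = 0"
    using H[of "(- y, x)"] by (simp add: dual_monoid_ray)
  then show "real_of_int x * real_of_int Q = real_of_int y * real_of_int P"
    by (simp flip: of_int_mult add: algebra_simps)
qed (use P x in auto)

text \<open>\<open>(- y, x)\<close> and \<open>(y', - x')\<close> are the inner normals of the two
  facets and do not lie in \<open>perp\<close> of the cone, so both are positive at (P, Q). Divided
  by the determinant, these values are the coordinates of (P, Q) on the generators.\<close>

lemma order_vector_cone_interior:
  fixes P Q x y x' y' :: int
  assumes P: "P > 0" "Q > 0" and det: "x * y' - y * x' > 0"
    and H: "\<And>m. m \<in> dual_monoid (cone_sum (ray x y) (ray x' y')) \<Longrightarrow>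
      0 \<le> P * fst m + Q * snd m \<and>
      (P * fst m + Q * snd m = 0 \<longleftrightarrow> m \<in> perp (cone_sum (ray x y) (ray x' y')))"
  shows "ray P Q \<subseteq> cone_sum (ray x y) (ray x' y')" "ray P Q \<noteq> ray x y" "ray P Q \<noteq> ray x' y'"
proof -
  have 1: "x * Q - y * P > 0"
    using H[of "(- y, x)"] det by (simp add: dual_monoid_cone_sum_ray algebra_simps)
  have 2: "y' * P - x' * Q > 0"
    using H[of "(y', - x')"] det by (simp add: dual_monoid_cone_sum_ray algebra_simps)
  define D u v where "D = real_of_int (x * y' - y * x')"
    and "u = real_of_int (y' * P - x' * Q) / D" and "v = real_of_int (x * Q - y * P) / D"
  have D: "D > 0" unfolding D_def using det by (simp only: of_int_0_less_iff)
  have uv: "u > 0" "v > 0" unfolding u_def v_def using 1 2 D by (simp_all only: divide_pos_pos of_int_0_less_iff)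
  have "D * (u * x + v * x') = (D * u) * x + (D * v) * x'" by (simp add: algebra_simps)
  also have "\<dots> = D * P" using D by (simp add: u_def v_def) (simp add: D_def algebra_simps)
  finally have P': "u * x + v * x' = P" using D by simp
  have "D * (u * y + v * y') = (D * u) * y + (D * v) * y'" by (simp add: algebra_simps)
  also have "\<dots> = D * Q" using D by (simp add: u_def v_def) (simp add: D_def algebra_simps)
  finally have Q': "u * y + v * y' = Q" using D by simp
  show "ray P Q \<subseteq> cone_sum (ray x y) (ray x' y')"
  proof
    fix n assume "n \<in> ray P Q"
    then obtain t :: real where t: "n = (t * P, t * Q)" "t \<ge> 0" by (auto simp: ray_def)
    have "n = ((t * u) * x, (t * u) * y) + ((t * v) * x', (t * v) * y')"
      by (simp add: t P'[symmetric] Q'[symmetric] algebra_simps)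
    moreover have "((t * u) * x, (t * u) * y) \<in> ray x y" "((t * v) * x', (t * v) * y') \<in> ray x' y'"
      unfolding ray_def using t uv by auto
    ultimately show "n \<in> cone_sum (ray x y) (ray x' y')" unfolding cone_sum_iff by blast
  qed
  have par: "real_of_int a * real_of_int Q = real_of_int b * real_of_int P"
    if "ray P Q = ray a b" for a b :: int
  proof -
    have "(real_of_int a, real_of_int b) \<in> ray P Q" unfolding that by (rule self_in_ray)
    then show ?thesis by (auto simp: ray_def)
  qed
  show "ray P Q \<noteq> ray x y"
    using par[of x y] 1 by (auto simp flip: of_int_mult)
  show "ray P Q \<noteq> ray x' y'"
    using par[of x' y'] 2 by (auto simp flip: of_int_mult)
qed

text \<open>In a two-dimensional cone the ray of (P, Q), being a ray of the fan, would lie strictly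
  between two consecutive rays. Degenerate or parallel pairs of generators reduce to a single
  ray.\<close>

lemma order_vector_newton_fan:
  fixes P Q :: int
  assumes P: "P > 0" "Q > 0" and \<tau>: "\<tau> \<in> newton_fan g" and ray: "ray P Q \<in> newton_rays g"
    and H: "\<And>m. m \<in> dual_monoid \<tau> \<Longrightarrow>
      0 \<le> P * fst m + Q * snd m \<and> (P * fst m + Q * snd m = 0 \<longleftrightarrow> m \<in> perp \<tau>)"
  shows "\<tau> = ray P Q"
proof -
  have ray_case: "R = ray P Q" if "R = \<tau>" "R \<in> newton_rays g" for R
  proof -
    obtain x y :: int where "x \<ge> 0" "R = ray x y" using newton_ray_integral[OF \<open>R \<in> _\<close>] by metis
    then show ?thesis using order_vector_ray[OF P] H that by metis
  qed
  consider "\<tau> = {0}" | "\<tau> \<in> newton_rays g" | A B where "\<tau> = cone_sum A B" "A \<in> newton_rays g"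
      "B \<in> newton_rays g" "A \<noteq> B" "\<And>R. R \<in> newton_rays g \<Longrightarrow> R \<subseteq> cone_sum A B \<Longrightarrow> R = A \<or> R = B"
    using \<tau> unfolding newton_fan_def by blast
  then show ?thesis
  proof cases
    case 1
    \<comment> \<open>For the zero cone \<open>H\<close> is contradictory;
      \<open>order_vector_ray\<close> covers this case through the degenerate ray.\<close>
    then have "\<tau> = ray (real_of_int 0) (real_of_int 0)" by (simp add: ray_00)
    with H show ?thesis using order_vector_ray[OF P, of 0 0] by simp
  next
    case 2
    then show ?thesis using ray_case by blast
  next
    case 3
    obtain x y :: int where x: "x \<ge> 0" "y \<ge> 0" "A = ray x y" using newton_ray_integral[OF 3(2)] by metis
    obtain x' y' :: int where x': "x' \<ge> 0" "y' \<ge> 0" "B = ray x' y'" using newton_ray_integral[OF 3(3)] by metis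
    consider "x * y' - y * x' > 0" | "x' * y - y' * x > 0" | "x * y' = y * x'" by (auto simp: algebra_simps) linarith
    then show ?thesis
    proof cases
      case 1
      then show ?thesis
        using order_vector_cone_interior[OF P 1] H 3(5)[OF ray] unfolding 3(1) x(3) x'(3) by blast
    next
      case 2
      then show ?thesis
        using order_vector_cone_interior[OF P 2] H 3(5)[OF ray] unfolding 3(1) x(3) x'(3)
          cone_sum_commute[of "ray x y"] by blast
    next
      case par: 3
      consider "x = 0" "y = 0" | "x' = 0" "y' = 0" | "(x, y) \<noteq> (0, 0)" "(x', y') \<noteq> (0, 0)" by auto
      then show ?thesis
      proof cases
        case 1
        then have "\<tau> = B" unfolding 3(1) x(3) cone_sum_commute[of "ray _ _"] by (simp add: ray_00 cone_sum_0)
        then show ?thesis using ray_case 3(3) by metis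
      next
        case 2
        then have "\<tau> = A" unfolding 3(1) x'(3) by (simp add: ray_00 cone_sum_0)
        then show ?thesis using ray_case 3(2) by metis
      next
        case nz: 3
        have "A = B"
        proof (cases "x' = 0 \<or> y' = 0")
          case False
          then have "ray x y = ray x' y'"
            using nz x x' par by (intro ray_parallel) (auto simp flip: of_int_mult)
          then show ?thesis by (simp add: x x')
        next
          case True
          then show ?thesis
          proof
            assume "x' = 0"
            then have "x = 0" "y > 0" "y' > 0" using par nz x x' by auto
            then show ?thesis using ray_scale[of y 0 1] ray_scale[of y' 0 1] by (simp add: x x' \<open>x' = 0\<close>)
          next
            assume "y' = 0"
            then have "y = 0" "x > 0" "x' > 0" using par nz x x' by auto
            then show ?thesis using ray_scale[of x 1 0] ray_scale[of x' 1 0] by (simp add: x x' \<open>y' = 0\<close>)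
          qed
        qed
        then show ?thesis using 3(4) by simp
      qed
    qed
  qed
qed

section \<open>Monomials along arcs\<close>

lemma newton_fan_subset_sigma0:
  assumes "\<tau> \<in> newton_fan g"
  shows "\<tau> \<subseteq> sigma0"
proof -
  have r: "R \<subseteq> sigma0" if "R \<in> newton_rays g" for R
    using that by (auto simp: newton_rays_def orthogonal_ray_def sigma0_def)
  have "a + b \<in> sigma0" if "a \<in> sigma0" "b \<in> sigma0" for a b using that by (auto simp: sigma0_def)
  then have "cone_sum A B \<subseteq> sigma0" if "A \<in> newton_rays g" "B \<in> newton_rays g" for A B
    using that r[of A] r[of B] unfolding cone_sum_def by blast
  moreover have "0 \<in> sigma0" by (simp add: sigma0_def)
  ultimately show ?thesis using assms r unfolding newton_fan_def by blast
qed

lemma dual_monoid_add: "m \<in> dual_monoid \<tau> \<Longrightarrow> m' \<in> dual_monoid \<tau> \<Longrightarrow> m + m' \<in> dual_monoid \<tau>"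
proof -
  have "pairing n (m + m') = pairing n m + pairing n m'" for n by (simp add: pairing_altdef algebra_simps)
  then show "m \<in> dual_monoid \<tau> \<Longrightarrow> m' \<in> dual_monoid \<tau> \<Longrightarrow> m + m' \<in> dual_monoid \<tau>"
    by (simp add: dual_monoid_def)
qed

lemma dual_monoid_0: "0 \<in> dual_monoid \<tau>"
  by (simp add: dual_monoid_def pairing_altdef)

lemma monoid_hom_power:
  assumes hom: "monoid_hom_on (dual_monoid \<tau>) \<phi>" and m: "m \<in> dual_monoid \<tau>"
  shows "(int n * fst m, int n * snd m) \<in> dual_monoid \<tau> \<and> \<phi> (int n * fst m, int n * snd m) = \<phi> m ^ n"
proof (induction n)
  case 0
  then show ?case using hom dual_monoid_0 by (simp add: monoid_hom_on_def flip: zero_prod_def)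
next
  case (Suc n)
  have eq: "(int (Suc n) * fst m, int (Suc n) * snd m) = (int n * fst m, int n * snd m) + m"
    by (simp add: prod_eq_iff algebra_simps)
  have "\<phi> ((int n * fst m, int n * snd m) + m) = \<phi> (int n * fst m, int n * snd m) * \<phi> m"
    using hom Suc m by (simp add: monoid_hom_on_def)
  then show ?case using Suc m dual_monoid_add unfolding eq by (simp add: mult.commute)
qed

lemma monoid_hom_monomial:
  assumes hom: "monoid_hom_on (dual_monoid \<tau>) \<phi>" and m: "m \<in> dual_monoid \<tau>" "m' \<in> dual_monoid \<tau>"
  shows "(int i * fst m + int j * fst m', int i * snd m + int j * snd m') \<in> dual_monoid \<tau>"
    and "\<phi> (int i * fst m + int j * fst m', int i * snd m + int j * snd m') = \<phi> m ^ i * \<phi> m' ^ j"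
proof -
  note i = monoid_hom_power[OF hom m(1), of i] and j = monoid_hom_power[OF hom m(2), of j]
  have eq: "(int i * fst m + int j * fst m', int i * snd m + int j * snd m')
      = (int i * fst m, int i * snd m) + (int j * fst m', int j * snd m')" by simp
  show "(int i * fst m + int j * fst m', int i * snd m + int j * snd m') \<in> dual_monoid \<tau>"
    unfolding eq using i j dual_monoid_add by blast
  show "\<phi> (int i * fst m + int j * fst m', int i * snd m + int j * snd m') = \<phi> m ^ i * \<phi> m' ^ j"
    unfolding eq using i j hom unfolding monoid_hom_on_def by metis
qed

text \<open>Adding suitable nonnegative exponents to \<open>m\<close> gives nonnegative exponents,
  so multiplicativity shows that \<alpha> m has order P m1 + Q m2, where m = (m1, m2). Its constant
  term is the value of the point at \<open>m\<close>, nonzero exactly in order 0.\<close>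

lemma arc_order:
  assumes \<tau>: "\<tau> \<subseteq> sigma0" and arc: "arc_at (\<tau>, \<phi>) \<alpha>" and nz: "\<alpha> (1, 0) \<noteq> 0" "\<alpha> (0, 1) \<noteq> 0"
    and m: "m \<in> dual_monoid \<tau>"
  defines "P \<equiv> int (subdegree (\<alpha> (1, 0)))" and "Q \<equiv> int (subdegree (\<alpha> (0, 1)))"
  shows "0 \<le> P * fst m + Q * snd m" "P * fst m + Q * snd m = 0 \<longleftrightarrow> \<phi> m \<noteq> 0"
proof -
  have hom: "monoid_hom_on (dual_monoid \<tau>) \<alpha>" and val: "fps_nth (\<alpha> m) 0 = \<phi> m"
    using arc m by (auto simp: arc_at_def)
  have e: "(1, 0) \<in> dual_monoid \<tau>" "(0, 1) \<in> dual_monoid \<tau>"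
    using \<tau> by (auto simp: dual_monoid_def pairing_altdef sigma0_def)
  define i j k l where "i = nat (fst m)" and "j = nat (snd m)" and "k = nat (- fst m)" and "l = nat (- snd m)"
  have mon: "(int a, int b) \<in> dual_monoid \<tau>" "\<alpha> (int a, int b) = \<alpha> (1, 0) ^ a * \<alpha> (0, 1) ^ b" for a b
    using monoid_hom_monomial[OF hom e, of a b] by simp_all
  have "m + (int k, int l) = (int i, int j)" by (simp add: prod_eq_iff i_def j_def k_def l_def)
  then have eq: "\<alpha> m * (\<alpha> (1, 0) ^ k * \<alpha> (0, 1) ^ l) = \<alpha> (1, 0) ^ i * \<alpha> (0, 1) ^ j"
    using hom m mon by (metis monoid_hom_on_def)
  then have nzm: "\<alpha> m \<noteq> 0" using nz by auto
  have "subdegree (\<alpha> m * (\<alpha> (1, 0) ^ k * \<alpha> (0, 1) ^ l)) = subdegree (\<alpha> (1, 0) ^ i * \<alpha> (0, 1) ^ j)"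
    by (simp add: eq)
  then have "int (subdegree (\<alpha> m)) + (int k * P + int l * Q) = int i * P + int j * Q"
    using nz nzm by (simp add: P_def Q_def flip: of_nat_mult of_nat_add)
  moreover have "fst m = int i - int k" "snd m = int j - int l" by (auto simp: i_def j_def k_def l_def)
  ultimately have s: "P * fst m + Q * snd m = int (subdegree (\<alpha> m))"
    by (simp only:) (simp add: algebra_simps)
  show "0 \<le> P * fst m + Q * snd m" unfolding s by simp
  show "P * fst m + Q * snd m = 0 \<longleftrightarrow> \<phi> m \<noteq> 0"
    unfolding s using nzm val by (simp add: subdegree_eq_0_iff)
qed

lemma nth_monomial_subdegree:
  fixes \<alpha> \<beta> :: "complex fps"
  defines "P \<equiv> subdegree \<alpha>" and "Q \<equiv> subdegree \<beta>"
  assumes "M \<le> P * i + Q * j"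
  shows "fps_nth (\<alpha> ^ i * \<beta> ^ j) M
    = (if P * i + Q * j = M then fps_nth \<alpha> P ^ i * fps_nth \<beta> Q ^ j else 0)"
proof -
  have \<alpha>: "\<alpha> = fps_shift P \<alpha> * fps_X ^ P" and \<beta>: "\<beta> = fps_shift Q \<beta> * fps_X ^ Q"
    unfolding P_def Q_def by (rule subdegree_decompose)+
  have "\<alpha> ^ i * \<beta> ^ j = fps_X ^ (P * i + Q * j) * (fps_shift P \<alpha> ^ i * fps_shift Q \<beta> ^ j)"
    by (subst \<alpha>, subst \<beta>) (simp add: power_mult_distrib power_add ac_simps flip: power_mult)
  then show ?thesis using assms(3)
    by (auto simp: fps_X_power_mult_nth fps_power_zeroth)
qed

text \<open>The coefficient at exponent \<open>M\<close> of the composed series is the initial form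
  of \<open>g\<close> for the orders (P, Q), evaluated at the leading coefficients of the arc;
  heavier monomials start later.\<close>

lemma subst1_lowest:
  fixes \<alpha> \<beta> :: "complex fps"
  defines "P \<equiv> subdegree \<alpha>" and "Q \<equiv> subdegree \<beta>"
  assumes M: "\<And>i j. coeff2 g i j \<noteq> 0 \<Longrightarrow> M \<le> P * i + Q * j" and z: "subst1 g \<alpha> \<beta> = 0"
  shows "(\<Sum>v\<in>{(i, j). i \<le> M \<and> j \<le> M \<and> P * i + Q * j = M}.
      coeff2 g (fst v) (snd v) * (fps_nth \<alpha> P ^ fst v * fps_nth \<beta> Q ^ snd v)) = 0"
proof -
  have "0 = fps_nth (subst1 g \<alpha> \<beta>) M" by (simp add: z)
  also have "\<dots> = (\<Sum>v\<in>{..M} \<times> {..M}. coeff2 g (fst v) (snd v) * fps_nth (\<alpha> ^ fst v * \<beta> ^ snd v) M)"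
    by (simp add: subst1_def sum.cartesian_product split_def)
  also have "\<dots> = (\<Sum>v\<in>{(i, j). i \<le> M \<and> j \<le> M \<and> P * i + Q * j = M}.
      coeff2 g (fst v) (snd v) * (fps_nth \<alpha> P ^ fst v * fps_nth \<beta> Q ^ snd v))"
  proof (rule sum.mono_neutral_cong_right)
    show "\<forall>v\<in>{..M} \<times> {..M} - {(i, j). i \<le> M \<and> j \<le> M \<and> P * i + Q * j = M}.
        coeff2 g (fst v) (snd v) * fps_nth (\<alpha> ^ fst v * \<beta> ^ snd v) M = 0"
    proof
      fix v assume v: "v \<in> {..M} \<times> {..M} - {(i, j). i \<le> M \<and> j \<le> M \<and> P * i + Q * j = M}"
      then have "P * fst v + Q * snd v \<noteq> M" by auto
      then show "coeff2 g (fst v) (snd v) * fps_nth (\<alpha> ^ fst v * \<beta> ^ snd v) M = 0"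
        using nth_monomial_subdegree[of M \<alpha> "fst v" \<beta> "snd v"] M[of "fst v" "snd v"]
        by (cases "coeff2 g (fst v) (snd v) = 0") (auto simp: P_def Q_def)
    qed
    show "coeff2 g (fst v) (snd v) * fps_nth (\<alpha> ^ fst v * \<beta> ^ snd v) M
        = coeff2 g (fst v) (snd v) * (fps_nth \<alpha> P ^ fst v * fps_nth \<beta> Q ^ snd v)"
      if "v \<in> {(i, j). i \<le> M \<and> j \<le> M \<and> P * i + Q * j = M}" for v
      using nth_monomial_subdegree[of M \<alpha> "fst v" \<beta> "snd v"] that by (auto simp: P_def Q_def)
  qed auto
  finally show ?thesis ..
qed

section \<open>Boundary points of the strict transform\<close>


text \<open>
  The data of a point of the strict transform on the boundary: the primitive vector of its ray, the
  weight \<open>M\<close> of the corresponding edge, two distinct points of the edge, the coordinate \<open>c\<close>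
  of the point on its orbit and an equation for \<open>c\<close>.
\<close>

definition edge_point :: "series2 \<Rightarrow> toric_point \<Rightarrow> nat \<Rightarrow> nat \<Rightarrow> nat \<Rightarrow> complex \<Rightarrow> bool" where
  "edge_point g z p q M c \<longleftrightarrow> p > 0 \<and> q > 0 \<and> coprime p q \<and> c \<noteq> 0 \<and>
     fst z = ray p q \<and> monoid_hom_on (dual_monoid (fst z)) (snd z) \<and> {m. snd z m \<noteq> 0} = perp (fst z) \<and>
     c = snd z (- int q, int p) \<and>
     (\<forall>i j. coeff2 g i j \<noteq> 0 \<longrightarrow> M \<le> p * i + q * j) \<and>
     (\<exists>i1 j1 i2 j2. coeff2 g i1 j1 \<noteq> 0 \<and> coeff2 g i2 j2 \<noteq> 0 \<and> (i1, j1) \<noteq> (i2, j2) \<and>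
        p * i1 + q * j1 = M \<and> p * i2 + q * j2 = M) \<and>
     (\<forall>a b. a * p = 1 + b * q \<longrightarrow>
        (\<Sum>v\<in>{(i, j). i \<le> M \<and> j \<le> M \<and> p * i + q * j = M}. coeff2 g (fst v) (snd v) * c ^ (b * fst v + a * snd v)) = 0)"

text \<open>\<open>m\<close> is the multiple \<open>l\<close> of the generator (-q, p) of the
  orthogonal lattice, so the value there determines a point of the orbit. Negative multiples appear
  as positive powers on the left.\<close>

lemma orbit_hom:
  fixes p q a b :: nat
  assumes \<tau>: "\<tau> = ray p q" and ab: "a * p = 1 + b * q"
    and hom: "monoid_hom_on (dual_monoid \<tau>) \<phi>" and m: "m \<in> perp \<tau>"
  defines "l \<equiv> int b * fst m + int a * snd m"
  shows "\<phi> m * \<phi> (- int q, int p) ^ nat (- l) = \<phi> (- int q, int p) ^ nat l"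
proof -
  let ?m0 = "(- int q, int p)"
  have dual: "m \<in> dual_monoid \<tau> \<longleftrightarrow> 0 \<le> int p * fst m + int q * snd m"
    "m \<in> perp \<tau> \<longleftrightarrow> int p * fst m + int q * snd m = 0" for m
    using dual_monoid_ray[of m "int p" "int q"] unfolding \<tau> by simp_all
  have k: "int p * fst m + int q * snd m = 0" using m by (simp add: dual)
  have uni: "int a * int p = 1 + int b * int q" using ab by (metis of_nat_mult of_nat_add of_nat_1)
  have "fst m * (int a * int p - int b * int q) = int a * (int p * fst m + int q * snd m) - int q * l"
    unfolding l_def by (simp add: algebra_simps)
  then have f: "fst m = - (int q * l)" using uni k by simp
  have "snd m * (int a * int p - int b * int q) = int p * l - int b * (int p * fst m + int q * snd m)"
    unfolding l_def by (simp add: algebra_simps)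
  then have s: "snd m = int p * l" using uni k by simp
  have m0: "?m0 \<in> dual_monoid \<tau>" by (simp add: dual)
  have pw: "(int n * - int q, int n * int p) \<in> dual_monoid \<tau>"
    "\<phi> (int n * - int q, int n * int p) = \<phi> ?m0 ^ n" for n
    using monoid_hom_power[OF hom m0, of n] by simp_all
  have l: "l = int (nat l) - int (nat (- l))" by simp
  have "m + (int (nat (- l)) * - int q, int (nat (- l)) * int p) = (int (nat l) * - int q, int (nat l) * int p)"
    unfolding prod_eq_iff fst_add snd_add fst_conv snd_conv f s
    by (subst (1 3) l, simp add: algebra_simps)
  moreover have "m \<in> dual_monoid \<tau>" by (simp add: dual k)
  ultimately have "\<phi> (int (nat l) * - int q, int (nat l) * int p)
      = \<phi> m * \<phi> (int (nat (- l)) * - int q, int (nat (- l)) * int p)"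
    using hom pw(1) unfolding monoid_hom_on_def by metis
  then show ?thesis unfolding pw(2) by simp
qed

text \<open>Cancellation of the lowest terms needs two support points of minimal weight for the
  order vector (P, Q), which therefore spans a ray of the fan. The cone of the origin contains (P,
  Q) in its relative interior, hence is this ray.\<close>

lemma strict_transform_edge_point:
  assumes z: "z \<in> strict_transform_boundary_points g" and g: "g \<noteq> 0"
  obtains p q M c where "edge_point g z p q M c"
proof -
  obtain \<tau> \<phi> where z': "z = (\<tau>, \<phi>)" by (cases z)
  obtain \<alpha> where bd: "(\<tau>, \<phi>) \<in> boundary_points g" and arc: "arc_at (\<tau>, \<phi>) \<alpha>"
    and nz: "\<alpha> (1, 0) \<noteq> 0" "\<alpha> (0, 1) \<noteq> 0" and s1: "subst1 g (\<alpha> (1, 0)) (\<alpha> (0, 1)) = 0"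
    using z unfolding z' strict_transform_boundary_points_def by blast
  have fan: "\<tau> \<in> newton_fan g" and hom: "monoid_hom_on (dual_monoid \<tau>) \<phi>" and perp: "{m. \<phi> m \<noteq> 0} = perp \<tau>"
    and \<phi>0: "\<phi> (1, 0) = 0" "\<phi> (0, 1) = 0"
    using bd by (auto simp: boundary_points_def toric_points_def)
  define P Q where "P = subdegree (\<alpha> (1, 0))" and "Q = subdegree (\<alpha> (0, 1))"
  note sub = newton_fan_subset_sigma0[OF fan]
  have ord: "0 \<le> int P * fst m + int Q * snd m" "int P * fst m + int Q * snd m = 0 \<longleftrightarrow> \<phi> m \<noteq> 0"
    if "m \<in> dual_monoid \<tau>" for m
    using arc_order[OF sub arc nz that] by (simp_all add: P_def Q_def)
  have e: "(1, 0) \<in> dual_monoid \<tau>" "(0, 1) \<in> dual_monoid \<tau>"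
    using sub by (auto simp: dual_monoid_def pairing_altdef sigma0_def)
  have PQ: "P > 0" "Q > 0" using ord[OF e(1)] ord[OF e(2)] \<phi>0 by auto
  obtain i j where "coeff2 g i j \<noteq> 0" using g by (metis series2_eqI coeff2_0)
  then have ex: "\<exists>n i j. coeff2 g i j \<noteq> 0 \<and> P * i + Q * j = n" by blast
  define N where "N = (LEAST n. \<exists>i j. coeff2 g i j \<noteq> 0 \<and> P * i + Q * j = n)"
  obtain i1 j1 where v1: "coeff2 g i1 j1 \<noteq> 0" "P * i1 + Q * j1 = N"
    using LeastI_ex[OF ex] unfolding N_def by blast
  have N: "N \<le> P * i + Q * j" if "coeff2 g i j \<noteq> 0" for i j
    unfolding N_def by (rule Least_le) (use that in blast)
  define x0 y0 where "x0 = fps_nth (\<alpha> (1, 0)) P" and "y0 = fps_nth (\<alpha> (0, 1)) Q"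
  have xy0: "x0 \<noteq> 0" "y0 \<noteq> 0" using nz by (simp_all add: x0_def y0_def P_def Q_def)
  let ?E = "{(i, j). i \<le> N \<and> j \<le> N \<and> P * i + Q * j = N}"
  have finE: "finite ?E" by (rule finite_subset[of _ "{..N} \<times> {..N}"]) auto
  have sum0: "(\<Sum>v\<in>?E. coeff2 g (fst v) (snd v) * (x0 ^ fst v * y0 ^ snd v)) = 0"
    using subst1_lowest[of g N "\<alpha> (1, 0)" "\<alpha> (0, 1)"] N s1 by (simp add: P_def Q_def x0_def y0_def)
  have inE: "(i, j) \<in> ?E" if "P * i + Q * j = N" for i j
  proof -
    have "1 * i \<le> P * i" "1 * j \<le> Q * j" using PQ by (intro mult_le_mono; simp)+
    then have "i \<le> N" "j \<le> N" using that by linarith+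
    then show ?thesis using that by simp
  qed
  \<comment> \<open>A lone monomial of weight \<open>N\<close> would survive, since
    \<open>x0\<close> and \<open>y0\<close> are nonzero.\<close>
  have "\<exists>i2 j2. coeff2 g i2 j2 \<noteq> 0 \<and> (i1, j1) \<noteq> (i2, j2) \<and> P * i2 + Q * j2 = N"
  proof (rule ccontr)
    assume no: "\<not> ?thesis"
    have "(\<Sum>v\<in>?E. coeff2 g (fst v) (snd v) * (x0 ^ fst v * y0 ^ snd v))
        = (\<Sum>v\<in>{(i1, j1)}. coeff2 g (fst v) (snd v) * (x0 ^ fst v * y0 ^ snd v))"
    proof (rule sum.mono_neutral_right)
      show "\<forall>v\<in>?E - {(i1, j1)}. coeff2 g (fst v) (snd v) * (x0 ^ fst v * y0 ^ snd v) = 0"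
      proof
        fix v assume v: "v \<in> ?E - {(i1, j1)}"
        obtain i j where ij: "v = (i, j)" by (cases v)
        have "P * i + Q * j = N" "(i1, j1) \<noteq> (i, j)" using v by (auto simp: ij)
        then have "coeff2 g i j = 0" using no by blast
        then show "coeff2 g (fst v) (snd v) * (x0 ^ fst v * y0 ^ snd v) = 0" by (simp add: ij)
      qed
    qed (use inE[OF v1(2)] finE in auto)
    then show False using sum0 v1(1) xy0 by simp
  qed
  then obtain i2 j2 where v2: "coeff2 g i2 j2 \<noteq> 0" "(i1, j1) \<noteq> (i2, j2)" "P * i2 + Q * j2 = N" by blast
  have "ray P Q \<in> newton_rays g" by (rule ray_in_newton_rays[OF PQ N v1 v2(1,3,2)])
  then have "\<tau> = ray (real_of_int (int P)) (real_of_int (int Q))"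
    using ord perp PQ fan by (intro order_vector_newton_fan) auto
  then have \<tau>: "\<tau> = ray P Q" by simp
  \<comment> \<open>(P, Q) need not be primitive, for instance on a ramified arc; weights are
    divided by the gcd.\<close>
  define d where "d = gcd P Q"
  obtain p q where pq: "P = d * p" "Q = d * q" "coprime p q"
  proof -
    have "gcd P Q \<noteq> 0" using PQ by simp
    then obtain p q where pq: "P = p * gcd P Q" "Q = q * gcd P Q" "coprime p q"
      by (metis gcd_coprime_exists)
    show ?thesis
    proof (rule that)
      show "P = d * p" unfolding d_def by (subst mult.commute) (rule pq(1))
      show "Q = d * q" unfolding d_def by (subst mult.commute) (rule pq(2))
    qed (rule pq(3))
  qed
  have d: "d > 0" using PQ by (simp add: d_def)
  have pos: "p > 0" "q > 0" using PQ pq by auto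
  have \<tau>': "\<tau> = ray p q" unfolding \<tau> pq(1,2) using ray_scale[of "real d" p q] d by simp
  define M where "M = p * i1 + q * j1"
  have NM: "N = d * M" using v1(2) by (simp add: M_def pq(1,2) algebra_simps)
  have wt: "P * i + Q * j = d * (p * i + q * j)" for i j by (simp add: pq(1,2) algebra_simps)
  define c where "c = \<phi> (- int q, int p)"
  have dual: "m \<in> dual_monoid \<tau> \<longleftrightarrow> 0 \<le> int p * fst m + int q * snd m"
    "m \<in> perp \<tau> \<longleftrightarrow> int p * fst m + int q * snd m = 0" for m
    using dual_monoid_ray[of m "int p" "int q"] unfolding \<tau>' by simp_all
  have m0: "(- int q, int p) \<in> perp \<tau>" "(- int q, int p) \<in> dual_monoid \<tau>" by (simp_all add: dual)
  have c: "c \<noteq> 0" using m0 perp by (auto simp: c_def)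
  \<comment> \<open>Leading coefficients in \<alpha>(-q, p) \<alpha>(1, 0)^q = \<alpha>(0, 1)^p,
    compared at the exponent P q = Q p.\<close>
  have c_eq: "c * x0 ^ q = y0 ^ p"
  proof -
    have ahom: "monoid_hom_on (dual_monoid \<tau>) \<alpha>" using arc by (simp add: arc_at_def)
    have "(- int q, int p) + (int q, 0) = (0, int p)" by simp
    moreover have "(int q, 0) \<in> dual_monoid \<tau>" "\<alpha> (int q, 0) = \<alpha> (1, 0) ^ q" "\<alpha> (0, int p) = \<alpha> (0, 1) ^ p"
      using monoid_hom_power[OF ahom e(1), of q] monoid_hom_power[OF ahom e(2), of p] by simp_all
    ultimately have "\<alpha> (- int q, int p) * \<alpha> (1, 0) ^ q = \<alpha> (0, 1) ^ p"
      using ahom m0(2) by (metis monoid_hom_on_def)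
    then have "fps_nth (\<alpha> (- int q, int p) * \<alpha> (1, 0) ^ q) (P * q) = fps_nth (\<alpha> (0, 1) ^ p) (P * q)" by simp
    moreover have "fps_nth (\<alpha> (0, 1) ^ p) (P * q) = y0 ^ p"
      using nth_monomial_subdegree[of "P * q" "\<alpha> (1, 0)" 0 "\<alpha> (0, 1)" p]
      by (simp add: Q_def[symmetric] y0_def pq(1,2))
    moreover have "fps_nth (\<alpha> (- int q, int p) * \<alpha> (1, 0) ^ q) (P * q) = c * x0 ^ q"
    proof -
      have "\<alpha> (1, 0) = fps_shift P (\<alpha> (1, 0)) * fps_X ^ P" unfolding P_def by (rule subdegree_decompose)
      then have eq: "\<alpha> (- int q, int p) * \<alpha> (1, 0) ^ q
          = fps_X ^ (P * q) * (\<alpha> (- int q, int p) * fps_shift P (\<alpha> (1, 0)) ^ q)"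
        by (metis (no_types) power_mult power_mult_distrib mult.left_commute mult.commute)
      have "fps_nth (\<alpha> (- int q, int p)) 0 = c" using arc m0(2) by (auto simp: arc_at_def c_def)
      then show ?thesis unfolding eq by (simp add: fps_X_power_mult_nth fps_power_zeroth x0_def)
    qed
    ultimately show ?thesis by simp
  qed
  have root: "(\<Sum>v\<in>{(i, j). i \<le> M \<and> j \<le> M \<and> p * i + q * j = M}. coeff2 g (fst v) (snd v) * c ^ (b * fst v + a * snd v)) = 0"
    if ab: "a * p = 1 + b * q" for a b
  proof -
    let ?E' = "{(i, j). i \<le> M \<and> j \<le> M \<and> p * i + q * j = M}"
    have EE: "?E' = ?E"
    proof -
      have "i \<le> M \<and> j \<le> M" if "p * i + q * j = M" for i j
      proof -
        have "1 * i \<le> p * i" "1 * j \<le> q * j" using pos by (intro mult_le_mono; simp)+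
        then show ?thesis using that by linarith
      qed
      then have E': "i \<le> M \<and> j \<le> M \<and> p * i + q * j = M \<longleftrightarrow> p * i + q * j = M" for i j by blast
      have E: "i \<le> N \<and> j \<le> N \<and> P * i + Q * j = N \<longleftrightarrow> P * i + Q * j = N" for i j using inE[of i j] by blast
      have "P * i + Q * j = N \<longleftrightarrow> p * i + q * j = M" for i j unfolding wt NM using d by simp
      moreover have "?E' = {(i, j). p * i + q * j = M}" by (simp only: E')
      moreover have "?E = {(i, j). P * i + Q * j = N}" by (simp only: E)
      ultimately show ?thesis by simp
    qed
    \<comment> \<open>Multiplication by x0^(a M) eliminates \<open>c\<close> through c x0^q = y0^p
      and leaves the common factor y0^(b M), so the sum in \<open>c\<close> is a nonzero multiple of
      the vanishing initial form.\<close>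
    have "(c ^ (b * fst v + a * snd v)) * (x0 ^ (a * M)) = (x0 ^ fst v * y0 ^ snd v) * y0 ^ (b * M)"
      if v: "v \<in> ?E'" for v
    proof -
      obtain i j where ij: "v = (i, j)" "p * i + q * j = M" using v by auto
      have "a * M = (a * p) * i + a * (q * j)" unfolding ij(2)[symmetric] by (simp add: algebra_simps)
      then have 1: "a * M = i + q * (b * i + a * j)" unfolding ab by (simp add: algebra_simps)
      have "j + b * M = (1 + b * q) * j + b * (p * i)" unfolding ij(2)[symmetric] by (simp add: algebra_simps)
      then have 2: "j + b * M = p * (b * i + a * j)" unfolding ab[symmetric] by (simp add: algebra_simps)
      have "c ^ (b * i + a * j) * x0 ^ (a * M) = x0 ^ i * (c * x0 ^ q) ^ (b * i + a * j)"
        unfolding 1 by (simp only: power_add power_mult power_mult_distrib mult_ac)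
      also have "\<dots> = x0 ^ i * y0 ^ (j + b * M)" unfolding c_eq 2 by (simp add: power_mult)
      finally show ?thesis by (simp add: ij power_add)
    qed
    then have "(\<Sum>v\<in>?E'. coeff2 g (fst v) (snd v) * c ^ (b * fst v + a * snd v)) * x0 ^ (a * M)
        = (\<Sum>v\<in>?E'. coeff2 g (fst v) (snd v) * (x0 ^ fst v * y0 ^ snd v)) * y0 ^ (b * M)"
      unfolding sum_distrib_right by (intro sum.cong refl) (simp add: mult.assoc)
    also have "\<dots> = 0" unfolding EE sum0 by simp
    finally show ?thesis using xy0 by simp
  qed
  have M1: "M \<le> p * i + q * j" if "coeff2 g i j \<noteq> 0" for i j
    using N[OF that] d unfolding wt NM by simp
  have M2: "p * i2 + q * j2 = M" using v2(3) d unfolding wt NM by simp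
  have "edge_point g z p q M c"
    unfolding edge_point_def z' fst_conv snd_conv
    using pos pq(3) c \<tau>' hom perp c_def M1 v1(1) v2(1,2) M_def[symmetric] M2 root by blast
  then show ?thesis by (rule that)
qed

text \<open>For p = 1 the Bezout coefficients are fixed so as to give the plain chart x = u, y = u^q
  (c + v) required by \<open>contact_lift\<close>.\<close>

lemma edge_point_chart:
  assumes "edge_point g z p q M c"
  obtains a b where "newton_chart g p q a b M c" "p = 1 \<Longrightarrow> a = 1 \<and> b = 0"
proof -
  note ep = assms[unfolded edge_point_def]
  have "\<exists>a b. a * p = 1 + b * q \<and> (p = 1 \<longrightarrow> a = 1 \<and> b = 0)"
  proof (cases "p = 1")
    case False
    obtain a b where "a * p = b * q + gcd p q" using bezout_nat[of p q] ep by (auto simp: mult.commute)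
    then show ?thesis using ep False by (metis coprime_iff_gcd_eq_1 add.commute)
  qed simp
  then obtain a b where ab: "a * p = 1 + b * q" "p = 1 \<longrightarrow> a = 1 \<and> b = 0" by blast
  have "newton_chart g p q a b M c"
    using ep ab(1) by unfold_locales blast+
  then show ?thesis using that ab(2) by blast
qed

text \<open>A support point of minimal weight has the least exponent of x in its row, and its row
  index is at most \<delta>; so two row indices determine a ray. On one orbit the points inject into
  the roots of the nonzero polynomial \<open>P\<close>.\<close>

lemma finite_strict_transform_points:
  assumes \<delta>: "coeff2 g 0 \<delta> \<noteq> 0"
  shows "finite (strict_transform_boundary_points g)"
proof -
  let ?S = "strict_transform_boundary_points g"
  have g: "g \<noteq> 0" using \<delta> by auto
  define I where "I j = (LEAST i. coeff2 g i j \<noteq> 0)" for j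
  define T where "T = (\<lambda>(j1, j2). {n \<in> sigma0. fst n * (real (I j1) - real (I j2)) + snd n * (real j1 - real j2) = 0})"
  have "fst ` ?S \<subseteq> T ` ({..\<delta>} \<times> {..\<delta>})"
  proof
    fix \<tau> assume "\<tau> \<in> fst ` ?S"
    then obtain z where z: "z \<in> ?S" "\<tau> = fst z" by blast
    obtain p q M c where ep: "edge_point g z p q M c" using strict_transform_edge_point[OF z(1) g] .
    note ep' = ep[unfolded edge_point_def]
    have pos: "p > 0" "q > 0" using ep' by auto
    have Mle: "M \<le> p * i + q * j" if "coeff2 g i j \<noteq> 0" for i j using ep' that by blast
    have at: "I j = i \<and> j \<le> \<delta>" if "coeff2 g i j \<noteq> 0" "p * i + q * j = M" for i j
    proof
      show "I j = i" unfolding I_def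
      proof (rule Least_equality)
        fix y assume "coeff2 g y j \<noteq> 0"
        then have "p * i \<le> p * y" using Mle[of y j] that by linarith
        then show "i \<le> y" using pos by simp
      qed (rule that)
      have "q * j \<le> q * \<delta>" using Mle[OF \<delta>] that by linarith
      then show "j \<le> \<delta>" using pos by simp
    qed
    obtain i1 j1 i2 j2 where v: "coeff2 g i1 j1 \<noteq> 0" "coeff2 g i2 j2 \<noteq> 0" "(i1, j1) \<noteq> (i2, j2)"
        "p * i1 + q * j1 = M" "p * i2 + q * j2 = M" using ep' by blast
    note a1 = at[OF v(1,4)] and a2 = at[OF v(2,5)]
    have "real (p * i1 + q * j1) = real (p * i2 + q * j2)" using v by simp
    then have "real p * (real i1 - real i2) + real q * (real j1 - real j2) = 0" by (simp add: algebra_simps)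
    moreover have "(real i1 - real i2, real j1 - real j2) \<noteq> (0, 0)" using v(3) by auto
    ultimately have "T (j1, j2) = ray p q"
      using ray_eq_orthogonal[of p q "real i1 - real i2" "real j1 - real j2"] pos a1 a2 by (simp add: T_def)
    moreover have "\<tau> = ray p q" using ep' z(2) by blast
    ultimately show "\<tau> \<in> T ` ({..\<delta>} \<times> {..\<delta>})" using a1 a2 by (intro image_eqI[of _ _ "(j1, j2)"]) auto
  qed
  then have fin: "finite (fst ` ?S)" by (rule finite_subset) simp
  have "finite {z \<in> ?S. fst z = \<tau>}" for \<tau>
  proof (cases "{z \<in> ?S. fst z = \<tau>} = {}")
    case False
    then obtain z where z: "z \<in> ?S" "fst z = \<tau>" by blast
    obtain p q M c where ep: "edge_point g z p q M c" using strict_transform_edge_point[OF z(1) g] .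
    obtain a b where nc: "newton_chart g p q a b M c" using edge_point_chart[OF ep] by blast
    define P where "P = newton_chart.P g p q a b M"
    have P: "P \<noteq> 0" unfolding P_def by (rule newton_chart.P_nonzero[OF nc])
    have ab: "a * p = 1 + b * q" using nc by (simp add: newton_chart_def)
    have polyP: "poly P x = (\<Sum>v\<in>{(i, j). i \<le> M \<and> j \<le> M \<and> p * i + q * j = M}.
        coeff2 g (fst v) (snd v) * x ^ (b * fst v + a * snd v))" for x
      unfolding P_def newton_chart.P_def[OF nc] newton_chart.E_def[OF nc] newton_chart.ex_def[OF nc]
      by (simp add: poly_sum poly_monom split_def)
    note ep' = ep[unfolded edge_point_def]
    have M_char: "(\<exists>i j. coeff2 g i j \<noteq> 0 \<and> p * i + q * j = M) \<and> (\<forall>i j. coeff2 g i j \<noteq> 0 \<longrightarrow> M \<le> p * i + q * j)"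
      using ep' by blast
    have data: "poly P (snd w (- int q, int p)) = 0 \<and> monoid_hom_on (dual_monoid \<tau>) (snd w) \<and> {m. snd w m \<noteq> 0} = perp \<tau>"
      if w: "w \<in> ?S" "fst w = \<tau>" for w
    proof -
      obtain p' q' M' c' where "edge_point g w p' q' M' c'" using strict_transform_edge_point[OF w(1) g] .
      note ew = this[unfolded edge_point_def]
      \<comment> \<open>Primitive vectors of one ray coincide, and the weight is determined as the
        minimal one, so all points of the orbit share one polynomial.\<close>
      have "ray p' q' = ray p q" using ep' ew z w by auto
      then have "(real p, real q) \<in> ray p' q'" using self_in_ray by simp
      then have "real p * real q' = real q * real p'" by (auto simp: ray_def)
      then have "p * q' = q * p'" by (simp flip: of_nat_mult)
      moreover have "coprime p q" "coprime p' q'" using ep' ew by blast+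
      ultimately have "p = p' \<and> q = q'"
        using coprime_crossproduct_nat[of p q p' q'] by (simp add: mult.commute)
      then have pq: "p' = p" "q' = q" by simp_all
      note ew = ew[unfolded pq]
      have "(\<exists>i j. coeff2 g i j \<noteq> 0 \<and> p * i + q * j = M') \<and> (\<forall>i j. coeff2 g i j \<noteq> 0 \<longrightarrow> M' \<le> p * i + q * j)"
        using ew by blast
      then have MM: "M' = M" using M_char by (metis antisym)
      have "poly P c' = 0" unfolding polyP using ew ab unfolding MM by blast
      moreover have "c' = snd w (- int q, int p)" using ew by blast
      moreover have "monoid_hom_on (dual_monoid \<tau>) (snd w) \<and> {m. snd w m \<noteq> 0} = perp \<tau>"
        using ew unfolding w(2) by blast
      ultimately show ?thesis by simp
    qed
    have dual: "m \<in> dual_monoid \<tau> \<longleftrightarrow> 0 \<le> int p * fst m + int q * snd m"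
      "m \<in> perp \<tau> \<longleftrightarrow> int p * fst m + int q * snd m = 0" for m
      using dual_monoid_ray[of m "int p" "int q"] ep' z(2) by simp_all
    have "inj_on (\<lambda>w. snd w (- int q, int p)) {w \<in> ?S. fst w = \<tau>}"
    proof (rule inj_onI)
      fix v w assume v: "v \<in> {w \<in> ?S. fst w = \<tau>}" and w: "w \<in> {w \<in> ?S. fst w = \<tau>}"
        and eq: "snd v (- int q, int p) = snd w (- int q, int p)"
      note dv = data[of v] and dw = data[of w]
      have "snd v m = snd w m" for m
      proof (cases "m \<in> perp \<tau>")
        case False
        have "snd u m = 0" if "{m. snd u m \<noteq> 0} = perp \<tau>" for u :: toric_point
          using that False by blast
        then show ?thesis using dv dw v w by simp
      next
        case True
        let ?m0 = "(- int q, int p)" and ?l = "int b * fst m + int a * snd m"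
        have "\<tau> = ray p q" using ep' z(2) by blast
        then have orb: "snd u m * snd u ?m0 ^ nat (- ?l) = snd u ?m0 ^ nat ?l" if "u \<in> {w \<in> ?S. fst w = \<tau>}" for u
          using orbit_hom[OF _ ab _ True, of "snd u"] data[of u] that by simp
        have "?m0 \<in> perp \<tau>" by (simp add: dual)
        then have "snd v ?m0 \<noteq> 0" using dv v by blast
        then show ?thesis using orb[OF v] orb[OF w] eq by (metis mult_right_cancel power_not_zero)
      qed
      then show "v = w" using v w by (auto simp: prod_eq_iff fun_eq_iff)
    qed
    moreover have "(\<lambda>w. snd w (- int q, int p)) ` {w \<in> ?S. fst w = \<tau>} \<subseteq> {x. poly P x = 0}"
      using data by blast
    ultimately show ?thesis using poly_roots_finite[OF P] by (meson finite_imageD finite_subset)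
  next
    case True
    then show ?thesis by (simp only: finite.emptyI)
  qed
  then have "finite (\<Union>\<tau>\<in>fst ` ?S. {z \<in> ?S. fst z = \<tau>})" using fin by blast
  moreover have "(\<Union>\<tau>\<in>fst ` ?S. {z \<in> ?S. fst z = \<tau>}) = ?S" by blast
  ultimately show ?thesis by simp
qed

section \<open>New inputs\<close>


text \<open>Each prime factor of the power is removed either from \<open>b\<close> or from its
  cofactor.\<close>

lemma dvd_prime_power:
  fixes p :: "'a :: idom"
  assumes p: "prime_elem p" and "b * k = p ^ n"
  shows "\<exists>j. b dvd p ^ j \<and> p ^ j dvd b"
  using assms(2)
proof (induction n arbitrary: b k)
  case 0
  then have "b dvd p ^ 0 \<and> p ^ 0 dvd b" by (metis dvd_triv_left one_dvd power_0)
  then show ?case by blast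
next
  case (Suc n)
  have p0: "p \<noteq> 0" using p by (simp add: prime_elem_def)
  have "p dvd b * k" using Suc.prems by simp
  then consider b' where "b = p * b'" | k' where "k = p * k'"
    using prime_elem_dvd_multD[OF p] by (metis dvdE)
  then show ?case
  proof cases
    case 1
    then have "p * (b' * k) = p * p ^ n" using Suc.prems by (simp add: mult.assoc)
    then have "b' * k = p ^ n" using p0 by simp
    then obtain j where "b' dvd p ^ j \<and> p ^ j dvd b'" using Suc.IH by blast
    then have "b dvd p ^ Suc j \<and> p ^ Suc j dvd b" using 1 by (simp add: mult_dvd_mono)
    then show ?thesis by blast
  next
    case 2
    then have "p * (b * k') = p * p ^ n" using Suc.prems by (simp add: mult.left_commute)
    then have "b * k' = p ^ n" using p0 by simp
    then show ?thesis by (rule Suc.IH)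
  qed
qed

lemma prime_power_factor_unique:
  fixes p :: "'a :: idom"
  assumes p: "p \<noteq> 0" and eq: "p ^ m * a = p ^ n * b" and a: "\<not> p dvd a" and b: "\<not> p dvd b"
  shows "a = b"
proof -
  have le: "n \<le> m" if eq: "p ^ m * a = p ^ n * b" and a: "\<not> p dvd a" for m n a b
  proof (rule ccontr)
    assume "\<not> n \<le> m"
    then obtain k where k: "n = m + Suc k" using less_iff_Suc_add[of m n] by auto
    have "p ^ m * a = p ^ m * (p * (p ^ k * b))" using eq by (simp add: k power_add mult.assoc)
    then have "a = p * (p ^ k * b)" using p by simp
    then show False using a by simp
  qed
  have "m = n" using le[OF eq a] le[OF eq[symmetric] b] by simp
  then show ?thesis using eq p by simp
qed

lemma coords_linear_parts:
  assumes "jacobian0 f g \<noteq> 0"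
    and "coeff2 f 1 0 = \<alpha> * u + \<beta> * w" "coeff2 f 0 1 = \<alpha> * u' + \<beta> * w'"
    and "coeff2 g 1 0 = \<gamma> * u + \<delta> * w" "coeff2 g 0 1 = \<gamma> * u' + \<delta> * w'"
  shows "u * w' - u' * w \<noteq> 0"
proof -
  have "jacobian0 f g = (\<alpha> * \<delta> - \<beta> * \<gamma>) * (u * w' - u' * w)"
    unfolding jacobian0_def assms(2-5) by (simp add: algebra_simps)
  then show ?thesis using assms(1) by auto
qed

context newton_chart
begin

text \<open>Every monomial regular at the point is a product of powers of \<open>U\<close>,
  \<open>T\<close> and the inverse of \<open>T\<close>. So all linear parts of the \<Phi> m lie in
  the span of those of \<open>U\<close> and \<open>T\<close>, and two independent ones force
  \<open>U\<close> and V = T - c to be coordinates.\<close>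

lemma coordinates_at_chart:
  assumes ep: "edge_point g z p q M c" and co: "coordinates_at z \<Phi>"
  obtains U V where "coords U V" "\<Phi> (1, 0) = subst2 X U V" "\<Phi> (0, 1) = subst2 Y U V"
proof -
  define \<tau> where "\<tau> = fst z"
  \<comment> \<open>\<open>m0\<close> generates the lattice orthogonal to (p, q), and
    \<open>m1\<close> has pairing 1 with (p, q); together they form a basis of the
    exponents.\<close>
  define m0 m1 where "m0 = (- int q, int p)" and "m1 = (int a, - int b)"
  have hom: "monoid_hom_on (dual_monoid \<tau>) \<Phi>"
    and val: "\<And>m. m \<in> dual_monoid \<tau> \<Longrightarrow> coeff2 (\<Phi> m) 0 0 = snd z m"
    and jac: "\<exists>m\<in>dual_monoid \<tau>. \<exists>m'\<in>dual_monoid \<tau>. jacobian0 (\<Phi> m) (\<Phi> m') \<noteq> 0"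
    using co unfolding coordinates_at_def \<tau>_def by auto
  have perp: "{m. snd z m \<noteq> 0} = perp \<tau>" and c': "c = snd z m0" and \<tau>: "\<tau> = ray p q"
    using ep unfolding edge_point_def \<tau>_def m0_def by auto
  have uni: "int a * int p = 1 + int b * int q" using unimodular by (metis of_nat_mult of_nat_add of_nat_1)
  have dual: "m \<in> dual_monoid \<tau> \<longleftrightarrow> 0 \<le> int p * fst m + int q * snd m"
    "m \<in> perp \<tau> \<longleftrightarrow> int p * fst m + int q * snd m = 0" for m
    using dual_monoid_ray[of m "int p" "int q"] unfolding \<tau> by simp_all
  have m1: "m1 \<in> dual_monoid \<tau>" "m1 \<notin> perp \<tau>" using uni by (simp_all add: dual m1_def algebra_simps)
  have m0: "m0 \<in> dual_monoid \<tau>" "- m0 \<in> dual_monoid \<tau>" by (simp_all add: dual m0_def)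
  define U T T' where "U = \<Phi> m1" and "T = \<Phi> m0" and "T' = \<Phi> (- m0)"
  have U0: "coeff2 U 0 0 = 0" using val[OF m1(1)] m1(2) perp by (auto simp: U_def)
  have T0: "coeff2 T 0 0 = c" using val[OF m0(1)] c' by (simp add: T_def)
  have TT: "T * T' = 1"
    using hom m0 unfolding monoid_hom_on_def T_def T'_def by (metis add.right_inverse)
  define V where "V = T - cst c"
  have V0: "coeff2 V 0 0 = 0" by (simp add: V_def T0 coeff2_cst)
  have T: "T = cst c + V" by (simp add: V_def)
  have X: "\<Phi> (1, 0) = subst2 X U V"
  proof -
    have "(1, 0) = (int p * fst m1 + int b * fst m0, int p * snd m1 + int b * snd m0)"
      using uni by (simp add: m0_def m1_def algebra_simps)
    then have "\<Phi> (1, 0) = U ^ p * T ^ b"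
      using monoid_hom_monomial(2)[OF hom m1(1) m0(1), of p b] by (simp add: U_def T_def)
    then show ?thesis
      by (simp add: X_def W_def T subst2_mult U0 V0 subst2_power subst2_vx subst2_vy subst2_add subst2_cst)
  qed
  have Y: "\<Phi> (0, 1) = subst2 Y U V"
  proof -
    have "(0, 1) = (int q * fst m1 + int a * fst m0, int q * snd m1 + int a * snd m0)"
      using uni by (simp add: m0_def m1_def algebra_simps)
    then have "\<Phi> (0, 1) = U ^ q * T ^ a"
      using monoid_hom_monomial(2)[OF hom m1(1) m0(1), of q a] by (simp add: U_def T_def)
    then show ?thesis
      by (simp add: Y_def W_def T subst2_mult U0 V0 subst2_power subst2_vx subst2_vy subst2_add subst2_cst)
  qed
  define lin where "lin f \<longleftrightarrow> (\<exists>\<alpha> \<beta>. coeff2 f 1 0 = \<alpha> * coeff2 U 1 0 + \<beta> * coeff2 T 1 0 \<and>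
      coeff2 f 0 1 = \<alpha> * coeff2 U 0 1 + \<beta> * coeff2 T 0 1)" for f
  have lin_mult: "lin (f * g)" if f: "lin f" and g: "lin g" for f g
  proof -
    obtain \<alpha> \<beta> where f': "coeff2 f 1 0 = \<alpha> * coeff2 U 1 0 + \<beta> * coeff2 T 1 0"
      "coeff2 f 0 1 = \<alpha> * coeff2 U 0 1 + \<beta> * coeff2 T 0 1" using f unfolding lin_def by blast
    obtain \<gamma> \<delta> where g': "coeff2 g 1 0 = \<gamma> * coeff2 U 1 0 + \<delta> * coeff2 T 1 0"
      "coeff2 g 0 1 = \<gamma> * coeff2 U 0 1 + \<delta> * coeff2 T 0 1" using g unfolding lin_def by blast
    show ?thesis unfolding lin_def coeff2_mult_10 coeff2_mult_01 f' g'
      by (intro exI[of _ "coeff2 f 0 0 * \<gamma> + coeff2 g 0 0 * \<alpha>"] exI[of _ "coeff2 f 0 0 * \<delta> + coeff2 g 0 0 * \<beta>"])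
        (simp add: algebra_simps)
  qed
  have lin1: "lin 1" unfolding lin_def by (intro exI[of _ 0]) (simp add: coeff2_1)
  have lin_power: "lin (f ^ n)" if "lin f" for f n
    by (induction n) (use that lin1 lin_mult in auto)
  have linU: "lin U" unfolding lin_def by (intro exI[of _ 1] exI[of _ 0]) simp
  have linT: "lin T" unfolding lin_def by (intro exI[of _ 0] exI[of _ 1]) simp
  have linT': "lin T'"
  proof -
    have "coeff2 T' 0 0 * c = 1" using arg_cong[OF TT, of "\<lambda>f. coeff2 f 0 0"] T0 by (simp add: coeff2_1 mult.commute)
    then have k: "coeff2 T' 0 0 = 1 / c" using c by (simp add: field_simps)
    have "c * coeff2 T' 1 0 + coeff2 T 1 0 * coeff2 T' 0 0 = 0" "c * coeff2 T' 0 1 + coeff2 T 0 1 * coeff2 T' 0 0 = 0"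
      using coeff2_mult_10[of T T'] coeff2_mult_01[of T T'] by (simp_all add: TT T0 coeff2_1)
    \<comment> \<open>The product rule for \<open>T * T' = 1\<close>: the linear part of the inverse
      is -1/c^2 times that of \<open>T\<close>.\<close>
    then have "coeff2 T' 1 0 = 0 * coeff2 U 1 0 + (- 1 / c\<^sup>2) * coeff2 T 1 0"
      "coeff2 T' 0 1 = 0 * coeff2 U 0 1 + (- 1 / c\<^sup>2) * coeff2 T 0 1"
      using c by (simp_all add: k field_simps power2_eq_square eq_neg_iff_add_eq_0)
    then show ?thesis unfolding lin_def by blast
  qed
  have lin: "lin (\<Phi> m)" if m: "m \<in> dual_monoid \<tau>" for m
  proof -
    define k where "k = nat (int p * fst m + int q * snd m)"
    define l where "l = int b * fst m + int a * snd m"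
    have k: "int k = int p * fst m + int q * snd m" using m by (simp add: k_def dual)
    have "fst m * (int a * int p - int b * int q) = int k * int a - l * int q"
      unfolding k l_def by (simp add: algebra_simps)
    then have f: "fst m = int k * int a - l * int q" using uni by simp
    have "snd m * (int a * int p - int b * int q) = l * int p - int k * int b"
      unfolding k l_def by (simp add: algebra_simps)
    then have s: "snd m = l * int p - int k * int b" using uni by simp
    show ?thesis
    proof (cases "l \<ge> 0")
      case True
      then have "m = (int k * fst m1 + int (nat l) * fst m0, int k * snd m1 + int (nat l) * snd m0)"
        using f s by (simp add: prod_eq_iff m0_def m1_def algebra_simps)
      then have "\<Phi> m = U ^ k * T ^ nat l"
        using monoid_hom_monomial(2)[OF hom m1(1) m0(1), of k "nat l"] by (simp add: U_def T_def)
      then show ?thesis using lin_mult lin_power linU linT by metis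
    next
      case False
      then have "m = (int k * fst m1 + int (nat (- l)) * fst (- m0), int k * snd m1 + int (nat (- l)) * snd (- m0))"
        using f s by (simp add: prod_eq_iff m0_def m1_def algebra_simps)
      then have "\<Phi> m = U ^ k * T' ^ nat (- l)"
        using monoid_hom_monomial(2)[OF hom m1(1) m0(2), of k "nat (- l)"] by (simp add: U_def T'_def)
      then show ?thesis using lin_mult lin_power linU linT' by metis
    qed
  qed
  obtain m m' where mm: "m \<in> dual_monoid \<tau>" "m' \<in> dual_monoid \<tau>" "jacobian0 (\<Phi> m) (\<Phi> m') \<noteq> 0"
    using jac by blast
  have "coeff2 U 1 0 * coeff2 T 0 1 - coeff2 U 0 1 * coeff2 T 1 0 \<noteq> 0"
    using lin[OF mm(1)] lin[OF mm(2)] coords_linear_parts[OF mm(3)] unfolding lin_def by metis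
  then have "coords U V" using U0 V0 by (simp add: coords_def jacobian0_def V_def coeff2_cst)
  then show ?thesis using X Y that by blast
qed

text \<open>The product x y is U^(p + q) times a unit, so the reduced boundary is \<open>U\<close>;
  the total transform is U^M times the pull-back of \<open>h\<close>, which \<open>U\<close> does
  not divide. Hence \<open>B\<close> and \<open>D\<close> are determined up to units by any
  \<Phi>.\<close>

lemma new_input_chart:
  assumes ep: "edge_point g z p q M c" and ni: "new_input_at g z B D"
  shows "\<exists>U V. coords U V \<and> same_curve U B \<and> same_curve (subst2 h U V) D"
proof -
  obtain \<Phi> where co: "coordinates_at z \<Phi>" and bg: "boundary_germ \<Phi> B" and st: "strict_transform_germ g \<Phi> B D"
    using ni by (auto simp: new_input_at_def)
  obtain U V where UV: "coords U V" "\<Phi> (1, 0) = subst2 X U V" "\<Phi> (0, 1) = subst2 Y U V"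
    using coordinates_at_chart[OF ep co] .
  note UV0 = coordsD(1,2)[OF UV(1)]
  note prime = prime_coords[OF UV(1)]
  have U0: "U \<noteq> 0" and U1: "\<not> U dvd 1" using prime by (auto simp: prime_elem_def)
  obtain w where w: "W ^ (a + b) * w = 1" using W_unit by (metis dvd_def is_unit_power_iff dvd_power_same power_one)
  define s where "s = subst2 (W ^ (a + b)) U V"
  have "s * subst2 w U V = 1" unfolding s_def subst2_mult[OF UV0, symmetric] w by (rule subst2_1[OF UV0])
  then obtain t where st1: "s * t = 1" by blast
  have XY: "\<Phi> (1, 0) * \<Phi> (0, 1) = U ^ (p + q) * s"
  proof -
    have "X * Y = vx ^ (p + q) * W ^ (a + b)" using XY_monomial[of 1 1] by (simp add: add.commute)
    then show ?thesis unfolding UV(2,3) s_def subst2_mult[OF UV0, symmetric]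
      by (simp add: subst2_mult[OF UV0] subst2_power[OF UV0] subst2_vx[OF UV0])
  qed
  obtain r where r: "U ^ (p + q) * s = B * r" using bg XY by (auto simp: boundary_germ_def dvd_def)
  have "B * (r * t) = U ^ (p + q) * (s * t)" using r by (simp add: mult.assoc[symmetric])
  then have "B * (r * t) = U ^ (p + q)" by (simp add: st1)
  then obtain j where j: "B dvd U ^ j" "U ^ j dvd B" using dvd_prime_power[OF prime] by blast
  have "U dvd U ^ (p + q)" using pos by (intro dvd_power) simp
  then have "U dvd \<Phi> (1, 0) * \<Phi> (0, 1)" unfolding XY by (rule dvd_mult2)
  then have "\<exists>k. U dvd B ^ k" using bg unfolding boundary_germ_def by (meson dvd_trans)
  then have "U dvd B" using prime prime_elem_dvd_power by blast
  have "j = 1"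
  proof (rule ccontr)
    assume "j \<noteq> 1"
    then consider "j = 0" | "j \<ge> 2" by linarith
    then show False
    proof cases
      case 1
      then show False using \<open>U dvd B\<close> j(1) U1 by (auto dest: dvd_trans)
    next
      case 2
      then have "U ^ 2 dvd B" using j(2) by (meson dvd_trans le_imp_power_dvd)
      then show False using bg U1 by (auto simp: boundary_germ_def squarefree_def)
    qed
  qed
  then have UB: "same_curve U B" using j by (simp add: same_curve_def)
  obtain E k where E: "subst2 g (\<Phi> (1, 0)) (\<Phi> (0, 1)) = D * E" "E dvd B ^ k"
    and D: "\<And>q. q dvd D \<Longrightarrow> q dvd B \<Longrightarrow> q dvd 1" using st by (auto simp: strict_transform_germ_def)
  have "E dvd U ^ k" using E(2) UB dvd_power_same[of B U k] by (auto simp: same_curve_def intro: dvd_trans)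
  then obtain e where "U ^ k = E * e" by (auto simp: dvd_def)
  then obtain i where i: "E dvd U ^ i" "U ^ i dvd E" using dvd_prime_power[OF prime, of E e k] by metis
  obtain u where u: "coeff2 u 0 0 \<noteq> 0" "E = u * U ^ i"
    using same_curve_unit[of E "U ^ i"] i by (auto simp: same_curve_def)
  have "subst2 g (\<Phi> (1, 0)) (\<Phi> (0, 1)) = subst2 (subst2 g X Y) U V"
    unfolding UV(2,3) by (rule subst2_subst2[OF XY0 UV0, symmetric])
  also have "\<dots> = U ^ M * subst2 h U V"
    by (simp add: chart subst2_mult[OF UV0] subst2_power[OF UV0] subst2_vx[OF UV0])
  finally have eq: "U ^ i * (u * D) = U ^ M * subst2 h U V" by (simp add: E(1) u(2) algebra_simps)
  have "\<not> U dvd D" using D[of U] \<open>U dvd B\<close> U1 by blast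
  moreover have "\<not> U dvd u" using u(1) U1 by (meson dvd_trans series2_unit_iff)
  ultimately have 1: "\<not> U dvd u * D" using prime by (auto dest: prime_elem_dvd_multD)
  have "subst2 vx U V dvd subst2 h U V \<longleftrightarrow> vx dvd h" by (rule subst2_dvd_iff[OF UV(1)])
  then have 2: "\<not> U dvd subst2 h U V" using h_not_dvd by (simp add: subst2_vx[OF UV0])
  have uD: "u * D = subst2 h U V" by (rule prime_power_factor_unique[OF U0 eq 1 2])
  obtain u' where u': "1 = u * u'" using u(1) series2_unit_iff[of u] by (auto simp: dvd_def)
  have "D = u' * (u * D)" using u' by (metis mult.assoc mult.commute mult_1)
  then have "same_curve (subst2 h U V) D"
    unfolding same_curve_def uD[symmetric] by (metis dvd_triv_right)
  then show ?thesis using UV(1) UB by blast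
qed

text \<open>The chart itself serves: \<Phi> m is u to the pairing of m = (m1, m2) with (p, q), times
  \<open>W\<close> to the integer b m1 + a m2. Boundary and strict transform are then
  \<open>vx\<close> and \<open>h\<close>.\<close>

lemma new_input_exists:
  assumes ep: "edge_point g z p q M c"
  shows "\<exists>B D. new_input_at g z B D"
proof -
  define \<tau> where "\<tau> = fst z"
  have hom: "monoid_hom_on (dual_monoid \<tau>) (snd z)" and perp: "{m. snd z m \<noteq> 0} = perp \<tau>"
    and c': "c = snd z (- int q, int p)" and \<tau>: "\<tau> = ray p q"
    using ep unfolding edge_point_def \<tau>_def by auto
  have uni: "int a * int p = 1 + int b * int q" using unimodular by (metis of_nat_mult of_nat_add of_nat_1)
  have dual: "m \<in> dual_monoid \<tau> \<longleftrightarrow> 0 \<le> int p * fst m + int q * snd m"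
    "m \<in> perp \<tau> \<longleftrightarrow> int p * fst m + int q * snd m = 0" for m
    using dual_monoid_ray[of m "int p" "int q"] unfolding \<tau> by simp_all
  obtain W' where W': "W * W' = 1" using W_unit by (auto simp: dvd_def)
  \<comment> \<open>Integer powers of the unit \<open>W\<close>, negative exponents being taken on
    its inverse \<open>W'\<close>.\<close>
  define pw where "pw l = W ^ nat l * W' ^ nat (- l)" for l
  have can: "W ^ n * W' ^ n = 1" for n by (simp add: power_mult_distrib[symmetric] W')
  have pw: "pw l = W ^ x * W' ^ y" if "l = int x - int y" for l x y
  proof (cases "x \<ge> y")
    case True
    then obtain k where "x = y + k" using le_Suc_ex by blast
    then show ?thesis using that can[of y] by (simp add: pw_def power_add algebra_simps)
  next
    case False
    then obtain k where k: "y = x + k" using le_Suc_ex[of x y] by auto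
    have "W ^ x * W' ^ y = (W ^ x * W' ^ x) * W' ^ k" by (simp add: k power_add mult.assoc)
    also have "\<dots> = W' ^ k" by (simp add: can)
    finally show ?thesis using that k by (simp add: pw_def)
  qed
  have pw_add: "pw (l + l') = pw l * pw l'" for l l'
  proof -
    have "pw (l + l') = W ^ (nat l + nat l') * W' ^ (nat (- l) + nat (- l'))" by (rule pw) auto
    then show ?thesis by (simp add: pw_def power_add algebra_simps)
  qed
  define \<Phi> where "\<Phi> m = vx ^ nat (int p * fst m + int q * snd m) * pw (int b * fst m + int a * snd m)" for m
  have X: "\<Phi> (1, 0) = X" and Y: "\<Phi> (0, 1) = Y"
    by (simp_all add: \<Phi>_def X_def Y_def pw_def)
  have phom: "monoid_hom_on (dual_monoid \<tau>) \<Phi>"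
    unfolding monoid_hom_on_def
  proof (intro conjI ballI)
    show "\<Phi> 0 = 1" by (simp add: \<Phi>_def pw_def)
    fix m m' assume "m \<in> dual_monoid \<tau>" "m' \<in> dual_monoid \<tau>"
    then have n: "nat (int p * fst (m + m') + int q * snd (m + m'))
        = nat (int p * fst m + int q * snd m) + nat (int p * fst m' + int q * snd m')"
      by (simp add: dual algebra_simps flip: nat_add_distrib)
    have l: "int b * fst (m + m') + int a * snd (m + m')
        = (int b * fst m + int a * snd m) + (int b * fst m' + int a * snd m')"
      by (simp add: algebra_simps)
    show "\<Phi> (m + m') = \<Phi> m * \<Phi> m'"
      unfolding \<Phi>_def n l pw_add by (simp add: power_add mult_ac)
  qed
  have W0: "coeff2 W 0 0 = c" by (simp add: W_def coeff2_cst)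
  have val: "coeff2 (\<Phi> m) 0 0 = snd z m" if m: "m \<in> dual_monoid \<tau>" for m
  proof (cases "m \<in> perp \<tau>")
    case False
    then have "int p * fst m + int q * snd m > 0" using m dual by (simp add: less_le)
    then have "coeff2 (\<Phi> m) 0 0 = 0" by (simp add: \<Phi>_def)
    then show ?thesis using False perp by auto
  next
    case True
    then have k: "int p * fst m + int q * snd m = 0" by (simp add: dual)
    define l where "l = int b * fst m + int a * snd m"
    have P: "\<Phi> m = pw l" by (simp add: \<Phi>_def k l_def)
    have 1: "snd z m * c ^ nat (- l) = c ^ nat l"
      unfolding c' l_def by (rule orbit_hom[OF \<tau> unimodular hom True])
    have "coeff2 (W * W') 0 0 = 1" by (simp add: W' coeff2_1)
    then have "coeff2 W' 0 0 * c = 1" by (simp add: W0 mult.commute)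
    then have "coeff2 W' 0 0 ^ nat (- l) * c ^ nat (- l) = 1"
      by (simp add: power_mult_distrib[symmetric])
    then have "coeff2 (\<Phi> m) 0 0 * c ^ nat (- l) = c ^ nat l" by (simp add: P pw_def W0 mult.assoc)
    then show ?thesis using 1 c by (metis mult_right_cancel power_not_zero)
  qed
  have "\<Phi> (int a, - int b) = vx"
  proof -
    have "int p * int a - int q * int b = 1" using uni by (simp add: mult.commute)
    then show ?thesis by (simp add: \<Phi>_def pw_def mult.commute)
  qed
  moreover have "\<Phi> (- int q, int p) = W"
  proof -
    have "int a * int p - int b * int q = 1" using uni by simp
    then have "int b * - int q + int a * int p = 1" by simp
    then show ?thesis by (simp add: \<Phi>_def pw_def)
  qed
  moreover have "jacobian0 vx W \<noteq> 0" by (simp add: jacobian0_def coeff2_vx W_def coeff2_cst coeff2_vy)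
  moreover have "(int a, - int b) \<in> dual_monoid \<tau>" using uni by (simp add: dual algebra_simps)
  moreover have "(- int q, int p) \<in> dual_monoid \<tau>" by (simp add: dual)
  ultimately have "coordinates_at z \<Phi>"
    unfolding coordinates_at_def \<tau>_def[symmetric] using phom val by metis
  moreover have "boundary_germ \<Phi> vx"
    unfolding boundary_germ_def X Y
  proof (intro conjI exI)
    show "squarefree vx"
      unfolding squarefree_def
    proof (intro allI impI)
      fix x assume "x\<^sup>2 dvd vx"
      then obtain k where k: "vx = x * (x * k)" by (auto simp: dvd_def power2_eq_square mult.assoc)
      then show "x dvd 1"
        using prime_elem_irreducible[OF prime_vx] by (metis dvd_mult_left irreducibleD)
    qed
    have XY: "X * Y = vx ^ (p + q) * W ^ (a + b)" using XY_monomial[of 1 1] by (simp add: add.commute)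
    show "vx dvd X * Y" unfolding XY using pos by (intro dvd_mult2 dvd_power) simp
    have "X * Y * W' ^ (a + b) = vx ^ (p + q)" unfolding XY mult.assoc can by simp
    then show "X * Y dvd vx ^ (p + q)" by (metis dvd_triv_left)
  qed
  moreover have "strict_transform_germ g \<Phi> vx h"
    unfolding strict_transform_germ_def X Y
  proof (intro conjI exI allI impI)
    show "subst2 g X Y = h * vx ^ M" by (simp add: chart mult.commute)
    show "vx ^ M dvd vx ^ M" by simp
    fix r assume r: "r dvd h \<and> r dvd vx"
    then obtain k where k: "vx = r * k" by (auto simp: dvd_def)
    then have "r dvd 1 \<or> k dvd 1" using prime_elem_irreducible[OF prime_vx] by (metis irreducibleD)
    moreover have "\<not> k dvd 1"
    proof
      assume "k dvd 1"
      then have "vx dvd r" unfolding k by (metis dvd_refl mult_dvd_mono mult.right_neutral)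
      then show False using r h_not_dvd by (meson dvd_trans)
    qed
    ultimately show "r dvd 1" by blast
  qed
  ultimately show ?thesis unfolding new_input_at_def by blast
qed

end

section \<open>Termination\<close>


text \<open>On x = 0 the term with \<open>vx\<close> disappears, and \<open>z\<close> has no
  constant term, so its power has order at least \<open>n\<close>.\<close>

lemma contact_order:
  assumes "contact n 1 vx g" "j < n"
  shows "coeff2 g 0 j = 0"
proof -
  obtain z c e where z: "coords vx z" "g = c * z ^ n + e * vx" using assms(1) by (auto simp: contact_def)
  have "res0 vx = 0" using vx_dvd_iff[of vx] by simp
  then have r: "res0 g = res0 c * res0 z ^ n" by (simp add: z(2))
  define k where "k = fps_shift 1 (res0 z)"
  have "res0 z = fps_X * k"
    using coordsD(2)[OF z(1)] by (intro fps_ext) (simp add: k_def)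
  then have "res0 g = fps_X ^ n * (res0 c * k ^ n)" by (simp add: r power_mult_distrib mult_ac)
  then have "fps_nth (res0 g) j = 0" using assms(2) by (simp add: fps_X_power_mult_nth)
  then show ?thesis by simp
qed

lemma not_contact_order:
  assumes "\<not> contact (Suc d) 1 vx g"
  obtains \<delta> where "\<delta> \<le> d" "coeff2 g 0 \<delta> \<noteq> 0"
proof -
  have "\<not> (\<forall>i j. i < 1 \<longrightarrow> j < Suc d \<longrightarrow> coeff2 g i j = 0)" using assms contact_vxI[of 1 "Suc d" g] by blast
  then show ?thesis using that by (auto simp: less_Suc_eq_le)
qed

text \<open>Contact serves in negated form, so it is transported against the direction of the
  algorithm, from \<open>g\<close> back to \<open>C\<close>; the Jacobian condition goes forward.
  \<open>chart_transfer\<close> does the same between a chart and the new input.\<close>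

lemma expansion_transfer:
  assumes "expansion_in_cross L L' C g"
  shows "jacobian_power L C \<Longrightarrow> jacobian_power vx g"
    and "contact n N vx g \<Longrightarrow> contact n N L C"
    and "coords vx g \<Longrightarrow> cross L C"
proof -
  obtain x y where xy: "coords x y" "same_curve x L" "C = subst2 g x y"
    using expansion_in_cross_coords[OF assms] .
  have x: "subst2 vx x y = x" by (simp add: subst2_vx coordsD[OF xy(1)])
  obtain A B where AB: "coords A B" "\<And>f. subst2 (subst2 f x y) A B = f"
    using coords_inverse[OF xy(1)] by metis
  show "jacobian_power vx g" if "jacobian_power L C"
  proof -
    have "jacobian_power x C" using that xy(2) by (rule jacobian_power_same_curve[OF _ same_curve_sym])
      (simp add: same_curve_def)
    then have "jacobian_power (subst2 x A B) (subst2 C A B)" by (rule jacobian_power_subst2[OF AB(1)])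
    then show ?thesis using AB(2)[of vx] AB(2)[of g] by (simp add: x xy(3))
  qed
  show "contact n N L C" if "contact n N vx g"
    using contact_subst2[OF xy(1) that] xy(2) unfolding x xy(3)[symmetric]
    by (rule contact_same_curve) (simp add: same_curve_def)
  show "cross L C" if "coords vx g"
    using coords_subst2[OF that xy(1)] coords_same_curve[of x C L C] xy(2)
    unfolding x xy(3)[symmetric] cross_iff_coords by (simp add: same_curve_def)
qed

lemma chart_transfer:
  assumes UV: "coords U V" and B: "same_curve U B" and D: "same_curve (subst2 h U V) D"
  shows "smooth_branch B" and "jacobian_power vx h \<Longrightarrow> jacobian_power B D"
    and "contact n N B D \<Longrightarrow> contact n N vx h"
proof -
  have U: "subst2 vx U V = U" by (simp add: subst2_vx coordsD[OF UV])
  obtain A A' where A: "coords A A'" "\<And>f. subst2 (subst2 f U V) A A' = f"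
    using coords_inverse[OF UV] by metis
  show "smooth_branch B" using coords_smooth coords_same_curve[OF UV B] by (metis same_curve_def dvd_refl)
  show "jacobian_power B D" if "jacobian_power vx h"
    using jacobian_power_subst2[OF UV that] B D unfolding U by (rule jacobian_power_same_curve)
  show "contact n N vx h" if "contact n N B D"
  proof -
    have "contact n N U (subst2 h U V)"
      using that same_curve_sym[OF B] same_curve_sym[OF D] by (rule contact_same_curve)
    then show ?thesis using contact_subst2[OF A(1)] A(2)[of vx] A(2)[of h] by (metis U)
  qed
qed

lemma straighten:
  assumes "smooth_branch L"
  obtains L' g where "coords L L'" "subst2 g L L' = C"
    "\<And>n N. contact n N L C \<longleftrightarrow> contact n N vx g" "jacobian_power L C \<longleftrightarrow> jacobian_power vx g"
proof -
  obtain L' where L': "coords L L'" using smooth_branch_coords[OF assms] by blast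
  obtain A B where AB: "coords A B" "\<And>f. subst2 (subst2 f A B) L L' = f" "\<And>f. subst2 (subst2 f L L') A B = f"
    using coords_inverse[OF L'] by metis
  define g where "g = subst2 C A B"
  have C: "subst2 g L L' = C" by (simp add: g_def AB(2))
  have L: "subst2 vx L L' = L" by (simp add: subst2_vx coordsD[OF L'])
  then have x: "subst2 L A B = vx" using AB(3)[of vx] by simp
  have "contact n N L C \<longleftrightarrow> contact n N vx g" for n N
    using contact_subst2[OF AB(1), of n N L C] contact_subst2[OF L', of n N vx g] unfolding C L x g_def[symmetric] by blast
  moreover have "jacobian_power L C \<longleftrightarrow> jacobian_power vx g"
    using jacobian_power_subst2[OF AB(1), of L C] jacobian_power_subst2[OF L', of vx g]
    unfolding C L x g_def[symmetric] by blast
  ultimately show ?thesis using that L' C by blast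
qed

text \<open>Collects what every iteration owes apart from the descent: a choice of
  \<open>L'\<close>, finiteness and new inputs. What remains is recursion on inputs given, up to
  units, by u and \<open>h\<close> in new coordinates.\<close>

lemma iterate_chart:
  assumes L: "smooth_branch L" and C: "\<not> contact (Suc d) 1 L C" and nc: "\<not> cross L C"
    and rec: "\<And>L' g p q a b M c B D U V. \<lbrakk>expansion_in_cross L L' C g; newton_chart g p q a b M c;
      p = 1 \<Longrightarrow> a = 1 \<and> b = 0; coeff2 g 0 0 = 0; coords U V; same_curve U B;
      same_curve (subst2 (newton_chart.h g p q a b M c) U V) D\<rbrakk> \<Longrightarrow> algorithm_stops B D"
  shows "algorithm_stops L C"
proof (rule algorithm_stops.iterate[OF nc])
  show "\<exists>L'. cross L L'" using smooth_branch_coords[OF L] by (simp add: cross_iff_coords)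
next
  fix L' g assume "expansion_in_cross L L' C g"
  then have "\<not> contact (Suc d) 1 vx g" using expansion_transfer(2) C by blast
  then show "finite (strict_transform_boundary_points g)"
    by (rule not_contact_order) (rule finite_strict_transform_points)
next
  fix L' g z assume ex: "expansion_in_cross L L' C g" and z: "z \<in> strict_transform_boundary_points g"
  have "\<not> contact (Suc d) 1 vx g" using expansion_transfer(2)[OF ex] C by blast
  then have "g \<noteq> 0" by (rule not_contact_order) auto
  then obtain p q M c where ep: "edge_point g z p q M c" using strict_transform_edge_point[OF z] by blast
  obtain a b where "newton_chart g p q a b M c" using edge_point_chart[OF ep] by blast
  then show "\<exists>B D. new_input_at g z B D" using ep by (rule newton_chart.new_input_exists)
next
  fix L' g z B D assume ex: "expansion_in_cross L L' C g" and z: "z \<in> strict_transform_boundary_points g"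
    and ni: "new_input_at g z B D"
  have "\<not> contact (Suc d) 1 vx g" using expansion_transfer(2)[OF ex] C by blast
  then have "g \<noteq> 0" by (rule not_contact_order) auto
  then obtain p q M c where ep: "edge_point g z p q M c" using strict_transform_edge_point[OF z] by blast
  obtain a b where ch: "newton_chart g p q a b M c" and ab: "p = 1 \<Longrightarrow> a = 1 \<and> b = 0"
    using edge_point_chart[OF ep] by blast
  obtain U V where UV: "coords U V" "same_curve U B" "same_curve (subst2 (newton_chart.h g p q a b M c) U V) D"
    using newton_chart.new_input_chart[OF ch ep ni] by blast
  have "coeff2 g 0 0 = 0"
  proof (rule ccontr)
    assume g0: "coeff2 g 0 0 \<noteq> 0"
    \<comment> \<open>If \<open>g\<close> were a unit, the minimal weight would be 0, attained only
      at the origin, while an edge has two points.\<close>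
    have "M \<le> p * 0 + q * 0" using ep g0 unfolding edge_point_def by blast
    then have "M = 0" by simp
    moreover obtain i1 j1 i2 j2 where "(i1, j1) \<noteq> (i2, j2)" "p * i1 + q * j1 = M" "p * i2 + q * j2 = M"
      using ep unfolding edge_point_def by blast
    moreover have "p > 0" "q > 0" using ep unfolding edge_point_def by blast+
    ultimately show False by simp
  qed
  then show "algorithm_stops B D" using rec ex ch ab UV by blast
qed

text \<open>Lexicographic induction: outside on the bound \<open>d\<close> of the intersection
  number, inside on an exponent \<open>k\<close> of contact that \<open>C\<close> does not reach.
  For each value of \<open>d\<close> such a \<open>k\<close> is supplied by
  \<open>contact_bounded_vx\<close>.\<close>

lemma algorithm_stops_invariant:
  "smooth_branch L \<Longrightarrow> jacobian_power L C \<Longrightarrow> \<not> contact (Suc d) 1 L C \<Longrightarrow> algorithm_stops L C"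
proof (induction d arbitrary: L C rule: less_induct)
  case (less d)
  note L = less.prems(1) and jp = less.prems(2) and nct = less.prems(3)
  show ?case
  proof (cases "d \<le> 1")
    case True
    show ?thesis
    proof (cases "cross L C")
      case False
      show ?thesis
      proof (rule iterate_chart[OF L nct False])
        \<comment> \<open>For \<open>d \<le> 1\<close> there is nothing to iterate: \<open>g\<close>
          vanishes at the origin, so it has order exactly 1 on x = 0, and (L, C) would be a
          cross.\<close>
        fix L' g B D
        assume ex: "expansion_in_cross L L' C g" and g0: "coeff2 g 0 0 = 0"
        have "\<not> contact (Suc d) 1 vx g" using expansion_transfer(2)[OF ex] nct by blast
        then obtain \<delta> where \<delta>: "\<delta> \<le> d" "coeff2 g 0 \<delta> \<noteq> 0" by (rule not_contact_order)
        then have "\<delta> \<noteq> 0" using g0 by (metis)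
        then have "coeff2 g 0 1 \<noteq> 0" using \<delta> True by (cases "\<delta> = 1") auto
        then have "coords vx g" using g0 by (simp add: coords_def jacobian0_def coeff2_vx)
        then show "algorithm_stops B D" using expansion_transfer(3)[OF ex] False by blast
      qed
    qed (rule stop)
  next
    case False
    then obtain d' where d': "d = Suc d'" by (cases d) auto
    have d2: "d \<ge> 2" using False by simp
    have inner: "algorithm_stops L C"
      if "smooth_branch L" "jacobian_power L C" "\<not> contact (Suc d) 1 L C" "\<not> contact d k L C" for k L C
      using that
    proof (induction k arbitrary: L C)
      case 0
      \<comment> \<open>Contact with \<open>N = 0\<close> always holds, so the base case is
        contradictory.\<close>
      obtain z where "coords L z" using smooth_branch_coords[OF "0.prems"(1)] by blast
      moreover have "C = 0 * z ^ d + C * L ^ 0" by simp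
      ultimately have "contact d 0 L C" unfolding contact_def by blast
      then show ?case using "0.prems"(4) by blast
    next
      case (Suc k)
      show ?case
      proof (cases "cross L C")
        case False
        show ?thesis
        proof (rule iterate_chart[OF Suc.prems(1,3) False])
          fix L' g p q a b M c B D U V
          assume ex: "expansion_in_cross L L' C g" and ch: "newton_chart g p q a b M c"
            and ab: "p = 1 \<Longrightarrow> a = 1 \<and> b = 0"
            and UV: "coords U V" and B: "same_curve U B"
            and D: "same_curve (subst2 (newton_chart.h g p q a b M c) U V) D"
          let ?h = "newton_chart.h g p q a b M c"
          note tr = chart_transfer[OF UV B D]
          have "\<not> contact (Suc d) 1 vx g" using expansion_transfer(2)[OF ex] Suc.prems(3) by blast
          then obtain \<delta> where \<delta>: "\<delta> \<le> d" "coeff2 g 0 \<delta> \<noteq> 0" by (rule not_contact_order)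
          obtain l where l: "l \<le> \<delta>" "coeff2 ?h 0 l \<noteq> 0" using newton_chart.h_order[OF ch \<delta>(2)] by blast
          have jpB: "jacobian_power B D"
            using newton_chart.jacobian_power_h[OF ch] expansion_transfer(1)[OF ex Suc.prems(2)] tr(2) by blast
          have ncB: "\<not> contact (Suc d) 1 B D"
          proof
            assume "contact (Suc d) 1 B D"
            then have "coeff2 ?h 0 l = 0" using l(1) \<delta>(1) by (intro contact_order[of "Suc d"] tr(3)) auto
            then show False using l(2) by simp
          qed
          show "algorithm_stops B D"
          \<comment> \<open>If the intersection number falls below \<open>d\<close>, the outer
            induction applies with \<open>d - 1\<close>; otherwise the equality case fixes the shape
            of the chart and the contact falls.\<close>
          proof (cases "contact d 1 B D")
            case True
            have h0: "coeff2 ?h 0 j = 0" if "j < d" for j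
              by (rule contact_order[OF tr(3)[OF True] that])
            have p: "p = 1" and M: "M = q * d"
              using newton_chart.h_order_max[OF ch \<delta>(2,1) _ h0] d2 by auto
            have "\<not> contact d k B D"
            proof
              assume "contact d k B D"
              then have "contact d (Suc k) vx g"
                using newton_chart.contact_lift[OF ch p _ _ M l(2)] ab p l(1) \<delta>(1) tr(3) by auto
              then show False using expansion_transfer(2)[OF ex] Suc.prems(4) by blast
            qed
            then show ?thesis using Suc.IH tr(1) jpB ncB by blast
          next
            case False
            then show ?thesis using less.IH[of d' B D] tr(1) jpB by (simp add: d')
          qed
        qed
      qed (rule stop)
    qed
    have "\<exists>N. \<not> contact d N L C"
    proof -
      obtain L' g where g: "\<And>n N. contact n N L C \<longleftrightarrow> contact n N vx g" "jacobian_power L C \<longleftrightarrow> jacobian_power vx g"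
        using straighten[OF L, of C] by metis
      obtain j where "j \<le> d" "coeff2 g 0 j \<noteq> 0" using nct unfolding g(1) by (rule not_contact_order)
      then show ?thesis using contact_bounded_vx[of g j d] d2 jp g by blast
    qed
    then show ?thesis using inner L jp nct by blast
  qed
qed

theorem theorem4p23:
  fixes L C :: series2
  assumes "smooth_branch L"
    and "squarefree C"
    and "\<not> L dvd C"
  shows "algorithm_stops L C"
proof -
  obtain L' g where L': "coords L L'" and gC: "subst2 g L L' = C"
    and con: "\<And>n N. contact n N L C \<longleftrightarrow> contact n N vx g" and jp: "jacobian_power L C \<longleftrightarrow> jacobian_power vx g"
    using straighten[OF assms(1), of C] by metis
  note L0 = coordsD(1,2)[OF L']
  have sL: "subst2 vx L L' = L" by (rule subst2_vx[OF L0])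
  have nd: "\<not> vx dvd g" using subst2_dvd_iff[OF L', of vx g] assms(3) by (simp add: sL gC)
  have "squarefree g"
    unfolding squarefree_def
  proof (intro allI impI)
    fix x assume "x\<^sup>2 dvd g"
    then have "(subst2 x L L')\<^sup>2 dvd C" using subst2_dvd[OF L0, of "x\<^sup>2" g] by (simp add: subst2_power[OF L0] gC)
    then have "subst2 x L L' dvd 1" using assms(2) by (simp add: squarefree_def)
    then show "x dvd 1" by (simp add: series2_unit_iff)
  qed
  then have "jacobian_power L C" unfolding jp using nd by (rule squarefree_jacobian_power)
  \<comment> \<open>The index of a nonzero coefficient on x = 0, available because \<open>L\<close>
    does not divide \<open>C\<close>, bounds the intersection number and starts the
    induction.\<close>
  moreover obtain d where d: "coeff2 g 0 d \<noteq> 0" using nd by (auto simp: vx_dvd_iff fps_eq_iff)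
  have "\<not> contact (Suc d) 1 L C" unfolding con using contact_order d by blast
  ultimately show ?thesis using assms(1) by (intro algorithm_stops_invariant)
qed

end
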